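(* Let $E$ be a continuous tangent subbundle (distribution) of rank $m$ on $U\subset\mathbb{R}^{m+n}$. If $E$ is asymptotically involutive, then $E$ is integrable. If $E$ is integrable and exterior regular, then $E$ is uniquely integrable.
   Context: Integrability. $E$ is integrable if through every point $p\in U$ there is a local integral manifold, i.e. an $m$-dimensional $C^1$ submanifold $N\ni p$ with $T_qN=E_q$ for all $q\in N$. $E$ is uniquely integrable if it is integrable and whenever two integral manifolds intersect, their intersection is relatively open in both. Setting. $U\subset\mathbb{R}^{m+n}$ is open (e.g. a Euclidean ball), with coordinates $(x^1,\dots,x^m,y^1,\dots,y^n)$ chosen so that $E_p$ is transverse to $\mathcal{Y}_p:=\mathrm{span}\{\partial/\partial y^1,\dots,\partial/\partial y^n\}|_p$ for every $p\in U$. Norms are Euclidean (operator norms for linear maps). A sequence of rank $m$ subbundles $E^k$ on $U$ converges to $E$ (in angle) if the Hausdorff distance between the unit spheres of $E^k_p$ and $E_p$ tends to $0$ uniformly in $p\in U$ as $k\to\infty$; without loss of generality all $E^k$ are also transverse to $\mathcal{Y}$ on $U$. Frames. $\mathcal{A}^1(E^k)$ is the bundle of 1-forms annihilating $E^k$, and $F(\mathcal{A}^1(E^k))$ its frame bundle. A non-vanishing ($C^1$) section $A$ of $F(\mathcal{A}^1(E^k))$ on an open set $V\subset U$ is given by $n$ pointwise linearly independent $C^1$ 1-forms $\alpha_1,\dots,\alpha_n$ on $V$ with $E^k\subset\ker\alpha_j$. Write $A_p:\mathbb{R}^{m+n}\to\mathbb{R}^n$, $A_p(v)=(\alpha_1(v),\dots,\alpha_n(v))|_p$,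 so $\ker A_p=E^k_p$, and $dA_p(u,v)=(d\alpha_1(u,v),\dots,d\alpha_n(u,v))|_p$. The restriction of $dA_p$ to $E^k_p\times E^k_p$ is $dA|_{E^k_p}$. Since $\mathcal{Y}_p$ is transverse to $E^k_p$, $A_p|_{\mathcal{Y}_p}$ is invertible. For sections named $A^{k,i}$ (resp. $B^{k,i}$) put $A^{-k,i}_p:=(A^{k,i}_p|_{\mathcal{Y}_p})^{-1}:\mathbb{R}^n\to\mathcal{Y}_p$ (resp. $B^{-k,i}_p$). $\|\cdot\|_\infty$ is the supremum of the operator norm over the domain of definition. Compatible cover. A finite open cover $\{U^{k,i}\}_{i=1}^{s_k}$ of $U$ is compatible for non-vanishing sections $\{A^{k,i}\}_{i=1}^{s_k}$ of $F(\mathcal{A}^1(E^k))$, with $A^{k,i}$ defined on $U^{k,i}$, if $\|A^{k,i}_p\circ A^{-k,j}_p\|=1$ for all $i,j$ and all $p\in U^{k,i}\cap U^{k,j}$. Put $$M^{k,i}_A:=\sup\{|dA^{k,i}_p(A^{-k,i}_pw,v)|:\ p\in U^{k,i},\ v\in E^k_p,\ w\in\mathbb{R}^n,\ |v|=|w|=1\},$$ and similarly $M^{k,i}_B$. Asymptotic involutivity. $E$ is asymptotically involutive if there are a sequence of $C^1$ subbundles $E^k$ converging to $E$, an $\epsilon>0$ and, for every $k$, a compatible open cover $\{U^{k,i}\}_{i=1}^{s_k}$ of $U$ with non-vanishing sections $A^{k,i}$ of $F(\mathcal{A}^1(E^k))$ on $U^{k,i}$ such that $$\max_{i,j,\ell\in\{1,\dots,s_k\}}\|dA^{k,i}|_{E^k}\|_\infty\,\|A^{-k,j}\|_\infty\,e^{\epsilon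 M^{k,\ell}_A}\to0\quad\text{as }k\to\infty.$$ Exterior regularity. $E$ is exterior regular if there are a sequence of $C^1$ subbundles $E^k$ converging to $E$, an $\epsilon>0$ and, for every $k$, a compatible open cover $\{U^{k,i}\}_{i=1}^{s_k}$ of $U$ with non-vanishing sections $B^{k,i}$ of $F(\mathcal{A}^1(E^k))$ on $U^{k,i}$ such that $$\max_{i,j,\ell\in\{1,\dots,s_k\}}\|B^{k,i}|_{E}\|_\infty\,\|B^{-k,j}\|_\infty\,e^{\epsilon M^{k,\ell}_B}\to0\quad\text{as }k\to\infty,$$ where $\|B^{k,i}|_E\|_\infty=\sup_{p\in U^{k,i}}\|B^{k,i}_p|_{E_p}\|$. *)

theory Defs
  imports "HOL-Analysis.Analysis"
begin

text \<open>
  The space \<open>\<real>\<^sup>m\<^sup>+\<^sup>n\<close> with coordinates \<open>(x, y)\<close>; the norm of the product type is the Euclidean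
  one. A distribution is given by its fibres, of which only those over the domain \<open>U\<close> matter.
\<close>

type_synonym ('m, 'n) pt = "(real ^ 'm) \<times> (real ^ 'n)"

type_synonym ('m, 'n) distribution = "('m, 'n) pt \<Rightarrow> ('m, 'n) pt set"

type_synonym ('m, 'n) one_form = "('m, 'n) pt \<Rightarrow> (('m, 'n) pt \<Rightarrow>\<^sub>L real)"


section \<open>Subbundles and submanifolds\<close>

text \<open>Only meant for open \<open>S\<close>.\<close>

definition C1_on :: "'a::real_normed_vector set \<Rightarrow> ('a \<Rightarrow> 'b::real_normed_vector) \<Rightarrow> bool" where
  "C1_on S f \<longleftrightarrow>
    (\<exists>f' :: 'a \<Rightarrow> 'a \<Rightarrow>\<^sub>L 'b.
       (\<forall>x\<in>S. (f has_derivative blinfun_apply (f' x)) (at x)) \<and> continuous_on S f')"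

definition local_frame ::
  "('m::finite, 'n::finite) pt set \<Rightarrow> ('m, 'n) distribution \<Rightarrow>
   ('m \<Rightarrow> ('m, 'n) pt \<Rightarrow> ('m, 'n) pt) \<Rightarrow> bool" where
  "local_frame V E X \<longleftrightarrow>
    (\<forall>q\<in>V. inj (\<lambda>i. X i q) \<and> independent (range (\<lambda>i. X i q)) \<and>
            span (range (\<lambda>i. X i q)) = E q)"

definition continuous_subbundle ::
  "('m::finite, 'n::finite) pt set \<Rightarrow> ('m, 'n) distribution \<Rightarrow> bool" where
  "continuous_subbundle U E \<longleftrightarrow>
    (\<forall>p\<in>U. \<exists>V X. open V \<and> p \<in> V \<and> V \<subseteq> U \<and>
       (\<forall>i. continuous_on V (X i)) \<and> local_frame V E X)"

definition C1_subbundle ::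
  "('m::finite, 'n::finite) pt set \<Rightarrow> ('m, 'n) distribution \<Rightarrow> bool" where
  "C1_subbundle U E \<longleftrightarrow>
    (\<forall>p\<in>U. \<exists>V X. open V \<and> p \<in> V \<and> V \<subseteq> U \<and>
       (\<forall>i. C1_on V (X i)) \<and> local_frame V E X)"

definition vertical :: "('m::finite, 'n::finite) pt set" where
  "vertical = {v. fst v = 0}"

definition transverse_to_vertical ::
  "('m::finite, 'n::finite) pt set \<Rightarrow> ('m, 'n) distribution \<Rightarrow> bool" where
  "transverse_to_vertical U E \<longleftrightarrow> (\<forall>p\<in>U. {u + v |u v. u \<in> E p \<and> v \<in> vertical} = UNIV)"

definition C1_submanifold :: "('m::finite, 'n::finite) pt set \<Rightarrow> bool" where
  "C1_submanifold N \<longleftrightarrow>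
    (\<forall>q\<in>N. \<exists>(W :: ('m, 'n) pt set) (Z :: ('m, 'n) pt set) \<phi> \<psi>.
       open W \<and> q \<in> W \<and> open Z \<and> homeomorphism W Z \<phi> \<psi> \<and> C1_on W \<phi> \<and> C1_on Z \<psi> \<and>
       \<phi> ` (N \<inter> W) = {z \<in> Z. snd z = 0})"

definition tangent_space :: "('m::finite, 'n::finite) pt set \<Rightarrow> ('m, 'n) pt \<Rightarrow> ('m, 'n) pt set" where
  "tangent_space N q =
    {v. \<exists>\<delta>>0. \<exists>\<gamma> :: real \<Rightarrow> ('m, 'n) pt.
       C1_on {-\<delta><..<\<delta>} \<gamma> \<and> \<gamma> ` {-\<delta><..<\<delta>} \<subseteq> N \<and> \<gamma> 0 = q \<and>
       (\<gamma> has_vector_derivative v) (at 0)}"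

definition integral_manifold ::
  "('m::finite, 'n::finite) pt set \<Rightarrow> ('m, 'n) distribution \<Rightarrow> ('m, 'n) pt set \<Rightarrow> bool" where
  "integral_manifold U E N \<longleftrightarrow>
    N \<subseteq> U \<and> C1_submanifold N \<and> (\<forall>q\<in>N. tangent_space N q = E q)"

definition integrable_distribution ::
  "('m::finite, 'n::finite) pt set \<Rightarrow> ('m, 'n) distribution \<Rightarrow> bool" where
  "integrable_distribution U E \<longleftrightarrow> (\<forall>p\<in>U. \<exists>N. integral_manifold U E N \<and> p \<in> N)"

definition uniquely_integrable ::
  "('m::finite, 'n::finite) pt set \<Rightarrow> ('m, 'n) distribution \<Rightarrow> bool" where
  "uniquely_integrable U E \<longleftrightarrow>
    integrable_distribution U E \<and>
    (\<forall>N1 N2. integral_manifold U E N1 \<and> integral_manifold U E N2 \<and> N1 \<inter> N2 \<noteq> {} \<longrightarrow>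
       openin (top_of_set N1) (N1 \<inter> N2) \<and> openin (top_of_set N2) (N1 \<inter> N2))"


section \<open>Convergence in angle\<close>

definition hausdorff_dist :: "'a::metric_space set \<Rightarrow> 'a set \<Rightarrow> real" where
  "hausdorff_dist S T = max (SUP x\<in>S. infdist x T) (SUP y\<in>T. infdist y S)"

definition converges_in_angle ::
  "('m::finite, 'n::finite) pt set \<Rightarrow> (nat \<Rightarrow> ('m, 'n) distribution) \<Rightarrow>
   ('m, 'n) distribution \<Rightarrow> bool" where
  "converges_in_angle U Ek E \<longleftrightarrow>
    uniform_limit U (\<lambda>k p. hausdorff_dist (Ek k p \<inter> sphere 0 1) (E p \<inter> sphere 0 1)) (\<lambda>p. 0)
      sequentially"

definition approximating_sequence ::
  "('m::finite, 'n::finite) pt set \<Rightarrow> ('m, 'n) distribution \<Rightarrow>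
   (nat \<Rightarrow> ('m, 'n) distribution) \<Rightarrow> bool" where
  "approximating_sequence U E Ek \<longleftrightarrow>
    (\<forall>k. C1_subbundle U (Ek k) \<and> transverse_to_vertical U (Ek k)) \<and> converges_in_angle U Ek E"


section \<open>Frames of the annihilator bundle\<close>

definition annihilator_frame ::
  "('m::finite, 'n::finite) pt set \<Rightarrow> ('m, 'n) distribution \<Rightarrow> ('n \<Rightarrow> ('m, 'n) one_form) \<Rightarrow> bool" where
  "annihilator_frame V E \<alpha> \<longleftrightarrow>
    (\<forall>j. C1_on V (\<alpha> j)) \<and>
    (\<forall>p\<in>V. inj (\<lambda>j. \<alpha> j p) \<and> independent (range (\<lambda>j. \<alpha> j p)) \<and>
            (\<forall>j. \<forall>v\<in>E p. blinfun_apply (\<alpha> j p) v = 0))"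

definition frame_map ::
  "('n::finite \<Rightarrow> ('m::finite, 'n) one_form) \<Rightarrow> ('m, 'n) pt \<Rightarrow> ('m, 'n) pt \<Rightarrow> real ^ 'n" where
  "frame_map \<alpha> p v = (\<chi> j. blinfun_apply (\<alpha> j p) v)"

definition frame_inv ::
  "('n::finite \<Rightarrow> ('m::finite, 'n) one_form) \<Rightarrow> ('m, 'n) pt \<Rightarrow> real ^ 'n \<Rightarrow> ('m, 'n) pt" where
  "frame_inv \<alpha> p = inv_into vertical (frame_map \<alpha> p)"

text \<open>
  Exterior derivative of a 1-form, with the normalisation
  \<open>d\<alpha>(X, Y) = X(\<alpha>(Y)) - Y(\<alpha>(X)) - \<alpha>([X, Y])\<close>, evaluated on constant vector fields.
\<close>

definition ext_deriv ::
  "('m::finite, 'n::finite) one_form \<Rightarrow> ('m, 'n) pt \<Rightarrow> ('m, 'n) pt \<Rightarrow> ('m, 'n) pt \<Rightarrow> real" where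
  "ext_deriv \<omega> p u v =
    blinfun_apply (frechet_derivative \<omega> (at p) u) v - blinfun_apply (frechet_derivative \<omega> (at p) v) u"

definition frame_d ::
  "('n::finite \<Rightarrow> ('m::finite, 'n) one_form) \<Rightarrow> ('m, 'n) pt \<Rightarrow> ('m, 'n) pt \<Rightarrow> ('m, 'n) pt \<Rightarrow> real ^ 'n" where
  "frame_d \<alpha> p u v = (\<chi> j. ext_deriv (\<alpha> j) p u v)"

text \<open>
  Operator norms of a linear map, respectively a bilinear map, restricted to a subspace
  (compare \<open>onorm\<close>; the quotient by a zero norm is 0).
\<close>

definition onorm_on :: "'a::real_normed_vector set \<Rightarrow> ('a \<Rightarrow> 'b::real_normed_vector) \<Rightarrow> real" where
  "onorm_on S f = (SUP x\<in>S. norm (f x) / norm x)"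

definition bilinear_onorm_on ::
  "'a::real_normed_vector set \<Rightarrow> ('a \<Rightarrow> 'a \<Rightarrow> 'b::real_normed_vector) \<Rightarrow> real" where
  "bilinear_onorm_on S b = (SUP (u, v)\<in>S \<times> S. norm (b u v) / (norm u * norm v))"

text \<open>
  Suprema over the sets of a cover are taken in \<open>[0, \<infinity>]\<close>, since the sections need not be
  bounded there. In a product, \<open>0 * \<infinity> = 0\<close>.
\<close>

definition d_sup_norm ::
  "('m::finite, 'n::finite) pt set \<Rightarrow> ('m, 'n) distribution \<Rightarrow> ('n \<Rightarrow> ('m, 'n) one_form) \<Rightarrow> ennreal" where
  "d_sup_norm V E \<alpha> = (SUP p\<in>V. ennreal (bilinear_onorm_on (E p) (frame_d \<alpha> p)))"

definition restr_sup_norm ::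
  "('m::finite, 'n::finite) pt set \<Rightarrow> ('m, 'n) distribution \<Rightarrow> ('n \<Rightarrow> ('m, 'n) one_form) \<Rightarrow> ennreal" where
  "restr_sup_norm V E \<alpha> = (SUP p\<in>V. ennreal (onorm_on (E p) (frame_map \<alpha> p)))"

definition inv_sup_norm ::
  "('m::finite, 'n::finite) pt set \<Rightarrow> ('n \<Rightarrow> ('m, 'n) one_form) \<Rightarrow> ennreal" where
  "inv_sup_norm V \<alpha> = (SUP p\<in>V. ennreal (onorm (frame_inv \<alpha> p)))"

definition M_const ::
  "('m::finite, 'n::finite) pt set \<Rightarrow> ('m, 'n) distribution \<Rightarrow> ('n \<Rightarrow> ('m, 'n) one_form) \<Rightarrow> ennreal" where
  "M_const V E \<alpha> =
    Sup {ennreal (norm (frame_d \<alpha> p (frame_inv \<alpha> p w) v)) |p v w.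
           p \<in> V \<and> v \<in> E p \<and> norm v = 1 \<and> norm w = 1}"

definition exp_ennreal :: "ennreal \<Rightarrow> ennreal" where
  "exp_ennreal x = (if x = \<infinity> then \<infinity> else ennreal (exp (enn2real x)))"

definition compatible_cover ::
  "('m::finite, 'n::finite) pt set \<Rightarrow> ('m, 'n) distribution \<Rightarrow> nat \<Rightarrow>
   (nat \<Rightarrow> ('m, 'n) pt set) \<Rightarrow> (nat \<Rightarrow> 'n \<Rightarrow> ('m, 'n) one_form) \<Rightarrow> bool" where
  "compatible_cover U E s V \<alpha> \<longleftrightarrow>
    1 \<le> s \<and> (\<forall>i\<in>{1..s}. open (V i)) \<and> (\<Union>i\<in>{1..s}. V i) = U \<and>
    (\<forall>i\<in>{1..s}. annihilator_frame (V i) E (\<alpha> i)) \<and>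
    (\<forall>i\<in>{1..s}. \<forall>j\<in>{1..s}. \<forall>p \<in> V i \<inter> V j.
       onorm (frame_map (\<alpha> i) p \<circ> frame_inv (\<alpha> j) p) = 1)"


section \<open>Asymptotic involutivity and exterior regularity\<close>

definition asymptotically_involutive ::
  "('m::finite, 'n::finite) pt set \<Rightarrow> ('m, 'n) distribution \<Rightarrow> bool" where
  "asymptotically_involutive U E \<longleftrightarrow>
    (\<exists>Ek (\<epsilon>::real) s V A.
       approximating_sequence U E Ek \<and> 0 < \<epsilon> \<and>
       (\<forall>k. compatible_cover U (Ek k) (s k) (V k) (A k)) \<and>
       (\<lambda>k. MAX (i, j, l) \<in> {1..s k} \<times> {1..s k} \<times> {1..s k}.
          d_sup_norm (V k i) (Ek k) (A k i) * inv_sup_norm (V k j) (A k j) *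
          exp_ennreal (ennreal \<epsilon> * M_const (V k l) (Ek k) (A k l))) \<longlonglongrightarrow> 0)"

definition exterior_regular ::
  "('m::finite, 'n::finite) pt set \<Rightarrow> ('m, 'n) distribution \<Rightarrow> bool" where
  "exterior_regular U E \<longleftrightarrow>
    (\<exists>Ek (\<epsilon>::real) s V B.
       approximating_sequence U E Ek \<and> 0 < \<epsilon> \<and>
       (\<forall>k. compatible_cover U (Ek k) (s k) (V k) (B k)) \<and>
       (\<lambda>k. MAX (i, j, l) \<in> {1..s k} \<times> {1..s k} \<times> {1..s k}.
          restr_sup_norm (V k i) E (B k i) * inv_sup_norm (V k j) (B k j) *
          exp_ennreal (ennreal \<epsilon> * M_const (V k l) (Ek k) (B k l))) \<longlonglongrightarrow> 0)"

end

theory Submission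
  imports Defs "HOL-Complex_Analysis.Great_Picard"
begin

text \<open>
  Transversality to the vertical makes \<open>E\<close> and the approximations \<open>E\<^sub>k\<close> graphs of slopes \<open>L\<close> and \<open>L\<^sub>k\<close>.
  Instead of the flows of horizontal lifts we use Euler polygons with steps \<open>p \<mapsto> p + h (v, L\<^sub>k p v)\<close>.
  If \<open>p\<close> and \<open>q\<close> move along two such polygons, Stokes' formula on the parallelogram spanned by a
  step and by \<open>q - p\<close> shows that \<open>A (q - p)\<close> changes by \<open>h dA (\<ell>, q - p) + o(h)\<close>, where \<open>\<ell>\<close> is the
  horizontal direction at \<open>p\<close>. Splitting \<open>q - p\<close> into its horizontal and vertical parts, \<open>\<bar>A (q - p)\<bar>\<close> grows
  at an exponential rate of at most \<open>M\<close>, with an inhomogeneity bounded by \<open>dA\<close> on \<open>E\<^sub>k\<close>. Compatibility of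
  the cover makes \<open>\<bar>A (q - p)\<bar>\<close> independent of the chart, so that a polygon may traverse arbitrarily many charts.

  Existence: as functions of \<open>v\<close>, the endpoints of the polygons issuing from a point have graphs
  that are tangent to \<open>E\<^sub>k\<close> up to an error \<open>\<parallel>A\<^sup>-\<^sup>1\<parallel> \<parallel>dA\<parallel> e\<^sup>\<epsilon>\<^sup>M\<close>, and a limit provided by the theorem of
  Arzela and Ascoli is tangent to \<open>E\<close>. Uniqueness: two integral manifolds of \<open>E\<close> are graphs of functions near a
  common point; along each of them the polygons issuing from nearby points drift apart at a rate measured by \<open>B\<close>
  on \<open>E\<close>, so that both are approximated by the same polygons up to \<open>\<parallel>B\<^sup>-\<^sup>1\<parallel> \<parallel>B|\<^sub>E\<parallel> e\<^sup>\<epsilon>\<^sup>M\<close>.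
\<close>

section \<open>Frames along infinitesimal parallelograms\<close>

text \<open>The constants belong to two scales. For a fixed \<open>k\<close> neither the modulus of
  continuity of the derivatives of the frames nor the number of charts is controlled. These
  quantities only decide how small the step \<open>h\<close> has to be; the one-step error is
  \<open>h\<close> times a small number \<eta>, and \<eta> is chosen for each \<open>k\<close> so
  that its total effect stays below a prescribed \<open>e\<close>. What survives is
  \<open>S * exp (M * ((1 + C) * \<rho>)) * D\<close>, with \<open>R\<close> in place of
  \<open>D\<close> for uniqueness. A polygon runs for unit time at speed at most
  \<open>(1 + C) * \<rho>\<close>, so a radius \<rho> with
  \<open>(1 + C) * \<rho> \<le> \<epsilon>\<close> turns this into the product that the hypotheses
  send to 0.

  The approximating surfaces are never asked to be differentiable. It suffices that their increments
  match the slope up to a small factor over distances below some threshold, and this threshold may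
  shrink arbitrarily fast with \<open>k\<close>: the estimate adds up along segments, where the
  threshold disappears, and only then is the limit taken.\<close>

lemma compact_bounded_image:
  fixes f :: "'a::topological_space \<Rightarrow> 'b::real_normed_vector"
  assumes "continuous_on V f" "compact K" "K \<subseteq> V"
  obtains B where "0 < B" "\<And>p. p \<in> K \<Longrightarrow> norm (f p) \<le> B"
proof -
  have "bounded (f ` K)"
    using assms by (meson compact_continuous_image compact_imp_bounded continuous_on_subset)
  then show ?thesis
    using that by (auto simp: bounded_pos)
qed

text \<open>Mean value inequality for \<open>f - f' p\<close> on a ball around \<open>p\<close>;
  uniform continuity of \<open>f'\<close> lets one radius serve all \<open>p\<close> in
  \<open>K\<close>.\<close>

lemma uniform_differentiability_on_compact:
  fixes f :: "'a::euclidean_space \<Rightarrow> 'b::real_normed_vector"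
  assumes der: "\<And>x. x \<in> V \<Longrightarrow> (f has_derivative blinfun_apply (f' x)) (at x)"
    and cont: "continuous_on V f'" and "open V" "compact K" "K \<subseteq> V" "0 < e"
  obtains d where "0 < d" "\<And>p q. p \<in> K \<Longrightarrow> dist p q < d \<Longrightarrow>
    norm (f q - f p - f' p (q - p)) \<le> e * norm (q - p)"
proof -
  obtain d0 where d0: "d0 > 0" "(\<Union>x\<in>K. ball x d0) \<subseteq> V"
    using compact_subset_open_imp_ball_epsilon_subset[OF \<open>compact K\<close> \<open>open V\<close> \<open>K \<subseteq> V\<close>] by blast
  \<comment> \<open>The ball around a point of \<open>K\<close> may leave \<open>K\<close>, so
    uniform continuity is needed on a compact collar that still lies in \<open>V\<close>.\<close>
  define K' where "K' = (\<Union>x\<in>K. \<Union>y\<in>cball 0 (d0/2). {x + y})"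
  have K': "compact K'"
    unfolding K'_def by (rule compact_sums'[OF \<open>compact K\<close> compact_cball])
  have K'_ball: "x \<in> K'" if "p \<in> K" "dist p x \<le> d0/2" for p x
  proof -
    have "x - p \<in> cball 0 (d0/2)" "x \<in> {p + (x - p)}"
      using that by (simp_all add: dist_norm norm_minus_commute)
    then show ?thesis unfolding K'_def using \<open>p \<in> K\<close> by blast
  qed
  have "K' \<subseteq> V"
  proof
    fix x assume "x \<in> K'"
    then obtain p y where "p \<in> K" "norm y \<le> d0/2" "x = p + y"
      unfolding K'_def by auto
    then have "x \<in> ball p d0" using \<open>d0 > 0\<close> by (simp add: dist_norm)
    then show "x \<in> V" using d0 \<open>p \<in> K\<close> by blast
  qed
  have "uniformly_continuous_on K' f'"
    using compact_uniformly_continuous K' cont continuous_on_subset[OF cont \<open>K' \<subseteq> V\<close>] by blast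
  then obtain d1 where d1: "d1 > 0" "\<And>x y. x \<in> K' \<Longrightarrow> y \<in> K' \<Longrightarrow> dist y x < d1 \<Longrightarrow> dist (f' y) (f' x) < e"
    unfolding uniformly_continuous_on_def using \<open>0 < e\<close> by meson
  show ?thesis
  proof
    show "0 < min d1 (d0/2)" using d0 d1 by simp
    fix p q assume "p \<in> K" and pq: "dist p q < min d1 (d0/2)"
    let ?S = "ball p (min d1 (d0/2))"
    have S: "x \<in> K'" if "x \<in> ?S" for x
      using K'_ball[OF \<open>p \<in> K\<close>, of x] that by simp
    have "p \<in> K'" using K'_ball[OF \<open>p \<in> K\<close>, of p] d0 by simp
    have "norm ((f q - f' p q) - (f p - f' p p)) \<le> e * norm (q - p)"
    proof (rule differentiable_bound[where S = ?S and f' = "\<lambda>x. blinfun_apply (f' x - f' p)"])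
      fix x assume x: "x \<in> ?S"
      have "x \<in> V" using S[OF x] \<open>K' \<subseteq> V\<close> by blast
      have "((\<lambda>x. f x - f' p x) has_derivative (\<lambda>h. f' x h - f' p h)) (at x)"
        by (intro has_derivative_diff der[OF \<open>x \<in> V\<close>] bounded_linear.has_derivative[OF blinfun.bounded_linear_right] has_derivative_ident)
      then show "((\<lambda>x. f x - f' p x) has_derivative blinfun_apply (f' x - f' p)) (at x within ?S)"
        by (simp add: minus_blinfun.rep_eq has_derivative_at_withinI)
      show "onorm (blinfun_apply (f' x - f' p)) \<le> e"
        using d1(2)[OF \<open>p \<in> K'\<close> S[OF x]] x
        by (simp add: dist_norm norm_blinfun.rep_eq[symmetric] norm_minus_commute)
    qed (use pq d0 d1 in auto)
    then show "norm (f q - f p - f' p (q - p)) \<le> e * norm (q - p)"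
      by (simp add: blinfun.diff_right algebra_simps)
  qed
qed

text \<open>
  Stokes' formula for an infinitesimal parallelogram: since \<open>\<omega>\<close> vanishes on the two sides
  \<open>h a\<close> and \<open>h b\<close>, its values on the two remaining sides differ by \<open>d\<omega>\<close>. The error is of order
  \<open>o(h)\<close>, but relative to the size of those sides, so that it can be summed over Euler steps.
\<close>

lemma one_form_parallelogram:
  fixes \<omega> :: "('m::finite, 'n::finite) one_form"
  assumes "open V" "compact K" "K \<subseteq> V" "C1_on V \<omega>" "0 < e" "0 < B"
  obtains d where "0 < d"
    "\<And>p q a b h. \<lbrakk>p \<in> K; dist p q < d; 0 < h; h < d; norm a \<le> B; norm b \<le> B; \<omega> p a = 0; \<omega> q b = 0\<rbrakk>
      \<Longrightarrow> \<bar>\<omega> (p + h *\<^sub>R a) ((q + h *\<^sub>R b) - (p + h *\<^sub>R a)) - \<omega> p (q - p) - h * ext_deriv \<omega> p a (q - p)\<bar>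
          \<le> h * e * (norm (q - p) + norm (b - a))"
proof -
  obtain \<omega>' where der: "\<And>x. x \<in> V \<Longrightarrow> (\<omega> has_derivative blinfun_apply (\<omega>' x)) (at x)"
    and cont: "continuous_on V \<omega>'"
    using \<open>C1_on V \<omega>\<close> unfolding C1_on_def by blast
  obtain \<Lambda> where \<Lambda>: "0 < \<Lambda>" "\<And>p. p \<in> K \<Longrightarrow> norm (\<omega>' p) \<le> \<Lambda>"
    using compact_bounded_image[OF cont \<open>compact K\<close> \<open>K \<subseteq> V\<close>] by blast
  define e1 where "e1 = e / (2*B)"
  have "0 < e1" using assms by (simp add: e1_def)
  obtain d1 where d1: "0 < d1" "\<And>p q. p \<in> K \<Longrightarrow> dist p q < d1 \<Longrightarrow>
      norm (\<omega> q - \<omega> p - \<omega>' p (q - p)) \<le> e1 * norm (q - p)"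
    using uniform_differentiability_on_compact[OF der cont \<open>open V\<close> \<open>compact K\<close> \<open>K \<subseteq> V\<close> \<open>0 < e1\<close>] by blast
  \<comment> \<open>The first two entries keep \<open>q\<close> and \<open>p + h a\<close> where
    \<omega> is well linearised at \<open>p\<close>. The other two make the coefficient
    \<open>(\<Lambda> + e1) * h * B + \<Lambda> * norm (q - p)\<close> of
    \<open>norm (b - a)\<close> at most \<open>e\<close>.\<close>
  define d where "d = Min {d1, d1 / B, e / (2 * (\<Lambda> + e1) * B), e / (2 * \<Lambda>)}"
  have d: "0 < d" "d \<le> d1" "d * B \<le> d1" "(\<Lambda> + e1) * d * B \<le> e / 2" "\<Lambda> * d \<le> e / 2"
  proof -
    have le: "d \<le> d1" "d \<le> d1 / B" "d \<le> e / (2 * (\<Lambda> + e1) * B)" "d \<le> e / (2 * \<Lambda>)"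
      unfolding d_def by auto
    show "0 < d" using d1 assms \<Lambda> \<open>0 < e1\<close> unfolding d_def by auto
    show "d \<le> d1" by fact
    show "d * B \<le> d1" using le(2) \<open>0 < B\<close> by (simp add: field_simps)
    have "0 < 2 * (\<Lambda> + e1) * B" using \<open>0 < B\<close> \<Lambda> \<open>0 < e1\<close> by simp
    then have "d * (2 * (\<Lambda> + e1) * B) \<le> e" using le(3) by (simp add: pos_le_divide_eq)
    then show "(\<Lambda> + e1) * d * B \<le> e / 2" by (simp add: algebra_simps)
    show "\<Lambda> * d \<le> e / 2" using le(4) \<Lambda> by (simp add: field_simps)
  qed
  show ?thesis
  proof
    show "0 < d" by fact
    fix p q a b and h :: real
    assume p: "p \<in> K" and pq: "dist p q < d" and h: "0 < h" "h < d"
      and a: "norm a \<le> B" and b: "norm b \<le> B" and pa: "\<omega> p a = 0" and qb: "\<omega> q b = 0"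
    let ?x = "p + h *\<^sub>R a"
    define r where "r = \<omega> ?x - \<omega> p - \<omega>' p (h *\<^sub>R a)"
    define s where "s = \<omega> q - \<omega> p - \<omega>' p (q - p)"
    have ha: "norm (h *\<^sub>R a) \<le> h * B" using a h by simp
    have "h * B < d * B" using h \<open>0 < B\<close> by simp
    then have "dist p ?x < d1" using ha d by (simp add: dist_norm)
    then have "norm r \<le> e1 * norm (h *\<^sub>R a)"
      using d1(2)[OF p, of ?x] by (simp add: r_def)
    also have "\<dots> \<le> e1 * (h * B)" using ha \<open>0 < e1\<close> by (intro mult_left_mono) auto
    finally have r: "norm r \<le> h * (e / 2)" using \<open>0 < B\<close> by (simp add: e1_def field_simps)
    have s: "norm s \<le> e1 * norm (q - p)"
      using d1(2)[OF p, of q] pq d by (simp add: s_def)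
    have fd: "frechet_derivative \<omega> (at p) = blinfun_apply (\<omega>' p)"
      using frechet_derivative_at[OF der[of p]] p \<open>K \<subseteq> V\<close> by auto
    have \<omega>x: "\<omega> ?x = \<omega> p + \<omega>' p (h *\<^sub>R a) + r" by (simp add: r_def)
    have \<omega>p: "\<omega> p = \<omega> q - \<omega>' p (q - p) - s" by (simp add: s_def)
    \<comment> \<open>Because \<omega> vanishes on \<open>b\<close> at \<open>q\<close>, its value
      on \<open>b\<close> at \<open>p\<close> is of first order in \<open>q - p\<close>. Its linear
      part meets the second term of \<open>ext_deriv\<close>, and only the difference
      \<open>b - a\<close> remains.\<close>
    have pb: "\<omega> p b = - \<omega>' p (q - p) b - s b"
      using qb by (subst \<omega>p) (simp add: blinfun.diff_left)
    have split: "(q + h *\<^sub>R b) - ?x = (q - p) + h *\<^sub>R (b - a)"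
      by (simp add: algebra_simps)
    have "\<omega> ?x ((q + h *\<^sub>R b) - ?x) - \<omega> p (q - p) - h * ext_deriv \<omega> p a (q - p)
      = r (q - p) + h * (\<omega>' p (h *\<^sub>R a) (b - a) + r (b - a) - s b - \<omega>' p (q - p) (b - a))"
      unfolding split ext_deriv_def fd \<omega>x
      by (simp add: blinfun.add_left blinfun.add_right blinfun.scaleR_right blinfun.scaleR_left
          blinfun.diff_right pa pb algebra_simps)
    also have "\<bar>\<dots>\<bar> \<le> h * (e/2) * norm (q - p) + h * (\<Lambda> * (h * B) * norm (b - a)
       + e1 * (h * B) * norm (b - a) + e1 * norm (q - p) * B + \<Lambda> * norm (q - p) * norm (b - a))"
    proof -
      have 1: "\<bar>r (q - p)\<bar> \<le> h * (e/2) * norm (q - p)"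
        using norm_blinfun[of r "q - p"] mult_right_mono[OF r norm_ge_zero[of "q - p"]] by simp
      have bl: "\<bar>(\<omega>' p u) w\<bar> \<le> \<Lambda> * norm u * norm w" for u w
      proof -
        have "\<bar>(\<omega>' p u) w\<bar> \<le> norm (\<omega>' p u) * norm w" using norm_blinfun[of "\<omega>' p u" w] by simp
        also have "\<dots> \<le> norm (\<omega>' p) * norm u * norm w"
          by (intro mult_right_mono norm_blinfun) simp
        also have "\<dots> \<le> \<Lambda> * norm u * norm w"
          by (intro mult_right_mono \<Lambda> p) simp_all
        finally show ?thesis .
      qed
      have 2: "\<bar>\<omega>' p (h *\<^sub>R a) (b - a)\<bar> \<le> \<Lambda> * (h * B) * norm (b - a)"
        by (rule order_trans[OF bl]) (intro mult_right_mono mult_left_mono ha; use \<Lambda> in simp)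
      have 3: "\<bar>r (b - a)\<bar> \<le> e1 * (h * B) * norm (b - a)"
        using norm_blinfun[of r "b - a"] mult_right_mono[OF r norm_ge_zero[of "b - a"]] \<open>0 < B\<close>
        by (simp add: e1_def field_simps)
      have "\<bar>s b\<bar> \<le> norm s * norm b" using norm_blinfun[of s b] by simp
      also have "\<dots> \<le> (e1 * norm (q - p)) * B"
        using s b \<open>0 < e1\<close> by (intro mult_mono) auto
      finally have 4: "\<bar>s b\<bar> \<le> e1 * norm (q - p) * B" .
      have "\<bar>\<omega>' p (h *\<^sub>R a) (b - a) + r (b - a) - s b - \<omega>' p (q - p) (b - a)\<bar>
        \<le> \<Lambda> * (h * B) * norm (b - a)
       + e1 * (h * B) * norm (b - a) + e1 * norm (q - p) * B + \<Lambda> * norm (q - p) * norm (b - a)"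
        using 2 3 4 bl[of "q - p" "b - a"] by linarith
      from mult_left_mono[OF this, of h] h
      have "\<bar>h * (\<omega>' p (h *\<^sub>R a) (b - a) + r (b - a) - s b - \<omega>' p (q - p) (b - a))\<bar>
        \<le> h * (\<Lambda> * (h * B) * norm (b - a)
       + e1 * (h * B) * norm (b - a) + e1 * norm (q - p) * B + \<Lambda> * norm (q - p) * norm (b - a))"
        by (simp add: abs_mult)
      with 1 show ?thesis by linarith
    qed
    also have "\<dots> = h * (e * norm (q - p) + ((\<Lambda> + e1) * h * B + \<Lambda> * norm (q - p)) * norm (b - a))"
      using \<open>0 < B\<close> by (simp add: e1_def field_simps)
    also have "\<dots> \<le> h * (e * norm (q - p) + e * norm (b - a))"
    proof -
      have "(\<Lambda> + e1) * h * B \<le> (\<Lambda> + e1) * d * B"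
        using h \<Lambda> \<open>0 < e1\<close> \<open>0 < B\<close> by (intro mult_right_mono mult_left_mono) auto
      moreover have "\<Lambda> * norm (q - p) \<le> \<Lambda> * d"
        using pq \<Lambda> by (intro mult_left_mono) (auto simp: dist_norm norm_minus_commute)
      ultimately have "(\<Lambda> + e1) * h * B + \<Lambda> * norm (q - p) \<le> e" using d by linarith
      then show ?thesis using h by (intro mult_left_mono add_left_mono mult_right_mono) auto
    qed
    finally show "\<bar>\<omega> ?x ((q + h *\<^sub>R b) - ?x) - \<omega> p (q - p) - h * ext_deriv \<omega> p a (q - p)\<bar>
          \<le> h * e * (norm (q - p) + norm (b - a))"
      by (simp add: algebra_simps)
  qed
qed

lemma frame_map_parallelogram:
  fixes \<alpha> :: "'n::finite \<Rightarrow> ('m::finite, 'n) one_form"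
  assumes "open V" "compact K" "K \<subseteq> V" "\<And>j. C1_on V (\<alpha> j)" "0 < e" "0 < B"
  obtains d where "0 < d"
    "\<And>p q a b h. \<lbrakk>p \<in> K; dist p q < d; 0 < h; h < d; norm a \<le> B; norm b \<le> B;
        frame_map \<alpha> p a = 0; frame_map \<alpha> q b = 0\<rbrakk>
      \<Longrightarrow> norm (frame_map \<alpha> (p + h *\<^sub>R a) ((q + h *\<^sub>R b) - (p + h *\<^sub>R a)) - frame_map \<alpha> p (q - p)
            - h *\<^sub>R frame_d \<alpha> p a (q - p))
          \<le> h * e * (norm (q - p) + norm (b - a))"
proof -
  \<comment> \<open>The norm of a vector is at most the sum of its absolute components, which costs
    the factor \<open>CARD('n)\<close>.\<close>
  define e' where "e' = e / real CARD('n)"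
  have "0 < e'" using \<open>0 < e\<close> by (simp add: e'_def)
  have "\<exists>d>0. \<forall>p q a b h. p \<in> K \<longrightarrow> dist p q < d \<longrightarrow> 0 < h \<longrightarrow> h < d \<longrightarrow> norm a \<le> B \<longrightarrow> norm b \<le> B \<longrightarrow>
      \<alpha> j p a = 0 \<longrightarrow> \<alpha> j q b = 0
      \<longrightarrow> \<bar>\<alpha> j (p + h *\<^sub>R a) ((q + h *\<^sub>R b) - (p + h *\<^sub>R a)) - \<alpha> j p (q - p) - h * ext_deriv (\<alpha> j) p a (q - p)\<bar>
          \<le> h * e' * (norm (q - p) + norm (b - a))" for j
    by (rule one_form_parallelogram[OF assms(1-3) assms(4)[of j] \<open>0 < e'\<close> \<open>0 < B\<close>]) blast
  then obtain D where D: "\<And>j. D j > 0" "\<And>j p q a b h. \<lbrakk>p \<in> K; dist p q < D j; 0 < h; h < D j; norm a \<le> B; norm b \<le> B;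
      \<alpha> j p a = 0; \<alpha> j q b = 0\<rbrakk>
      \<Longrightarrow> \<bar>\<alpha> j (p + h *\<^sub>R a) ((q + h *\<^sub>R b) - (p + h *\<^sub>R a)) - \<alpha> j p (q - p) - h * ext_deriv (\<alpha> j) p a (q - p)\<bar>
          \<le> h * e' * (norm (q - p) + norm (b - a))"
    by metis
  show ?thesis
  proof
    show "0 < Min (range D)" using D by simp
    fix p q a b and h :: real
    assume *: "p \<in> K" "dist p q < Min (range D)" "0 < h" "h < Min (range D)" "norm a \<le> B" "norm b \<le> B"
        "frame_map \<alpha> p a = 0" "frame_map \<alpha> q b = 0"
    let ?X = "frame_map \<alpha> (p + h *\<^sub>R a) ((q + h *\<^sub>R b) - (p + h *\<^sub>R a)) - frame_map \<alpha> p (q - p)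
            - h *\<^sub>R frame_d \<alpha> p a (q - p)"
    have j: "\<bar>?X $ j\<bar> \<le> h * e' * (norm (q - p) + norm (b - a))" for j
    proof -
      have "dist p q < D j" "h < D j" using * by auto
      moreover have "\<alpha> j p a = 0" "\<alpha> j q b = 0"
        using *(7,8) by (auto simp: frame_map_def vec_eq_iff)
      ultimately show ?thesis using D(2)[of p q j h a b] * by (simp add: frame_map_def frame_d_def)
    qed
    have "norm ?X \<le> (\<Sum>j\<in>UNIV. \<bar>?X $ j\<bar>)" by (rule norm_le_l1_cart)
    also have "\<dots> \<le> of_nat (card (UNIV :: 'n set)) * (h * e' * (norm (q - p) + norm (b - a)))"
      by (rule sum_bounded_above) (rule j)
    also have "\<dots> = h * e * (norm (q - p) + norm (b - a))" by (simp add: e'_def)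
    finally show "norm ?X \<le> h * e * (norm (q - p) + norm (b - a))" .
  qed
qed

section \<open>Compatible frames and Euler polygons\<close>

lemma frame_map_add: "frame_map \<alpha> p (x + y) = frame_map \<alpha> p x + frame_map \<alpha> p y"
  by (simp add: frame_map_def vec_eq_iff blinfun.add_right)

lemma frame_map_diff: "frame_map \<alpha> p (x - y) = frame_map \<alpha> p x - frame_map \<alpha> p y"
  by (simp add: frame_map_def vec_eq_iff blinfun.diff_right)

lemma frame_map_scaleR: "frame_map \<alpha> p (c *\<^sub>R x) = c *\<^sub>R frame_map \<alpha> p x"
  by (simp add: frame_map_def vec_eq_iff blinfun.scaleR_right)

lemma C1_on_imp_differentiable: "C1_on V f \<Longrightarrow> p \<in> V \<Longrightarrow> f differentiable (at p)"
  unfolding C1_on_def differentiable_def by blast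

lemma frame_d_add:
  assumes "\<And>j. C1_on V (\<alpha> j)" "p \<in> V"
  shows "frame_d \<alpha> p u (x + y) = frame_d \<alpha> p u x + frame_d \<alpha> p u y"
  unfolding frame_d_def ext_deriv_def vec_eq_iff
  using linear_add[OF linear_frechet_derivative[OF C1_on_imp_differentiable[OF assms]]]
  by (simp add: blinfun.add_right blinfun.add_left)

definition lift_vector ::
  "(('m::finite, 'n::finite) pt \<Rightarrow> (real ^ 'm) \<Rightarrow>\<^sub>L (real ^ 'n)) \<Rightarrow> ('m, 'n) pt \<Rightarrow> real ^ 'm \<Rightarrow> ('m, 'n) pt" where
  "lift_vector L p v = (v, L p v)"

definition euler_step ::
  "(('m::finite, 'n::finite) pt \<Rightarrow> (real ^ 'm) \<Rightarrow>\<^sub>L (real ^ 'n)) \<Rightarrow> real \<Rightarrow> real ^ 'm \<Rightarrow> ('m, 'n) pt \<Rightarrow> ('m, 'n) pt"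
  where "euler_step L h v p = p + h *\<^sub>R lift_vector L p v"

lemma norm_lift_vector_le:
  assumes "norm (L p) \<le> C"
  shows "norm (lift_vector L p v) \<le> (1 + C) * norm v"
proof -
  have "norm (L p v) \<le> C * norm v"
    using norm_blinfun[of "L p" v] mult_right_mono[OF assms norm_ge_zero[of v]] by linarith
  then show ?thesis
    using norm_Pair_le[of v "L p v"] by (simp add: lift_vector_def algebra_simps)
qed

lemma fst_euler_iterate: "fst ((euler_step L h v ^^ j) p) = fst p + (real j * h) *\<^sub>R v"
  by (induction j) (simp_all add: euler_step_def lift_vector_def algebra_simps)

text \<open>The quantitative bounds are required on the compact pieces \<open>Kc i\<close>, but
  annihilation and compatibility on the open charts \<open>V i\<close>: a step that starts in
  \<open>Kc i\<close> may end outside every estimate made there, but for small \<open>h\<close> it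
  still ends in \<open>V i\<close>. In \<open>mixed_bound\<close> the vertical argument is measured
  by the frame itself, so that \<open>M\<close> is a growth rate for the frame norm and involves no
  factor \<open>S\<close>; \<open>D\<close> measures the failure of involutivity.\<close>

locale framed_bundle =
  fixes K :: "('m::finite, 'n::finite) pt set"
    and L :: "('m, 'n) pt \<Rightarrow> (real ^ 'm) \<Rightarrow>\<^sub>L (real ^ 'n)"
    and I :: "nat set"
    and Kc V :: "nat \<Rightarrow> ('m, 'n) pt set"
    and \<alpha> :: "nat \<Rightarrow> 'n \<Rightarrow> ('m, 'n) one_form"
    and C S M D :: real
  assumes finite_I: "finite I"
    and compact_Kc: "i \<in> I \<Longrightarrow> compact (Kc i)"
    and Kc_subset: "i \<in> I \<Longrightarrow> Kc i \<subseteq> V i"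
    and open_V: "i \<in> I \<Longrightarrow> open (V i)"
    and K_covered: "K \<subseteq> (\<Union>i\<in>I. Kc i)"
    and C1_frame: "i \<in> I \<Longrightarrow> C1_on (V i) (\<alpha> i j)"
    and L_bound: "p \<in> K \<Longrightarrow> norm (L p) \<le> C"
    and annihilates: "i \<in> I \<Longrightarrow> p \<in> V i \<Longrightarrow> frame_map (\<alpha> i) p (lift_vector L p u) = 0"
    and compatible: "i \<in> I \<Longrightarrow> i' \<in> I \<Longrightarrow> p \<in> V i \<Longrightarrow> p \<in> V i' \<Longrightarrow>
      norm (frame_map (\<alpha> i) p d) = norm (frame_map (\<alpha> i') p d)"
    and inverse_bound: "i \<in> I \<Longrightarrow> p \<in> Kc i \<Longrightarrow> norm w \<le> S * norm (frame_map (\<alpha> i) p (0, w))"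
    and mixed_bound: "i \<in> I \<Longrightarrow> p \<in> Kc i \<Longrightarrow>
      norm (frame_d (\<alpha> i) p (lift_vector L p u) (0, w))
        \<le> M * norm (lift_vector L p u) * norm (frame_map (\<alpha> i) p (0, w))"
    and curvature_bound: "i \<in> I \<Longrightarrow> p \<in> Kc i \<Longrightarrow>
      norm (frame_d (\<alpha> i) p (lift_vector L p u) (lift_vector L p u'))
        \<le> D * norm (lift_vector L p u) * norm (lift_vector L p u')"
    and nonneg: "0 \<le> C" "0 \<le> S" "0 \<le> M" "0 \<le> D"
begin

text \<open>Compatibility of the cover makes this norm on the fibres independent of the chart.\<close>

definition fnorm :: "('m, 'n) pt \<Rightarrow> ('m, 'n) pt \<Rightarrow> real" where
  "fnorm p d = norm (frame_map (\<alpha> (SOME i. i \<in> I \<and> p \<in> V i)) p d)"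

lemma fnorm_eq:
  assumes "i \<in> I" "p \<in> V i"
  shows "fnorm p d = norm (frame_map (\<alpha> i) p d)"
proof -
  have "(SOME i. i \<in> I \<and> p \<in> V i) \<in> I \<and> p \<in> V (SOME i. i \<in> I \<and> p \<in> V i)"
    using assms by (metis (mono_tags, lifting) someI_ex)
  then show ?thesis unfolding fnorm_def using compatible assms by blast
qed

lemma fnorm_nonneg: "0 \<le> fnorm p d"
  by (simp add: fnorm_def)

lemma obtain_chart:
  assumes "p \<in> K"
  obtains i where "i \<in> I" "p \<in> Kc i" "p \<in> V i"
  using assms K_covered Kc_subset by blast

lemma norm_lift_le: "p \<in> K \<Longrightarrow> norm (lift_vector L p v) \<le> (1 + C) * norm v"
  by (intro norm_lift_vector_le L_bound)

text \<open>The frames annihilate lifts, so only the vertical deviation of \<open>d\<close> from the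
  graph of \<open>L p\<close> is seen.\<close>

lemma fnorm_lift_diff:
  assumes "p \<in> K"
  shows "fnorm p d = fnorm p (0, snd d - L p (fst d))"
proof -
  obtain i where i: "i \<in> I" "p \<in> V i" using obtain_chart[OF assms] .
  have "d = lift_vector L p (fst d) + (0, snd d - L p (fst d))"
    by (simp add: lift_vector_def prod_eq_iff)
  then have "frame_map (\<alpha> i) p d = frame_map (\<alpha> i) p (lift_vector L p (fst d))
      + frame_map (\<alpha> i) p (0, snd d - L p (fst d))"
    by (metis frame_map_add)
  then show ?thesis using i by (simp add: fnorm_eq annihilates)
qed

lemma vertical_le_fnorm:
  assumes "p \<in> K"
  shows "norm (snd d - L p (fst d)) \<le> S * fnorm p d"
proof -
  obtain i where i: "i \<in> I" "p \<in> Kc i" "p \<in> V i" using obtain_chart[OF assms] .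
  show ?thesis
    using inverse_bound[OF i(1,2), of "snd d - L p (fst d)"]
    by (subst fnorm_lift_diff[OF assms]) (simp add: fnorm_eq[OF i(1,3)])
qed

lemma norm_le_fnorm:
  assumes "p \<in> K"
  shows "norm d \<le> (1 + C) * norm (fst d) + S * fnorm p d"
proof -
  have "d = lift_vector L p (fst d) + (0, snd d - L p (fst d))"
    by (simp add: lift_vector_def prod_eq_iff)
  then have "norm d \<le> norm (lift_vector L p (fst d)) + norm ((0, snd d - L p (fst d)) :: ('m, 'n) pt)"
    by (metis norm_triangle_ineq)
  also have "norm ((0, snd d - L p (fst d)) :: ('m, 'n) pt) = norm (snd d - L p (fst d))"
    by (simp add: norm_Pair)
  finally show ?thesis
    using norm_lift_le[OF assms, of "fst d"] vertical_le_fnorm[OF assms, of d] by linarith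
qed

text \<open>Besides the Lipschitz constant this provides a Lebesgue number: points closer than
  \<open>d\<close> to \<open>Kc i\<close> can be treated in the chart \<open>V i\<close>.\<close>

lemma frame_lipschitz:
  obtains d \<Lambda> where "0 < d" "0 < \<Lambda>"
    "\<And>i p q u. i \<in> I \<Longrightarrow> p \<in> Kc i \<Longrightarrow> dist p q < d \<Longrightarrow> q \<in> V i \<and>
       norm (frame_map (\<alpha> i) q u - frame_map (\<alpha> i) p u) \<le> \<Lambda> * norm (q - p) * norm u"
proof -
  define P where "P i j d \<Lambda> \<longleftrightarrow> 0 < d \<and> 0 < \<Lambda> \<and>
    (\<forall>p q. p \<in> Kc i \<longrightarrow> dist p q < d \<longrightarrow> norm (\<alpha> i j q - \<alpha> i j p) \<le> \<Lambda> * norm (q - p))" for i j d \<Lambda>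
  have "\<exists>d \<Lambda>. P i j d \<Lambda>"
    if iI: "i \<in> I" for i j
  proof -
    obtain \<omega>' where der: "\<And>x. x \<in> V i \<Longrightarrow> (\<alpha> i j has_derivative blinfun_apply (\<omega>' x)) (at x)"
      and cont: "continuous_on (V i) \<omega>'"
      using C1_frame[OF iI] unfolding C1_on_def by blast
    obtain B where B: "0 < B" "\<And>p. p \<in> Kc i \<Longrightarrow> norm (\<omega>' p) \<le> B"
      using compact_bounded_image[OF cont compact_Kc[OF iI] Kc_subset[OF iI]] by blast
    obtain d where d: "0 < d" "\<And>p q. p \<in> Kc i \<Longrightarrow> dist p q < d \<Longrightarrow>
      norm (\<alpha> i j q - \<alpha> i j p - \<omega>' p (q - p)) \<le> 1 * norm (q - p)"
      using uniform_differentiability_on_compact[OF der cont open_V[OF iI] compact_Kc[OF iI] Kc_subset[OF iI] zero_less_one] by blast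
    have "norm (\<alpha> i j q - \<alpha> i j p) \<le> (1 + B) * norm (q - p)" if "p \<in> Kc i" "dist p q < d" for p q
    proof -
      have "norm (\<omega>' p (q - p)) \<le> B * norm (q - p)"
        using norm_blinfun[of "\<omega>' p" "q - p"] mult_right_mono[OF B(2)[OF that(1)] norm_ge_zero[of "q - p"]]
        by linarith
      then show ?thesis
        using d(2)[OF that] norm_triangle_ineq2[of "\<alpha> i j q - \<alpha> i j p" "\<omega>' p (q - p)"]
        by (simp add: algebra_simps)
    qed
    then have "P i j d (1 + B)" using d(1) B(1) by (simp add: P_def)
    then show ?thesis by blast
  qed
  then obtain d0 \<Lambda>0 where PD: "\<And>i j. i \<in> I \<Longrightarrow> P i j (d0 i j) (\<Lambda>0 i j)"
    by metis
  have d0: "0 < d0 i j" "0 < \<Lambda>0 i j" if "i \<in> I" for i j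
    using PD[OF that, of j] unfolding P_def by blast+
  have d0': "norm (\<alpha> i j q - \<alpha> i j p) \<le> \<Lambda>0 i j * norm (q - p)"
    if "i \<in> I" "p \<in> Kc i" "dist p q < d0 i j" for i j p q
    using PD[OF that(1), of j] that(2,3) unfolding P_def by blast
  have "\<exists>r>0. \<forall>x\<in>Kc i. ball x r \<subseteq> V i" if iI: "i \<in> I" for i
  proof -
    obtain r where "r > 0" "(\<Union>x\<in>Kc i. ball x r) \<subseteq> V i"
      by (rule compact_subset_open_imp_ball_epsilon_subset[OF compact_Kc[OF iI] open_V[OF iI] Kc_subset[OF iI]])
    then show ?thesis by (intro exI[of _ r]) (simp add: UN_subset_iff)
  qed
  then obtain r where r: "\<And>i. i \<in> I \<Longrightarrow> 0 < r i" "\<And>i x. i \<in> I \<Longrightarrow> x \<in> Kc i \<Longrightarrow> ball x (r i) \<subseteq> V i"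
    by metis
  \<comment> \<open>The element 1, here and in \<open>?LS\<close>, keeps minimum and maximum
    meaningful for an empty index set.\<close>
  let ?DS = "insert 1 (r ` I \<union> (\<lambda>(i, j). d0 i j) ` (I \<times> UNIV))"
  have fin: "finite ?DS" using finite_I by auto
  define d where "d = Min ?DS"
  have d_pos: "0 < d" unfolding d_def using fin r(1) d0(1) by (subst Min_gr_iff) auto
  have d_le: "d \<le> r i" "d \<le> d0 i j" if "i \<in> I" for i j
    unfolding d_def by (rule Min_le[OF fin]; use that in auto)+
  let ?LS = "insert 1 ((\<lambda>(i, j). \<Lambda>0 i j) ` (I \<times> UNIV))"
  have finL: "finite ?LS" using finite_I by auto
  define \<Lambda> where "\<Lambda> = Max ?LS"
  have "1 \<le> \<Lambda>" unfolding \<Lambda>_def by (rule Max_ge[OF finL]) simp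
  have L_ge: "\<Lambda>0 i j \<le> \<Lambda>" if "i \<in> I" for i j
    unfolding \<Lambda>_def by (rule Max_ge[OF finL]) (use that in auto)
  show ?thesis
  proof
    show "0 < d" by fact
    show "0 < of_nat (card (UNIV :: 'n set)) * \<Lambda>" using \<open>1 \<le> \<Lambda>\<close> by simp
    fix i p q and u :: "('m, 'n) pt" assume i: "i \<in> I" and p: "p \<in> Kc i" and pq: "dist p q < d"
    have "q \<in> V i" using r(2)[OF i p] pq d_le(1)[OF i] by auto
    moreover have "norm (frame_map (\<alpha> i) q u - frame_map (\<alpha> i) p u) \<le> of_nat (card (UNIV :: 'n set)) * \<Lambda> * norm (q - p) * norm u"
    proof -
      have j: "\<bar>(frame_map (\<alpha> i) q u - frame_map (\<alpha> i) p u) $ j\<bar> \<le> \<Lambda> * norm (q - p) * norm u" for j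
      proof -
        have "\<bar>(frame_map (\<alpha> i) q u - frame_map (\<alpha> i) p u) $ j\<bar> = norm ((\<alpha> i j q - \<alpha> i j p) u)"
          by (simp add: frame_map_def blinfun.diff_left)
        also have "\<dots> \<le> norm (\<alpha> i j q - \<alpha> i j p) * norm u" by (rule norm_blinfun)
        also have "\<dots> \<le> (\<Lambda>0 i j * norm (q - p)) * norm u"
          using d0'[OF i p, of q j] pq d_le(2)[OF i, of j] by (intro mult_right_mono) auto
        also have "\<dots> \<le> (\<Lambda> * norm (q - p)) * norm u"
          by (intro mult_right_mono L_ge i) auto
        finally show ?thesis .
      qed
      have "norm (frame_map (\<alpha> i) q u - frame_map (\<alpha> i) p u) \<le> (\<Sum>j\<in>UNIV. \<bar>(frame_map (\<alpha> i) q u - frame_map (\<alpha> i) p u) $ j\<bar>)"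
        by (rule norm_le_l1_cart)
      also have "\<dots> \<le> of_nat (card (UNIV :: 'n set)) * (\<Lambda> * norm (q - p) * norm u)"
        by (rule sum_bounded_above) (rule j)
      finally show ?thesis by (simp add: mult.assoc)
    qed
    ultimately show "q \<in> V i \<and> norm (frame_map (\<alpha> i) q u - frame_map (\<alpha> i) p u) \<le> of_nat (card (UNIV :: 'n set)) * \<Lambda> * norm (q - p) * norm u"
      by blast
  qed
qed

text \<open>The lifts of \<open>u\<close> at \<open>p\<close> and \<open>q\<close> differ by a
  vertical vector. The frame at \<open>q\<close> kills the lift at \<open>q\<close>, so the frame at
  \<open>p\<close> sees on this vector only the change of the frame from \<open>p\<close> to
  \<open>q\<close>; \<open>inverse_bound\<close> then recovers the vector.\<close>

lemma L_locally_lipschitz: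
  obtains d \<Lambda> where "0 < d" "0 \<le> \<Lambda>"
    "\<And>p q u. p \<in> K \<Longrightarrow> q \<in> K \<Longrightarrow> dist p q < d \<Longrightarrow> norm (L q u - L p u) \<le> \<Lambda> * norm (q - p) * norm u"
proof -
  obtain d \<Lambda> where d: "0 < d" "0 < \<Lambda>"
    "\<And>i p q u. i \<in> I \<Longrightarrow> p \<in> Kc i \<Longrightarrow> dist p q < d \<Longrightarrow> q \<in> V i \<and>
       norm (frame_map (\<alpha> i) q u - frame_map (\<alpha> i) p u) \<le> \<Lambda> * norm (q - p) * norm u"
    using frame_lipschitz by blast
  show ?thesis
  proof
    show "0 < d" by fact
    show "0 \<le> S * \<Lambda> * (1 + C)" using d nonneg by simp
    fix p q u assume p: "p \<in> K" and q: "q \<in> K" and pq: "dist p q < d"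
    obtain i where i: "i \<in> I" "p \<in> Kc i" "p \<in> V i" using obtain_chart[OF p] .
    have qV: "q \<in> V i" using d(3)[OF i(1,2) pq] by blast
    have "lift_vector L q u - lift_vector L p u = (0, L q u - L p u)" by (simp add: lift_vector_def)
    then have "frame_map (\<alpha> i) p (0, L q u - L p u)
        = frame_map (\<alpha> i) p (lift_vector L q u) - frame_map (\<alpha> i) p (lift_vector L p u)"
      by (metis frame_map_diff)
    also have "\<dots> = - (frame_map (\<alpha> i) q (lift_vector L q u) - frame_map (\<alpha> i) p (lift_vector L q u))"
      using annihilates[OF i(1,3)] annihilates[OF i(1) qV] by simp
    finally have "norm (frame_map (\<alpha> i) p (0, L q u - L p u)) \<le> \<Lambda> * norm (q - p) * norm (lift_vector L q u)"
      using d(3)[OF i(1,2) pq] by (simp only: norm_minus_cancel)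
    also have "\<dots> \<le> \<Lambda> * norm (q - p) * ((1 + C) * norm u)"
      by (intro mult_left_mono norm_lift_le q) (use d in simp)
    finally have "S * norm (frame_map (\<alpha> i) p (0, L q u - L p u)) \<le> S * (\<Lambda> * norm (q - p) * ((1 + C) * norm u))"
      by (rule mult_left_mono) (rule nonneg)
    then show "norm (L q u - L p u) \<le> S * \<Lambda> * (1 + C) * norm (q - p) * norm u"
      using inverse_bound[OF i(1,2), of "L q u - L p u"] by (simp add: algebra_simps)
  qed
qed

end

section \<open>Discrete Gronwall estimate for a pair of Euler polygons\<close>

context framed_bundle
begin

text \<open>One step of the Gronwall argument. In the first-order change of the frame norm, the
  vertical part of \<open>q - p\<close> is amplified at rate \<open>M\<close> and its horizontal
  part contributes through \<open>D\<close>; \<eta> collects the rest.\<close>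

lemma euler_step_estimate:
  assumes "0 < \<eta>" "0 < \<rho>"
  obtains d where "0 < d"
    "\<And>p q v v' h. \<lbrakk>p \<in> K; q \<in> K; dist p q < d; 0 < h; h < d; norm v \<le> \<rho>; norm v' \<le> \<rho>\<rbrakk> \<Longrightarrow>
      fnorm (euler_step L h v p) (euler_step L h v' q - euler_step L h v p)
       \<le> (1 + h * (M * ((1 + C) * \<rho>))) * fnorm p (q - p)
         + h * (D * ((1 + C) * \<rho>) * (1 + C)) * norm (fst (q - p))
         + h * \<eta> * (norm (q - p) + norm (v' - v))"
proof -
  obtain d0 \<Lambda> where d0: "0 < d0" "0 \<le> \<Lambda>"
    "\<And>p q u. p \<in> K \<Longrightarrow> q \<in> K \<Longrightarrow> dist p q < d0 \<Longrightarrow> norm (L q u - L p u) \<le> \<Lambda> * norm (q - p) * norm u"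
    using L_locally_lipschitz by blast
  \<comment> \<open>\<open>G\<close> bounds \<open>norm (q - p) + norm (b - a)\<close>, for the two
    lifts \<open>a\<close> and \<open>b\<close>, by a multiple of
    \<open>norm (q - p) + norm (v' - v)\<close>; an accuracy \<open>\<eta> / G\<close> for the
    parallelogram therefore yields \<eta>.\<close>
  define G where "G = 1 + C + \<Lambda> * \<rho>"
  have "0 < G" using nonneg d0 assms by (simp add: G_def add_pos_nonneg)
  define e where "e = \<eta> / G"
  define B where "B = (1 + C) * \<rho>"
  have "0 < e" "0 < B" using \<open>0 < G\<close> assms nonneg by (simp_all add: e_def B_def)
  define P where "P i d \<longleftrightarrow> 0 < d \<and> (\<forall>p q a b h. p \<in> Kc i \<longrightarrow> dist p q < d \<longrightarrow> 0 < h \<longrightarrow> h < d \<longrightarrow> norm a \<le> B \<longrightarrow> norm b \<le> B \<longrightarrow>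
        frame_map (\<alpha> i) p a = 0 \<longrightarrow> frame_map (\<alpha> i) q b = 0
      \<longrightarrow> norm (frame_map (\<alpha> i) (p + h *\<^sub>R a) ((q + h *\<^sub>R b) - (p + h *\<^sub>R a)) - frame_map (\<alpha> i) p (q - p)
            - h *\<^sub>R frame_d (\<alpha> i) p a (q - p))
          \<le> h * e * (norm (q - p) + norm (b - a)))" for i d
  have "\<exists>d. P i d" if "i \<in> I" for i
    unfolding P_def by (rule frame_map_parallelogram[where \<alpha> = "\<alpha> i", OF open_V[OF that] compact_Kc[OF that] Kc_subset[OF that] C1_frame[OF that] \<open>0 < e\<close> \<open>0 < B\<close>]) blast
  then obtain d1 where PD: "\<And>i. i \<in> I \<Longrightarrow> P i (d1 i)"
    by metis
  have d1: "0 < d1 i" if "i \<in> I" for i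
    using PD[OF that] unfolding P_def by blast
  have d1': "norm (frame_map (\<alpha> i) (p + h *\<^sub>R a) ((q + h *\<^sub>R b) - (p + h *\<^sub>R a)) - frame_map (\<alpha> i) p (q - p)
            - h *\<^sub>R frame_d (\<alpha> i) p a (q - p))
          \<le> h * e * (norm (q - p) + norm (b - a))"
    if "i \<in> I" "p \<in> Kc i" "dist p q < d1 i" "0 < h" "h < d1 i" "norm a \<le> B" "norm b \<le> B"
        "frame_map (\<alpha> i) p a = 0" "frame_map (\<alpha> i) q b = 0" for i p q a b h
    using PD[OF that(1)] that(2-) unfolding P_def by blast
  obtain d2 \<Lambda>2 where d2: "0 < d2" "0 < \<Lambda>2"
    "\<And>i p q u. i \<in> I \<Longrightarrow> p \<in> Kc i \<Longrightarrow> dist p q < d2 \<Longrightarrow> q \<in> V i \<and>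
       norm (frame_map (\<alpha> i) q u - frame_map (\<alpha> i) p u) \<le> \<Lambda>2 * norm (q - p) * norm u"
    using frame_lipschitz by blast
  \<comment> \<open>The entry \<open>d2 / B\<close> keeps the end of a step from \<open>Kc i\<close>
    inside the same chart \<open>V i\<close>, since a step has length at most
    \<open>h * B\<close>.\<close>
  let ?DS = "insert d0 (insert d2 (insert (d2 / B) (d1 ` I)))"
  have fin: "finite ?DS" using finite_I by simp
  define d where "d = Min ?DS"
  have d_le: "d \<le> d0" "d \<le> d2" "d \<le> d2 / B" "\<And>i. i \<in> I \<Longrightarrow> d \<le> d1 i"
    unfolding d_def by (rule Min_le[OF fin]; simp)+
  have "0 < d" unfolding d_def using fin d0 d1 d2 \<open>0 < B\<close> by (subst Min_gr_iff) auto
  show ?thesis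
  proof
    show "0 < d" by fact
    fix p q :: "('m, 'n) pt" and v v' :: "real ^ 'm" and h :: real
    assume p: "p \<in> K" and q: "q \<in> K" and pq: "dist p q < d" and h: "0 < h" "h < d"
      and v: "norm v \<le> \<rho>" and v': "norm v' \<le> \<rho>"
    obtain i where i: "i \<in> I" "p \<in> Kc i" "p \<in> V i" using obtain_chart[OF p] .
    let ?a = "lift_vector L p v" and ?b = "lift_vector L q v'"
    have qV: "q \<in> V i" using d2(3)[OF i(1,2), of q] pq d_le by simp
    have a: "norm ?a \<le> B" and b: "norm ?b \<le> B"
      unfolding B_def using nonneg
      by (auto intro!: order_trans[OF norm_lift_le] mult_left_mono p q v v')
    have "norm (h *\<^sub>R ?a) \<le> h * B" using a h by simp
    also have "\<dots> < d * B" using h \<open>0 < B\<close> by simp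
    also have "\<dots> \<le> d2" using d_le(3) \<open>0 < B\<close> by (simp add: field_simps)
    finally have pV: "p + h *\<^sub>R ?a \<in> V i" using d2(3)[OF i(1,2), of "p + h *\<^sub>R ?a"] by (simp add: dist_norm)
    \<comment> \<open>The splitting of \<open>q - p\<close> into the lift of \<open>r\<close> and
      the vertical vector \<open>w\<close>: \<open>D\<close> bounds \<open>frame_d\<close> on the
      former, \<open>M\<close> on the latter.\<close>
    define r where "r = fst (q - p)"
    define w where "w = snd (q - p) - L p r"
    have qp: "q - p = lift_vector L p r + (0, w)"
      by (simp add: lift_vector_def r_def w_def prod_eq_iff)
    have N: "fnorm p (q - p) = norm (frame_map (\<alpha> i) p (0, w))"
      using fnorm_lift_diff[OF p, of "q - p"] fnorm_eq[OF i(1,3)] by (simp add: w_def r_def)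
    have "frame_d (\<alpha> i) p ?a (q - p) = frame_d (\<alpha> i) p ?a (lift_vector L p r) + frame_d (\<alpha> i) p ?a (0, w)"
      unfolding qp by (rule frame_d_add[OF C1_frame[OF i(1)] i(3)])
    then have "norm (frame_d (\<alpha> i) p ?a (q - p))
        \<le> norm (frame_d (\<alpha> i) p ?a (lift_vector L p r)) + norm (frame_d (\<alpha> i) p ?a (0, w))"
      by (simp add: norm_triangle_ineq)
    also have "\<dots> \<le> D * norm ?a * norm (lift_vector L p r) + M * norm ?a * fnorm p (q - p)"
      unfolding N by (intro add_mono curvature_bound mixed_bound i)
    also have "\<dots> \<le> D * B * ((1 + C) * norm r) + M * B * fnorm p (q - p)"
      by (intro add_mono mult_mono mult_nonneg_nonneg a norm_lift_le p fnorm_nonneg order_refl)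
        (use nonneg \<open>0 < B\<close> in auto)
    finally have dA: "norm (frame_d (\<alpha> i) p ?a (q - p)) \<le> D * B * ((1 + C) * norm r) + M * B * fnorm p (q - p)" .
    have "?b - ?a = lift_vector L p (v' - v) + (0, L q v' - L p v')"
      by (simp add: lift_vector_def prod_eq_iff blinfun.diff_right)
    then have "norm (?b - ?a) \<le> norm (lift_vector L p (v' - v)) + norm ((0, L q v' - L p v') :: ('m, 'n) pt)"
      by (metis norm_triangle_ineq)
    also have "\<dots> \<le> (1 + C) * norm (v' - v) + \<Lambda> * norm (q - p) * norm v'"
      using norm_lift_le[OF p, of "v' - v"] d0(3)[OF p q, of v'] pq d_le(1) by (simp add: norm_Pair)
    also have "\<dots> \<le> (1 + C) * norm (v' - v) + \<Lambda> * norm (q - p) * \<rho>"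
      using v' d0(2) by (intro add_left_mono mult_left_mono) auto
    finally have "norm (q - p) + norm (?b - ?a) \<le> (1 + \<Lambda> * \<rho>) * norm (q - p) + (1 + C) * norm (v' - v)"
      by (simp add: algebra_simps)
    also have "\<dots> \<le> G * norm (q - p) + G * norm (v' - v)"
      using nonneg d0(2) assms by (intro add_mono mult_right_mono) (auto simp: G_def)
    finally have "e * (norm (q - p) + norm (?b - ?a)) \<le> e * (G * norm (q - p) + G * norm (v' - v))"
      using \<open>0 < e\<close> by (intro mult_left_mono) auto
    also have "\<dots> = (e * G) * (norm (q - p) + norm (v' - v))" by (simp add: algebra_simps)
    also have "e * G = \<eta>" using \<open>0 < G\<close> by (simp add: e_def)
    finally have ba: "e * (norm (q - p) + norm (?b - ?a)) \<le> \<eta> * (norm (q - p) + norm (v' - v))" .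
    let ?A' = "frame_map (\<alpha> i) (p + h *\<^sub>R ?a) ((q + h *\<^sub>R ?b) - (p + h *\<^sub>R ?a))"
    have "norm (?A' - frame_map (\<alpha> i) p (q - p) - h *\<^sub>R frame_d (\<alpha> i) p ?a (q - p))
          \<le> h * e * (norm (q - p) + norm (?b - ?a))"
      by (rule d1'[OF i(1,2)])
        (use pq h d_le(4)[OF i(1)] a b annihilates[OF i(1,3)] annihilates[OF i(1) qV] in auto)
    also have "\<dots> \<le> h * (\<eta> * (norm (q - p) + norm (v' - v)))"
      using mult_left_mono[OF ba, of h] h by (simp add: mult.assoc)
    finally have "norm ?A' \<le> norm (frame_map (\<alpha> i) p (q - p)) + norm (h *\<^sub>R frame_d (\<alpha> i) p ?a (q - p))
        + h * (\<eta> * (norm (q - p) + norm (v' - v)))"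
      using norm_triangle_ineq[of "?A' - frame_map (\<alpha> i) p (q - p) - h *\<^sub>R frame_d (\<alpha> i) p ?a (q - p)"
          "frame_map (\<alpha> i) p (q - p) + h *\<^sub>R frame_d (\<alpha> i) p ?a (q - p)"]
        norm_triangle_ineq[of "frame_map (\<alpha> i) p (q - p)" "h *\<^sub>R frame_d (\<alpha> i) p ?a (q - p)"]
      by simp
    also have "\<dots> \<le> fnorm p (q - p) + h * (D * B * ((1 + C) * norm r) + M * B * fnorm p (q - p))
        + h * (\<eta> * (norm (q - p) + norm (v' - v)))"
      using mult_left_mono[OF dA, of h] h by (simp add: fnorm_eq[OF i(1,3)])
    finally show "fnorm (euler_step L h v p) (euler_step L h v' q - euler_step L h v p)
       \<le> (1 + h * (M * ((1 + C) * \<rho>))) * fnorm p (q - p)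
         + h * (D * ((1 + C) * \<rho>) * (1 + C)) * norm (fst (q - p))
         + h * \<eta> * (norm (q - p) + norm (v' - v))"
      unfolding euler_step_def fnorm_eq[OF i(1) pV] B_def r_def by (simp add: algebra_simps)
  qed
qed

text \<open>The one-step estimate holds only for points closer than \<open>d\<close>. The last
  hypothesis says that the very bound to be proved keeps the polygons that close, which lets the
  induction sustain itself. The terms with \<eta> in \<open>a\<close> and \<open>b\<close> arise
  from inserting \<open>norm_le_fnorm\<close> for \<open>norm (q - p)\<close>.\<close>

lemma euler_stability:
  assumes "0 < \<eta>" "0 < \<rho>"
  defines "a \<equiv> M * ((1 + C) * \<rho>) + \<eta> * S"
    and "b \<equiv> D * ((1 + C) * \<rho>) * (1 + C) + \<eta> * (2 + C)"
  obtains d where "0 < d"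
    "\<And>p q v v' h n. \<lbrakk>fst p = fst q; 0 < h; h < d; real n * h \<le> 1; norm v \<le> \<rho>; norm v' \<le> \<rho>;
      \<And>j. j \<le> n \<Longrightarrow> (euler_step L h v ^^ j) p \<in> K; \<And>j. j \<le> n \<Longrightarrow> (euler_step L h v' ^^ j) q \<in> K;
      (1 + C) * norm (v' - v) + S * (exp a * (fnorm p (q - p) + b * norm (v' - v))) < d\<rbrakk> \<Longrightarrow>
      fnorm ((euler_step L h v ^^ n) p) ((euler_step L h v' ^^ n) q - (euler_step L h v ^^ n) p)
      \<le> exp a * (fnorm p (q - p) + b * norm (v' - v))"
proof -
  obtain d where d: "0 < d"
    "\<And>p q v v' h. \<lbrakk>p \<in> K; q \<in> K; dist p q < d; 0 < h; h < d; norm v \<le> \<rho>; norm v' \<le> \<rho>\<rbrakk> \<Longrightarrow>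
      fnorm (euler_step L h v p) (euler_step L h v' q - euler_step L h v p)
       \<le> (1 + h * (M * ((1 + C) * \<rho>))) * fnorm p (q - p)
         + h * (D * ((1 + C) * \<rho>) * (1 + C)) * norm (fst (q - p))
         + h * \<eta> * (norm (q - p) + norm (v' - v))"
    using euler_step_estimate[OF assms(1,2)] by blast
  have a0: "0 \<le> a" and b0: "0 \<le> b" using nonneg assms by (simp_all add: a_def b_def)
  show ?thesis
  proof
    show "0 < d" by fact
    fix p q :: "('m, 'n) pt" and v v' :: "real ^ 'm" and h :: real and n :: nat
    assume fpq: "fst p = fst q" and h: "0 < h" "h < d" and nh: "real n * h \<le> 1" and v: "norm v \<le> \<rho>" "norm v' \<le> \<rho>"
      and pK: "\<And>j. j \<le> n \<Longrightarrow> (euler_step L h v ^^ j) p \<in> K" and qK: "\<And>j. j \<le> n \<Longrightarrow> (euler_step L h v' ^^ j) q \<in> K"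
      and small: "(1 + C) * norm (v' - v) + S * (exp a * (fnorm p (q - p) + b * norm (v' - v))) < d"
    let ?P = "\<lambda>j. (euler_step L h v ^^ j) p" and ?Q = "\<lambda>j. (euler_step L h v' ^^ j) q"
    let ?N = "\<lambda>j. fnorm (?P j) (?Q j - ?P j)" and ?\<Delta> = "norm (v' - v)"
    \<comment> \<open>The induction needs the elapsed time \<open>j * h\<close> in the exponent and
      in the inhomogeneity; the constants of the claim are the values at time 1.\<close>
    have main: "?N j \<le> exp (a * (real j * h)) * (?N 0 + real j * h * (b * ?\<Delta>))" if "j \<le> n" for j
      using that
    proof (induction j)
      case 0
      then show ?case by simp
    next
      case (Suc j)
      then have jn: "j \<le> n" by simp
      have IH: "?N j \<le> exp (a * (real j * h)) * (?N 0 + real j * h * (b * ?\<Delta>))" using Suc by simp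
      have "real j * h \<le> real n * h" using jn h by (intro mult_right_mono) auto
      then have jh: "real j * h \<le> 1" using nh by linarith
      have N0: "0 \<le> ?N 0" by (rule fnorm_nonneg)
      have "exp (a * (real j * h)) \<le> exp a"
        using mult_left_mono[OF jh a0] by simp
      moreover have "real j * h * (b * ?\<Delta>) \<le> 1 * (b * ?\<Delta>)"
        using jh b0 by (intro mult_right_mono) auto
      ultimately have "?N j \<le> exp a * (?N 0 + b * ?\<Delta>)"
        by (intro order_trans[OF IH] mult_mono) (use N0 h b0 in auto)
      then have SN: "S * ?N j \<le> S * (exp a * (?N 0 + b * ?\<Delta>))"
        by (rule mult_left_mono) (rule nonneg)
      have "fst (?Q j - ?P j) = (real j * h) *\<^sub>R (v' - v)"
        by (simp add: fst_euler_iterate fpq algebra_simps)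
      then have fst_le: "norm (fst (?Q j - ?P j)) \<le> ?\<Delta>"
        using mult_right_mono[OF jh norm_ge_zero[of "v' - v"]] h by simp
      have dn: "norm (?Q j - ?P j) \<le> (1 + C) * ?\<Delta> + S * ?N j"
        using norm_le_fnorm[OF pK[OF jn], of "?Q j - ?P j"] mult_left_mono[OF fst_le, of "1 + C"] nonneg
        by linarith
      have "dist (?P j) (?Q j) < d"
        using dn SN small by (simp add: dist_norm norm_minus_commute)
      have "?N (Suc j) \<le> (1 + h * (M * ((1 + C) * \<rho>))) * ?N j
         + h * (D * ((1 + C) * \<rho>) * (1 + C)) * norm (fst (?Q j - ?P j))
         + h * \<eta> * (norm (?Q j - ?P j) + ?\<Delta>)"
        using d(2)[OF pK[OF jn] qK[OF jn] \<open>dist (?P j) (?Q j) < d\<close> h v] by simp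
      also have "\<dots> \<le> (1 + h * (M * ((1 + C) * \<rho>))) * ?N j
         + h * (D * ((1 + C) * \<rho>) * (1 + C)) * ?\<Delta>
         + h * \<eta> * (((1 + C) * ?\<Delta> + S * ?N j) + ?\<Delta>)"
        by (intro add_mono mult_left_mono order_refl fst_le dn) (use nonneg h assms(1,2) in auto)
      also have "\<dots> = (1 + h * a) * ?N j + h * (b * ?\<Delta>)"
        by (simp add: a_def b_def algebra_simps)
      also have "\<dots> \<le> exp (h * a) * ?N j + exp (a * (real (Suc j) * h)) * (h * (b * ?\<Delta>))"
        using mult_right_mono[OF exp_ge_add_one_self[of "h * a"] fnorm_nonneg[of "?P j" "?Q j - ?P j"]]
          mult_right_mono[of 1 "exp (a * (real (Suc j) * h))" "h * (b * ?\<Delta>)"] h a0 b0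
        by (simp add: algebra_simps)
      also have "\<dots> \<le> exp (h * a) * (exp (a * (real j * h)) * (?N 0 + real j * h * (b * ?\<Delta>)))
          + exp (a * (real (Suc j) * h)) * (h * (b * ?\<Delta>))"
        using IH by (intro add_right_mono mult_left_mono) auto
      also have "\<dots> = exp (a * (real (Suc j) * h)) * (?N 0 + real (Suc j) * h * (b * ?\<Delta>))"
      proof -
        have "exp (a * (real (Suc j) * h)) = exp (h * a) * exp (a * (real j * h))"
          by (simp add: exp_add[symmetric] algebra_simps)
        then show ?thesis by (simp only:) (simp add: algebra_simps)
      qed
      finally show ?case .
    qed
    have "?N n \<le> exp (a * (real n * h)) * (?N 0 + real n * h * (b * ?\<Delta>))" using main by simp
    also have "\<dots> \<le> exp a * (?N 0 + 1 * (b * ?\<Delta>))"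
      by (intro mult_mono add_left_mono mult_right_mono)
        (use mult_left_mono[OF nh a0] nh b0 h fnorm_nonneg[of "?P 0" "?Q 0 - ?P 0"] in auto)
    finally show "?N n \<le> exp a * (fnorm p (q - p) + b * ?\<Delta>)" by simp
  qed
qed

end

section \<open>Surfaces swept out by polygons, and polygons tracking a curve\<close>

lemma uniform_vector_derivative:
  fixes y :: "real \<Rightarrow> 'a::real_normed_vector"
  assumes der: "\<And>t. t \<in> {0..1} \<Longrightarrow> (y has_vector_derivative y' t) (at t within {0..1})"
    and cont: "continuous_on {0..1} y'" and "0 < e"
  obtains d where "0 < d" "\<And>s t. \<lbrakk>s \<in> {0..1}; t \<in> {0..1}; \<bar>s - t\<bar> < d\<rbrakk> \<Longrightarrow>
    norm (y s - y t - (s - t) *\<^sub>R y' t) \<le> e * \<bar>s - t\<bar>"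
proof -
  have "uniformly_continuous_on {0..1} y'"
    using compact_uniformly_continuous[OF cont compact_Icc] .
  then obtain d where d: "d > 0" "\<And>x z. x \<in> {0..1} \<Longrightarrow> z \<in> {0..1} \<Longrightarrow> dist z x < d \<Longrightarrow> dist (y' z) (y' x) < e"
    unfolding uniformly_continuous_on_def using \<open>0 < e\<close> by meson
  show ?thesis
  proof
    show "0 < d" by fact
    fix s t :: real assume s: "s \<in> {0..1}" and t: "t \<in> {0..1}" and st: "\<bar>s - t\<bar> < d"
    let ?S = "{0..1} \<inter> ball t d"
    have "norm ((y s - s *\<^sub>R y' t) - (y t - t *\<^sub>R y' t)) \<le> e * norm (s - t)"
    proof (rule differentiable_bound[where S = ?S and f' = "\<lambda>x h. h *\<^sub>R (y' x - y' t)"])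
      show "convex ?S" by (intro convex_Int convex_ball convex_real_interval)
      fix x assume x: "x \<in> ?S"
      have "(y has_derivative (\<lambda>h. h *\<^sub>R y' x)) (at x within ?S)"
        using der[of x] x by (auto simp: has_vector_derivative_def intro: has_derivative_subset)
      then show "((\<lambda>x. y x - x *\<^sub>R y' t) has_derivative (\<lambda>h. h *\<^sub>R (y' x - y' t))) (at x within ?S)"
        by (auto intro!: derivative_eq_intros simp: algebra_simps)
      have "dist (y' x) (y' t) < e" using d(2)[OF t, of x] x by (auto simp: dist_commute)
      then have "norm (y' x - y' t) \<le> e" by (simp add: dist_norm)
      then show "onorm (\<lambda>h. h *\<^sub>R (y' x - y' t)) \<le> e"
        using \<open>0 < e\<close> by (intro onorm_le) (simp add: mult.commute[of e] mult_left_mono)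
    qed (use s t st d in \<open>auto simp: dist_real_def\<close>)
    then show "norm (y s - y t - (s - t) *\<^sub>R y' t) \<le> e * \<bar>s - t\<bar>"
      by (simp add: algebra_simps)
  qed
qed

text \<open>Serves to choose the one-step error \<eta> so that the final constant exceeds its value
  at \<open>\<eta> = 0\<close> by at most \<open>e\<close>.\<close>

lemma obtain_small_parameter:
  fixes F :: "real \<Rightarrow> real"
  assumes "(F \<longlongrightarrow> l) (at 0)" "0 < e"
  obtains \<eta> where "0 < \<eta>" "F \<eta> \<le> l + e"
proof -
  obtain s where s: "s > 0" "\<And>x. x \<noteq> 0 \<Longrightarrow> norm (x - 0) < s \<Longrightarrow> norm (F x - l) < e"
    using LIM_D[OF assms] by blast
  from s(2)[of "s/2"] s(1) show ?thesis by (intro that[of "s/2"]) auto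
qed

context framed_bundle
begin

lemma frame_bounded:
  obtains B where "0 < B" "\<And>i p u. i \<in> I \<Longrightarrow> p \<in> Kc i \<Longrightarrow> norm (frame_map (\<alpha> i) p u) \<le> B * norm u"
proof -
  have "\<exists>b>0. \<forall>p\<in>Kc i. norm (\<alpha> i j p) \<le> b" if iI: "i \<in> I" for i j
  proof -
    have "continuous_on (V i) (\<alpha> i j)"
      using C1_on_imp_differentiable[OF C1_frame[OF iI]]
      by (meson continuous_at_imp_continuous_on differentiable_imp_continuous_within)
    from compact_bounded_image[OF this compact_Kc[OF iI] Kc_subset[OF iI]] show ?thesis by metis
  qed
  then obtain b where b: "\<And>i j. i \<in> I \<Longrightarrow> 0 < b i j" "\<And>i j p. i \<in> I \<Longrightarrow> p \<in> Kc i \<Longrightarrow> norm (\<alpha> i j p) \<le> b i j"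
    by metis
  let ?S = "insert 1 ((\<lambda>i. \<Sum>j\<in>UNIV. b i j) ` I)"
  have fin: "finite ?S" using finite_I by simp
  show ?thesis
  proof
    have "1 \<le> Max ?S" by (rule Max_ge[OF fin]) simp
    then show "0 < Max ?S" by simp
    fix i p and u :: "('m, 'n) pt" assume i: "i \<in> I" "p \<in> Kc i"
    have "norm (frame_map (\<alpha> i) p u) \<le> (\<Sum>j\<in>UNIV. \<bar>frame_map (\<alpha> i) p u $ j\<bar>)" by (rule norm_le_l1_cart)
    also have "\<dots> \<le> (\<Sum>j\<in>UNIV. b i j * norm u)"
    proof (rule sum_mono)
      fix j
      have "\<bar>\<alpha> i j p u\<bar> \<le> norm (\<alpha> i j p) * norm u" using norm_blinfun[of "\<alpha> i j p" u] by simp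
      also have "\<dots> \<le> b i j * norm u" by (intro mult_right_mono b i) simp
      finally show "\<bar>frame_map (\<alpha> i) p u $ j\<bar> \<le> b i j * norm u" by (simp add: frame_map_def)
    qed
    also have "\<dots> = (\<Sum>j\<in>UNIV. b i j) * norm u" by (simp add: sum_distrib_right)
    also have "\<dots> \<le> Max ?S * norm u" by (intro mult_right_mono Max_ge[OF fin]) (use i in auto)
    finally show "norm (frame_map (\<alpha> i) p u) \<le> Max ?S * norm u" .
  qed
qed

text \<open>The bound \<open>C\<close> on the slope is available only inside the box, so the speed
  limit \<open>C * \<rho>\<close> for the second component and the confinement to the box have to be
  proved together.\<close>

lemma euler_iterate_in_box:
  assumes K: "K = cball x0 r \<times> cball y0 r" and h: "0 \<le> h" and v: "norm v \<le> \<rho>"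
    and x: "\<And>j. j \<le> n \<Longrightarrow> fst p + (real j * h) *\<^sub>R v \<in> cball x0 r"
    and y: "dist y0 (snd p) + real n * h * (C * \<rho>) \<le> r"
    and "j \<le> n"
  shows "(euler_step L h v ^^ j) p \<in> K"
proof -
  have C\<rho>: "0 \<le> C * \<rho>" using nonneg v norm_ge_zero[of v] by (simp del: norm_ge_zero)
  have box: "q \<in> K" if "fst q = fst p + (real j * h) *\<^sub>R v" "dist y0 (snd q) \<le> dist y0 (snd p) + real j * h * (C * \<rho>)" "j \<le> n" for q j
  proof -
    have "real j * h * (C * \<rho>) \<le> real n * h * (C * \<rho>)"
      using that(3) h C\<rho> by (intro mult_right_mono) auto
    then show ?thesis using x[OF that(3)] that y unfolding K by (cases q) auto
  qed
  have "dist y0 (snd ((euler_step L h v ^^ j) p)) \<le> dist y0 (snd p) + real j * h * (C * \<rho>)" if "j \<le> n" for j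
    using that
  proof (induction j)
    case 0
    then show ?case by simp
  next
    case (Suc j)
    let ?q = "(euler_step L h v ^^ j) p"
    have IH: "dist y0 (snd ?q) \<le> dist y0 (snd p) + real j * h * (C * \<rho>)" using Suc by simp
    then have "?q \<in> K" using Suc by (intro box[of _ j]) (auto simp: fst_euler_iterate)
    then have "norm (L ?q v) \<le> C * \<rho>"
      using norm_blinfun[of "L ?q" v] mult_mono[OF L_bound v] nonneg by fastforce
    then have "dist (snd ?q) (snd (euler_step L h v ?q)) \<le> h * (C * \<rho>)"
      using h by (simp add: euler_step_def lift_vector_def dist_norm mult_left_mono)
    then show ?case
      using IH dist_triangle[of y0 "snd (euler_step L h v ?q)" "snd ?q"] by (simp add: algebra_simps)
  qed
  with \<open>j \<le> n\<close> show ?thesis by (intro box[of _ j]) (auto simp: fst_euler_iterate)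
qed

text \<open>The number \<open>n\<close> of steps is fixed once, and \<open>f v\<close> is the height
  of the polygon with velocity \<open>v\<close> after unit time. Polygons of \<open>v\<close> and
  \<open>v'\<close> start at the same point, so only the inhomogeneity
  \<open>b * norm (v' - v)\<close> drives them apart; by \<open>vertical_le_fnorm\<close> the frame
  norm of their final difference is the deviation of \<open>f\<close> from its slope.\<close>

theorem euler_surface:
  assumes K: "K = cball x0 r \<times> cball y0 r" and "0 < \<rho>" "\<rho> \<le> r" "C * \<rho> \<le> r" "0 < e"
  obtains f d where "0 < d" "f 0 = y0" "\<And>v. norm v \<le> \<rho> \<Longrightarrow> (x0 + v, f v) \<in> K"
    "\<And>v v'. \<lbrakk>norm v \<le> \<rho>; norm v' \<le> \<rho>; norm (v' - v) < d\<rbrakk> \<Longrightarrow>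
      norm (f v' - f v - L (x0 + v, f v) (v' - v))
        \<le> (S * exp (M * ((1 + C) * \<rho>)) * D * ((1 + C) * \<rho> * (1 + C)) + e) * norm (v' - v)"
proof -
  let ?l = "(1 + C) * \<rho>"
  have "((\<lambda>\<eta>. S * (exp (M * ?l + \<eta> * S) * (D * ?l * (1 + C) + \<eta> * (2 + C))))
     \<longlongrightarrow> S * (exp (M * ?l + 0 * S) * (D * ?l * (1 + C) + 0 * (2 + C)))) (at 0)"
    by (intro tendsto_intros)
  then obtain \<eta> where \<eta>: "0 < \<eta>" "S * (exp (M * ?l + \<eta> * S) * (D * ?l * (1 + C) + \<eta> * (2 + C)))
     \<le> S * (exp (M * ?l + 0 * S) * (D * ?l * (1 + C) + 0 * (2 + C))) + e"
    using obtain_small_parameter[OF _ \<open>0 < e\<close>] by blast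
  define a where "a = M * ?l + \<eta> * S"
  define b where "b = D * ?l * (1 + C) + \<eta> * (2 + C)"
  have Sab: "S * (exp a * b) \<le> S * exp (M * ?l) * D * (?l * (1 + C)) + e"
    using \<eta>(2) by (simp add: a_def b_def algebra_simps)
  have b0: "0 \<le> b" using nonneg \<eta> \<open>0 < \<rho>\<close> by (simp add: b_def)
  obtain d where d: "0 < d"
    "\<And>p q v v' h n. \<lbrakk>fst p = fst q; 0 < h; h < d; real n * h \<le> 1; norm v \<le> \<rho>; norm v' \<le> \<rho>;
      \<And>j. j \<le> n \<Longrightarrow> (euler_step L h v ^^ j) p \<in> K; \<And>j. j \<le> n \<Longrightarrow> (euler_step L h v' ^^ j) q \<in> K;
      (1 + C) * norm (v' - v) + S * (exp a * (fnorm p (q - p) + b * norm (v' - v))) < d\<rbrakk> \<Longrightarrow>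
      fnorm ((euler_step L h v ^^ n) p) ((euler_step L h v' ^^ n) q - (euler_step L h v ^^ n) p)
      \<le> exp a * (fnorm p (q - p) + b * norm (v' - v))"
    unfolding a_def b_def using euler_stability[OF \<open>0 < \<eta>\<close> \<open>0 < \<rho>\<close>] by blast
  obtain n :: nat where n: "n > 0" "1 / real n < d"
    using reals_Archimedean[OF d(1)] by (metis inverse_eq_divide zero_less_Suc)
  define h where "h = 1 / real n"
  have h: "0 < h" "h < d" "real n * h = 1" using n by (simp_all add: h_def)
  define P where "P v j = (euler_step L h v ^^ j) (x0, y0)" for v j
  define f where "f v = snd (P v n)" for v
  have inK: "P v j \<in> K" if v: "norm v \<le> \<rho>" and j: "j \<le> n" for v j
    unfolding P_def
  proof (rule euler_iterate_in_box[OF K _ v _ _ j])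
    fix k assume "k \<le> n"
    then have "real k * h \<le> 1" using h mult_right_mono[of "real k" "real n" h] by simp
    then have "norm ((real k * h) *\<^sub>R v) \<le> 1 * norm v" using h by (simp add: mult_left_le_one_le)
    then show "fst (x0, y0) + (real k * h) *\<^sub>R v \<in> cball x0 r"
      using v \<open>\<rho> \<le> r\<close> by (simp add: dist_norm)
  qed (use h \<open>C * \<rho> \<le> r\<close> in auto)
  have Pn: "P v n = (x0 + v, f v)" for v
    by (simp add: prod_eq_iff f_def) (simp add: P_def fst_euler_iterate h)
  \<comment> \<open>Exactly the threshold that implies the smallness hypothesis of
    \<open>euler_stability\<close> for a zero initial difference.\<close>
  define d' where "d' = d / (1 + C + S * (exp a * b))"
  have den: "0 < 1 + C + S * (exp a * b)" using nonneg b0 by (simp add: add_pos_nonneg)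
  show ?thesis
  proof
    show "0 < d'" using d(1) den by (simp add: d'_def)
    have "P 0 j = (x0, y0)" for j
      unfolding P_def by (induction j) (auto simp: euler_step_def lift_vector_def blinfun.zero_right)
    then show "f 0 = y0" by (simp add: f_def)
    show "(x0 + v, f v) \<in> K" if "norm v \<le> \<rho>" for v
      using inK[OF that, of n] Pn by simp
    fix v v' :: "real ^ 'm" assume v: "norm v \<le> \<rho>" and v': "norm v' \<le> \<rho>" and dv: "norm (v' - v) < d'"
    have f0: "fnorm (x0, y0) ((x0, y0) - (x0, y0)) = 0" by (simp add: fnorm_def frame_map_def blinfun.zero_right vec_eq_iff)
    have small: "(1 + C) * norm (v' - v) + S * (exp a * (0 + b * norm (v' - v))) < d"
      using dv den by (simp add: d'_def pos_less_divide_eq algebra_simps)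
    have "fnorm (P v n) (P v' n - P v n) \<le> exp a * (0 + b * norm (v' - v))"
      using d(2)[of "(x0, y0)" "(x0, y0)" h n v v', unfolded f0] inK[OF v] inK[OF v'] h small v v'
      by (simp add: P_def)
    then have "S * fnorm (P v n) (P v' n - P v n) \<le> S * (exp a * b) * norm (v' - v)"
      using mult_left_mono[of _ _ S] nonneg by (simp add: mult.assoc)
    also have "\<dots> \<le> (S * exp (M * ?l) * D * (?l * (1 + C)) + e) * norm (v' - v)"
      by (intro mult_right_mono Sab) simp
    finally show "norm (f v' - f v - L (x0 + v, f v) (v' - v))
        \<le> (S * exp (M * ?l) * D * (?l * (1 + C)) + e) * norm (v' - v)"
      using vertical_le_fnorm[OF inK[OF v, of n], of "P v' n - P v n"] by (simp add: Pn)
  qed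
qed

end

context framed_bundle
begin

text \<open>
  Discrete variation of constants: the Euler polygons started at consecutive points of the given
  curve differ initially by \<open>h R\<close>, a difference that grows at most by a constant factor.
\<close>

theorem euler_tracks_curve:
  assumes K: "K = cball x0 r \<times> cball y0 r" and "0 < \<rho>" "\<rho> \<le> r" "C * \<rho> \<le> r / 2" and v: "norm v \<le> \<rho>"
    and der: "\<And>t. t \<in> {0..1} \<Longrightarrow> (y has_vector_derivative y' t) (at t within {0..1})"
    and cont: "continuous_on {0..1} y'"
    and y_close: "\<And>t. t \<in> {0..1} \<Longrightarrow> dist y0 (y t) \<le> r / 2"
    and deriv_bound: "\<And>t. t \<in> {0..1} \<Longrightarrow> norm (v, y' t) \<le> (1 + C) * \<rho>"
    and almost_tangent: "\<And>t i. \<lbrakk>t \<in> {0..1}; i \<in> I; (x0 + t *\<^sub>R v, y t) \<in> Kc i\<rbrakk> \<Longrightarrow>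
      norm (frame_map (\<alpha> i) (x0 + t *\<^sub>R v, y t) (v, y' t)) \<le> R * norm (v, y' t)"
    and "0 \<le> R" "0 < e"
  obtains n0 :: nat where "0 < n0" "\<And>n. n \<ge> n0 \<Longrightarrow>
    norm (y 1 - snd ((euler_step L (1 / real n) v ^^ n) (x0, y 0)))
      \<le> S * exp (M * ((1 + C) * \<rho>)) * (R * ((1 + C) * \<rho>)) + e"
proof -
  define l where "l = (1 + C) * \<rho>"
  have "0 < l" using nonneg \<open>0 < \<rho>\<close> by (simp add: l_def)
  have "((\<lambda>\<eta>. S * (exp (M * l + \<eta> * S) * (R * l + \<eta>)))
     \<longlongrightarrow> S * (exp (M * l + 0 * S) * (R * l + 0))) (at 0)"
    by (intro tendsto_intros)
  then obtain \<eta> where \<eta>: "0 < \<eta>" "S * (exp (M * l + \<eta> * S) * (R * l + \<eta>))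
     \<le> S * (exp (M * l + 0 * S) * (R * l + 0)) + e"
    using obtain_small_parameter[OF _ \<open>0 < e\<close>] by blast
  define a where "a = M * l + \<eta> * S"
  define b where "b = D * l * (1 + C) + \<eta> * (2 + C)"
  \<comment> \<open>\<open>h * Q\<close> will bound the frame norm of the defect after one step:
    \<open>R * l\<close> is the failure of the curve to be tangent to the subbundle, and \<eta> is
    shared equally by the linearisation of \<open>y\<close> and the change of the frame along the
    step.\<close>
  define Q where "Q = R * l + \<eta>"
  have "0 < Q" using \<eta> \<open>0 < l\<close> \<open>0 \<le> R\<close> by (simp add: Q_def add_nonneg_pos)
  obtain d where d: "0 < d"
    "\<And>p q v v' h n. \<lbrakk>fst p = fst q; 0 < h; h < d; real n * h \<le> 1; norm v \<le> \<rho>; norm v' \<le> \<rho>;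
      \<And>j. j \<le> n \<Longrightarrow> (euler_step L h v ^^ j) p \<in> K; \<And>j. j \<le> n \<Longrightarrow> (euler_step L h v' ^^ j) q \<in> K;
      (1 + C) * norm (v' - v) + S * (exp a * (fnorm p (q - p) + b * norm (v' - v))) < d\<rbrakk> \<Longrightarrow>
      fnorm ((euler_step L h v ^^ n) p) ((euler_step L h v' ^^ n) q - (euler_step L h v ^^ n) p)
      \<le> exp a * (fnorm p (q - p) + b * norm (v' - v))"
    unfolding a_def b_def l_def using euler_stability[OF \<open>0 < \<eta>\<close> \<open>0 < \<rho>\<close>] by blast
  obtain B where B: "0 < B" "\<And>i p u. i \<in> I \<Longrightarrow> p \<in> Kc i \<Longrightarrow> norm (frame_map (\<alpha> i) p u) \<le> B * norm u"
    using frame_bounded by blast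
  obtain d2 \<Lambda> where d2: "0 < d2" "0 < \<Lambda>"
    "\<And>i p q u. i \<in> I \<Longrightarrow> p \<in> Kc i \<Longrightarrow> dist p q < d2 \<Longrightarrow> q \<in> V i \<and>
       norm (frame_map (\<alpha> i) q u - frame_map (\<alpha> i) p u) \<le> \<Lambda> * norm (q - p) * norm u"
    using frame_lipschitz by blast
  define \<kappa> where "\<kappa> = \<eta> / (2 * B)"
  have "0 < \<kappa>" using B \<eta> by (simp add: \<kappa>_def)
  obtain d3 where d3: "0 < d3" "\<And>s t. \<lbrakk>s \<in> {0..1}; t \<in> {0..1}; \<bar>s - t\<bar> < d3\<rbrakk> \<Longrightarrow>
    norm (y s - y t - (s - t) *\<^sub>R y' t) \<le> \<kappa> * \<bar>s - t\<bar>"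
    using uniform_vector_derivative[OF der cont \<open>0 < \<kappa>\<close>] by blast
  define Z where "Z = \<Lambda> * l * (2 * l + \<kappa>)"
  have "0 < Z" using d2 \<open>0 < l\<close> \<open>0 < \<kappa>\<close> by (simp add: Z_def)
  \<comment> \<open>In order: the step bound of \<open>euler_stability\<close>; a step stays where
    the frame is Lipschitz; the linearisation of \<open>y\<close> applies; the second-order defect
    \<open>h * Z\<close> is at most \<open>\<eta> / 2\<close>; the defect \<open>h * Q\<close>
    passes the smallness hypothesis of \<open>euler_stability\<close>, where the summand 1 avoids a
    zero denominator.\<close>
  define m where "m = Min {d, d2 / l, d3, \<eta> / (2 * Z), d / (S * exp a * Q + 1)}"
  have SQ: "0 \<le> S * exp a * Q" using nonneg \<open>0 < Q\<close> by simp
  have m: "0 < m" "m \<le> d" "m \<le> d2 / l" "m \<le> d3" "m \<le> \<eta> / (2 * Z)" "m \<le> d / (S * exp a * Q + 1)"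
  proof -
    show "0 < m" unfolding m_def using d d2 d3 \<open>0 < l\<close> \<open>0 < Z\<close> \<eta> SQ
      by (auto intro!: divide_pos_pos)
  qed (auto simp: m_def)
  obtain n0 :: nat where n0: "0 < n0" "1 / real n0 < m"
    using reals_Archimedean[OF m(1)] by (metis inverse_eq_divide zero_less_Suc)
  show ?thesis
  proof
    show "0 < n0" by fact
    fix n assume "n0 \<le> n"
    then have n: "0 < n" using n0 by simp
    define h where "h = 1 / real n"
    have "h \<le> 1 / real n0" using \<open>n0 \<le> n\<close> n0 n by (simp add: h_def frac_le)
    then have h: "0 < h" "h < m" "real n * h = 1" using n n0 by (simp_all add: h_def)
    have hZ: "h * Z \<le> \<eta> / 2" and hl: "h * l < d2" and hd: "h < d" "h < d3"
    proof -
      have "h < \<eta> / (2 * Z)" using h m by simp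
      then show "h * Z \<le> \<eta> / 2" using \<open>0 < Z\<close> by (simp add: field_simps)
      have "h < d2 / l" using h m by simp
      then show "h * l < d2" using \<open>0 < l\<close> by (simp add: field_simps)
    qed (use h m in auto)
    have "h < d / (S * exp a * Q + 1)" using h m by simp
    then have hSQ: "S * (exp a * (h * Q)) < d" using SQ h by (simp add: pos_less_divide_eq algebra_simps)
    define \<gamma> where "\<gamma> i = (x0 + (real i * h) *\<^sub>R v, y (real i * h))" for i
    have ih: "real i * h \<in> {0..1}" if "i \<le> n" for i
      using that h mult_right_mono[of "real i" "real n" h] by simp
    have v_ball: "x0 + (real j * h) *\<^sub>R v \<in> cball x0 r" if "j \<le> n" for j
    proof -
      have "norm ((real j * h) *\<^sub>R v) \<le> 1 * norm v" using ih[OF that] h by (simp add: mult_left_le_one_le)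
      then show ?thesis using v \<open>\<rho> \<le> r\<close> by (simp add: dist_norm)
    qed
    have inK: "(euler_step L h v ^^ j) (\<gamma> i) \<in> K" if "i + j \<le> n" for i j
    proof (rule euler_iterate_in_box[OF K _ v, where n = "n - i"])
      fix k assume "k \<le> n - i"
      then have "i + k \<le> n" using that by simp
      from v_ball[OF this] show "fst (\<gamma> i) + (real k * h) *\<^sub>R v \<in> cball x0 r"
        by (simp add: \<gamma>_def algebra_simps)
    next
      \<comment> \<open>A polygon may start at any point of the curve, at height up to
        \<open>r / 2\<close> from \<open>y0\<close>, and climbs by at most another
        \<open>r / 2\<close>.\<close>
      have "real (n - i) * h \<le> 1" using ih[of "n - i"] by simp
      then have "real (n - i) * h * (C * \<rho>) \<le> 1 * (C * \<rho>)"
        using nonneg \<open>0 < \<rho>\<close> by (intro mult_right_mono) auto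
      then show "dist y0 (snd (\<gamma> i)) + real (n - i) * h * (C * \<rho>) \<le> r"
        using y_close[OF ih[of i]] that \<open>C * \<rho> \<le> r / 2\<close> by (simp add: \<gamma>_def)
    qed (use that h in auto)
    have defect: "fnorm (euler_step L h v (\<gamma> i)) (\<gamma> (Suc i) - euler_step L h v (\<gamma> i)) \<le> h * Q" if "i < n" for i
    proof -
      let ?t = "real i * h" and ?s = "real (Suc i) * h" and ?p = "euler_step L h v (\<gamma> i)"
      have t: "?t \<in> {0..1}" "?s \<in> {0..1}" using ih[of i] ih[of "Suc i"] that by auto
      have st: "?s - ?t = h" by (simp add: algebra_simps)
      define \<zeta> where "\<zeta> = y ?s - y ?t - h *\<^sub>R y' ?t"
      have \<zeta>: "norm \<zeta> \<le> h * \<kappa>"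
        using d3(2)[OF t(2,1)] hd h unfolding st \<zeta>_def by (simp add: mult.commute)
      have gK: "\<gamma> i \<in> K" using inK[of i 0] that by simp
      obtain c where c: "c \<in> I" "\<gamma> i \<in> Kc c" "\<gamma> i \<in> V c" using obtain_chart[OF gK] .
      let ?L = "lift_vector L (\<gamma> i) v"
      have Ll: "norm ?L \<le> l"
        unfolding l_def using nonneg by (intro order_trans[OF norm_lift_le[OF gK]] mult_left_mono v) auto
      have pg: "?p - \<gamma> i = h *\<^sub>R ?L" by (simp add: euler_step_def)
      have npg: "norm (?p - \<gamma> i) \<le> h * l" using Ll h by (simp add: pg)
      have dp: "dist (\<gamma> i) ?p < d2" using npg hl by (simp add: dist_norm norm_minus_commute)
      let ?q = "\<gamma> (Suc i) - ?p"
      have q: "?q = h *\<^sub>R (v, y' ?t) - h *\<^sub>R ?L + (0, \<zeta>)"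
        by (simp add: \<gamma>_def euler_step_def lift_vector_def \<zeta>_def algebra_simps)
      have nz: "norm ((0, \<zeta>) :: ('m, 'n) pt) \<le> h * \<kappa>" using \<zeta> by (simp add: norm_Pair)
      have "norm ?q \<le> norm (h *\<^sub>R (v, y' ?t)) + norm (h *\<^sub>R ?L) + norm ((0, \<zeta>) :: ('m, 'n) pt)"
        unfolding q using norm_triangle_ineq norm_triangle_ineq4 by (smt (verit))
      also have "\<dots> \<le> h * l + h * l + h * \<kappa>"
        using deriv_bound[OF t(1)] Ll nz h by (intro add_mono) (simp_all add: l_def del: scaleR_Pair)
      finally have nq: "norm ?q \<le> h * (2 * l + \<kappa>)" by (simp add: algebra_simps)
      have "frame_map (\<alpha> c) (\<gamma> i) ?q = h *\<^sub>R frame_map (\<alpha> c) (\<gamma> i) (v, y' ?t) + frame_map (\<alpha> c) (\<gamma> i) (0, \<zeta>)"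
        unfolding q frame_map_add frame_map_diff frame_map_scaleR annihilates[OF c(1,3)] by simp
      then have "norm (frame_map (\<alpha> c) (\<gamma> i) ?q)
          \<le> h * norm (frame_map (\<alpha> c) (\<gamma> i) (v, y' ?t)) + norm (frame_map (\<alpha> c) (\<gamma> i) (0, \<zeta>))"
        using norm_triangle_ineq[of "h *\<^sub>R frame_map (\<alpha> c) (\<gamma> i) (v, y' ?t)" "frame_map (\<alpha> c) (\<gamma> i) (0, \<zeta>)"] h
        by simp
      also have "\<dots> \<le> h * (R * l) + B * (h * \<kappa>)"
      proof (intro add_mono mult_left_mono)
        have "norm (frame_map (\<alpha> c) (\<gamma> i) (v, y' ?t)) \<le> R * norm (v, y' ?t)"
          using almost_tangent[OF t(1) c(1)] c(2) by (simp add: \<gamma>_def)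
        also have "\<dots> \<le> R * l" using deriv_bound[OF t(1)] \<open>0 \<le> R\<close> by (intro mult_left_mono) (auto simp: l_def)
        finally show "norm (frame_map (\<alpha> c) (\<gamma> i) (v, y' ?t)) \<le> R * l" .
        show "norm (frame_map (\<alpha> c) (\<gamma> i) (0, \<zeta>)) \<le> B * (h * \<kappa>)"
          using B(2)[OF c(1,2), of "(0, \<zeta>)"] mult_left_mono[OF nz, of B] B(1) by linarith
      qed (use h in auto)
      finally have g: "norm (frame_map (\<alpha> c) (\<gamma> i) ?q) \<le> h * (R * l) + B * (h * \<kappa>)" .
      \<comment> \<open>The tangency of the curve is known at \<open>\<gamma> i\<close>, but the
        stability estimate needs the frame at the end \<open>?p\<close> of the step. Moving there
        costs a quantity of order \<open>h * h\<close>.\<close>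
      have "norm (frame_map (\<alpha> c) ?p ?q - frame_map (\<alpha> c) (\<gamma> i) ?q) \<le> \<Lambda> * norm (?p - \<gamma> i) * norm ?q"
        using d2(3)[OF c(1,2) dp] by blast
      also have "\<dots> \<le> \<Lambda> * (h * l) * (h * (2 * l + \<kappa>))"
        using npg nq d2(2) h \<open>0 < l\<close> by (intro mult_mono mult_nonneg_nonneg) auto
      also have "\<dots> = h * (h * Z)" by (simp add: Z_def)
      also have "\<dots> \<le> h * (\<eta> / 2)" using hZ h by (intro mult_left_mono) auto
      finally have "norm (frame_map (\<alpha> c) ?p ?q) \<le> h * (R * l) + B * (h * \<kappa>) + h * (\<eta> / 2)"
        using g norm_triangle_ineq2[of "frame_map (\<alpha> c) ?p ?q" "frame_map (\<alpha> c) (\<gamma> i) ?q"] by linarith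
      also have "\<dots> = h * Q" using B(1) by (simp add: Q_def \<kappa>_def field_simps)
      finally show ?thesis using fnorm_eq[OF c(1)] d2(3)[OF c(1,2) dp] by simp
    qed
    \<comment> \<open>The curve is followed for \<open>i\<close> steps and the polygon for the
      remaining ones. \<open>Y n\<close> is the end of the curve, \<open>Y 0\<close> the end of the
      polygon, and consecutive terms differ by a single defect propagated with equal velocities, so
      that the term with \<open>b\<close> vanishes.\<close>
    define Y where "Y i = (euler_step L h v ^^ (n - i)) (\<gamma> i)" for i
    have step: "norm (snd (Y (Suc i)) - snd (Y i)) \<le> S * (exp a * (h * Q))" if "i < n" for i
    proof -
      let ?p = "euler_step L h v (\<gamma> i)" and ?q = "\<gamma> (Suc i)" and ?n = "n - Suc i"
      have "n - i = Suc ?n" using that by simp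
      then have Yi: "Y i = (euler_step L h v ^^ ?n) ?p" unfolding Y_def by (simp add: funpow_swap1)
      have Ys: "Y (Suc i) = (euler_step L h v ^^ ?n) ?q" by (simp add: Y_def)
      have f: "fst ?p = fst ?q" by (simp add: \<gamma>_def euler_step_def lift_vector_def algebra_simps)
      have pK: "(euler_step L h v ^^ j) ?p \<in> K" if "j \<le> ?n" for j
        using inK[of i "Suc j"] that \<open>i < n\<close> by (simp add: funpow_swap1)
      have qK: "(euler_step L h v ^^ j) ?q \<in> K" if "j \<le> ?n" for j
        using inK[of "Suc i" j] that \<open>i < n\<close> by simp
      have def_le: "exp a * fnorm ?p (?q - ?p) \<le> exp a * (h * Q)"
        using defect[OF that] by (intro mult_left_mono) auto
      have S_le: "S * (exp a * fnorm ?p (?q - ?p)) \<le> S * (exp a * (h * Q))"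
        by (rule mult_left_mono[OF def_le]) (rule nonneg)
      have "real ?n * h \<le> 1" using ih[of ?n] by simp
      have "fnorm (Y i) (Y (Suc i) - Y i) \<le> exp a * (fnorm ?p (?q - ?p) + b * norm (v - v))"
        unfolding Yi Ys
        by (rule d(2)[OF f h(1) hd(1) \<open>real ?n * h \<le> 1\<close> v v pK qK]) (use S_le hSQ in auto)
      then have "S * fnorm (Y i) (Y (Suc i) - Y i) \<le> S * (exp a * (h * Q))"
        by (intro mult_left_mono nonneg(2)) (rule order_trans[OF _ def_le], simp)
      moreover have "fst (Y (Suc i) - Y i) = 0" unfolding Yi Ys using f by (simp add: fst_euler_iterate)
      moreover have "Y i \<in> K" unfolding Yi using pK by simp
      ultimately show ?thesis
        using vertical_le_fnorm[of "Y i" "Y (Suc i) - Y i"] by (simp add: blinfun.zero_right)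
    qed
    have "norm (snd (Y n) - snd (Y 0)) = norm (\<Sum>i<n. snd (Y (Suc i)) - snd (Y i))"
      using sum_lessThan_telescope[of "\<lambda>i. snd (Y i)" n] by simp
    also have "\<dots> \<le> (\<Sum>i<n. S * (exp a * (h * Q)))"
      by (intro order_trans[OF norm_sum] sum_mono step) simp
    also have "\<dots> = S * (exp a * Q) * (real n * h)" by (simp add: mult_ac)
    also have "\<dots> = S * (exp (M * l + \<eta> * S) * (R * l + \<eta>))" unfolding h(3) by (simp add: a_def Q_def)
    also have "\<dots> \<le> S * exp (M * l) * (R * l) + e" using \<eta>(2) by (simp add: mult.assoc)
    also have "snd (Y n) = y 1" unfolding Y_def \<gamma>_def h(3) by simp
    also have "Y 0 = (euler_step L h v ^^ n) (x0, y 0)" by (simp add: Y_def \<gamma>_def)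
    finally show "norm (y 1 - snd ((euler_step L (1 / real n) v ^^ n) (x0, y 0)))
      \<le> S * exp (M * ((1 + C) * \<rho>)) * (R * ((1 + C) * \<rho>)) + e"
      unfolding l_def h_def .
  qed
qed

end

section \<open>Slopes of transverse subbundles\<close>

definition slope ::
  "('m::finite, 'n::finite) distribution \<Rightarrow> ('m, 'n) pt \<Rightarrow> (real ^ 'm) \<Rightarrow>\<^sub>L (real ^ 'n)" where
  "slope E p = (SOME L. E p = range (\<lambda>u. (u, blinfun_apply L u)))"

text \<open>Transversality makes the projection of the fibre to the first factor surjective. A
  linear section of it has a range of dimension \<open>CARD('m)\<close> inside a fibre of the same
  dimension, hence the whole fibre.\<close>

lemma transverse_fibre_is_graph:
  fixes E :: "('m::finite, 'n::finite) distribution"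
  assumes "local_frame V E X" "p \<in> V" "transverse_to_vertical U E" "p \<in> U"
  shows "E p = range (lift_vector (slope E) p)"
proof -
  have X: "inj (\<lambda>i. X i p)" "independent (range (\<lambda>i. X i p))" "span (range (\<lambda>i. X i p)) = E p"
    using assms unfolding local_frame_def by auto
  have sub: "subspace (E p)" using X(3) subspace_span by metis
  have "dim (E p) = card (range (\<lambda>i. X i p))" using X(2,3) by (metis dim_span_eq_card_independent)
  then have dimE: "dim (E p) = CARD('m)" using X(1) by (simp add: card_image)
  have "\<exists>e\<in>E p. fst e = u" for u
  proof -
    have "(u, 0) \<in> {u + v |u v. u \<in> E p \<and> v \<in> (vertical :: ('m, 'n) pt set)}"
      using assms unfolding transverse_to_vertical_def by blast
    then obtain e v where "(u, 0) = e + v" "e \<in> E p" "v \<in> (vertical :: ('m, 'n) pt set)" by blast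
    then show ?thesis by (intro bexI[of _ e]) (auto simp: vertical_def prod_eq_iff)
  qed
  then obtain e where e: "\<And>u. e u \<in> E p" "\<And>u. fst (e u) = u" by metis
  \<comment> \<open>The preimages \<open>e u\<close> were chosen independently of each other;
    prescribing \<open>g\<close> on a basis makes the choice linear.\<close>
  define g where "g u = (\<Sum>i\<in>UNIV. (u $ i) *\<^sub>R e (axis i 1))" for u :: "real ^ 'm"
  have lin: "linear g"
    unfolding g_def by (intro linearI) (simp_all add: scaleR_add_left sum.distrib scaleR_sum_right)
  have fst_g: "fst (g u) = u" for u
  proof -
    have "fst (g u) = (\<Sum>i\<in>UNIV. (u $ i) *\<^sub>R axis i 1)" by (simp add: g_def fst_sum e(2))
    also have "\<dots> = u" using basis_expansion[of u] by (simp add: scalar_mult_eq_scaleR)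
    finally show ?thesis .
  qed
  have "inj g" using fst_g by (metis injI)
  have "range g \<subseteq> E p"
    unfolding g_def using sub by (auto intro!: subspace_sum subspace_scale e(1))
  moreover have "dim (range g) = CARD('m)"
    using dim_image_eq[OF lin, of UNIV] \<open>inj g\<close> by simp
  moreover have "subspace (range g)" using lin by (intro linear_subspace_image) auto
  ultimately have range_g: "range g = E p" using sub dimE by (intro subspace_dim_equal) auto
  have "bounded_linear (\<lambda>u. snd (g u))"
    using lin linear_conv_bounded_linear bounded_linear_snd_comp by blast
  then have "E p = range (\<lambda>u. (u, blinfun_apply (Blinfun (\<lambda>u. snd (g u))) u))"
    unfolding range_g[symmetric] by (intro image_cong) (auto simp: bounded_linear_Blinfun_apply prod_eq_iff fst_g)
  then have "E p = range (\<lambda>u. (u, blinfun_apply (slope E p) u))"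
    unfolding slope_def by (rule someI)
  then show ?thesis by (simp add: lift_vector_def)
qed

lemma continuous_subbundle_graph:
  assumes "continuous_subbundle U E" "transverse_to_vertical U E" "p \<in> U"
  shows "E p = range (lift_vector (slope E) p)"
  using assms transverse_fibre_is_graph unfolding continuous_subbundle_def by metis

lemma C1_subbundle_graph:
  assumes "C1_subbundle U E" "transverse_to_vertical U E" "p \<in> U"
  shows "E p = range (lift_vector (slope E) p)"
  using assms transverse_fibre_is_graph unfolding C1_subbundle_def by metis

lemma slope_eqI:
  assumes "E p = range (lift_vector (slope E) p)" "(u, w) \<in> E p"
  shows "slope E p u = w"
  using assms by (auto simp: lift_vector_def)

text \<open>The slope at \<open>q\<close> maps the first components of the frame vectors to the
  second ones, and at \<open>p\<close> the first components span. Expanding basis vectors with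
  coefficients fixed at \<open>p\<close> yields an estimate in which \<epsilon> and \<beta> tend to
  0, with no matrix to invert.\<close>

lemma continuous_on_slope:
  fixes E :: "('m::finite, 'n::finite) distribution"
  assumes cs: "continuous_subbundle U E" and tr: "transverse_to_vertical U E"
  shows "continuous_on U (slope E)"
proof (rule continuous_at_imp_continuous_on, rule ballI)
  fix p assume "p \<in> U"
  then obtain V X where V: "open V" "p \<in> V" "V \<subseteq> U" and X: "\<And>i. continuous_on V (X i)" "local_frame V E X"
    using cs unfolding continuous_subbundle_def by metis
  let ?L = "slope E"
  have XE: "?L q (fst (X i q)) = snd (X i q)" if "q \<in> V" for i q
  proof (rule slope_eqI)
    show "E q = range (lift_vector ?L q)" using continuous_subbundle_graph[OF cs tr] that V by blast
    have "span (range (\<lambda>i. X i q)) = E q" using X that unfolding local_frame_def by blast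
    then show "(fst (X i q), snd (X i q)) \<in> E q" by (auto intro: span_base)
  qed
  have "\<exists>c. u = (\<Sum>i\<in>UNIV. c i *\<^sub>R fst (X i p))" for u
  proof -
    have sp: "span (range (\<lambda>i. X i p)) = E p" and inj: "inj (\<lambda>i. X i p)"
      using X V unfolding local_frame_def by blast+
    have "lift_vector ?L p u \<in> span (range (\<lambda>i. X i p))"
      using continuous_subbundle_graph[OF cs tr \<open>p \<in> U\<close>] sp by blast
    then obtain c where "lift_vector ?L p u = (\<Sum>v\<in>range (\<lambda>i. X i p). c v *\<^sub>R v)"
      by (auto simp: span_finite)
    also have "\<dots> = (\<Sum>i\<in>UNIV. c (X i p) *\<^sub>R X i p)" using inj by (simp add: sum.reindex)
    finally have "fst (lift_vector ?L p u) = fst (\<Sum>i\<in>UNIV. c (X i p) *\<^sub>R X i p)" by simp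
    then show ?thesis by (intro exI[of _ "\<lambda>i. c (X i p)"]) (simp add: lift_vector_def fst_sum)
  qed
  then obtain c where c: "\<And>u. u = (\<Sum>i\<in>UNIV. c u i *\<^sub>R fst (X i p))" by metis
  define \<epsilon> where "\<epsilon> q = (\<Sum>u\<in>Basis. \<Sum>i\<in>UNIV. \<bar>c u i\<bar> * norm (fst (X i p) - fst (X i q)))" for q
  define \<beta> where "\<beta> q = (\<Sum>u\<in>Basis. \<Sum>i\<in>UNIV. \<bar>c u i\<bar> * norm (snd (X i q) - snd (X i p)))" for q
  have est: "norm (?L q - ?L p) \<le> \<epsilon> q * norm (?L q) + \<beta> q" if q: "q \<in> V" for q
  proof -
    have u: "norm ((?L q - ?L p) u) \<le> (\<Sum>i\<in>UNIV. \<bar>c u i\<bar> * norm (fst (X i p) - fst (X i q))) * norm (?L q)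
        + (\<Sum>i\<in>UNIV. \<bar>c u i\<bar> * norm (snd (X i q) - snd (X i p)))" for u
    proof -
      have "(?L q - ?L p) u = (?L q - ?L p) (\<Sum>i\<in>UNIV. c u i *\<^sub>R fst (X i p))" using c[of u] by simp
      also have "\<dots> = (\<Sum>i\<in>UNIV. c u i *\<^sub>R (?L q - ?L p) (fst (X i p)))"
        by (simp add: blinfun.sum_right blinfun.scaleR_right)
      also have "\<dots> = (\<Sum>i\<in>UNIV. c u i *\<^sub>R (?L q (fst (X i p) - fst (X i q)) + (snd (X i q) - snd (X i p))))"
        using XE[OF q] XE[OF \<open>p \<in> V\<close>] by (simp add: blinfun.diff_left blinfun.diff_right)
      also have "norm \<dots> \<le> (\<Sum>i\<in>UNIV. \<bar>c u i\<bar> * (norm (fst (X i p) - fst (X i q)) * norm (?L q) + norm (snd (X i q) - snd (X i p))))"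
      proof (rule sum_norm_le)
        fix i
        have "norm (?L q (fst (X i p) - fst (X i q)) + (snd (X i q) - snd (X i p)))
          \<le> norm (fst (X i p) - fst (X i q)) * norm (?L q) + norm (snd (X i q) - snd (X i p))"
          using norm_triangle_ineq norm_blinfun[of "?L q" "fst (X i p) - fst (X i q)"]
          by (smt (verit) mult.commute)
        then show "norm (c u i *\<^sub>R (?L q (fst (X i p) - fst (X i q)) + (snd (X i q) - snd (X i p))))
          \<le> \<bar>c u i\<bar> * (norm (fst (X i p) - fst (X i q)) * norm (?L q) + norm (snd (X i q) - snd (X i p)))"
          by (simp add: mult_left_mono)
      qed
      finally show ?thesis by (simp add: sum.distrib sum_distrib_right distrib_left mult.assoc)
    qed
    have "norm (?L q - ?L p) \<le> (\<Sum>u\<in>Basis. norm ((?L q - ?L p) u))"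
      by (rule norm_blinfun_euclidean_le)
    also have "\<dots> \<le> \<epsilon> q * norm (?L q) + \<beta> q"
      unfolding \<epsilon>_def \<beta>_def sum_distrib_right[of _ Basis] sum.distrib[symmetric] by (rule sum_mono[OF u])
    finally show ?thesis .
  qed
  have Xp: "(X i \<longlongrightarrow> X i p) (at p)" for i
    using X(1)[of i] V by (simp add: continuous_on_eq_continuous_at isCont_def)
  have lim\<epsilon>: "(\<epsilon> \<longlongrightarrow> 0) (at p)"
    unfolding \<epsilon>_def by (rule tendsto_eq_intros tendsto_fst Xp refl | simp)+
  have lim\<beta>: "(\<beta> \<longlongrightarrow> 0) (at p)"
    unfolding \<beta>_def by (rule tendsto_eq_intros tendsto_snd Xp refl | simp)+
  have "((\<lambda>q. 2 * (\<epsilon> q * norm (?L p) + \<beta> q)) \<longlongrightarrow> 2 * (0 * norm (?L p) + 0)) (at p)"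
    by (intro tendsto_intros lim\<epsilon> lim\<beta>)
  then have lim: "((\<lambda>q. 2 * (\<epsilon> q * norm (?L p) + \<beta> q)) \<longlongrightarrow> 0) (at p)" by simp
  \<comment> \<open>The unknown \<open>norm (?L q)\<close> stands on the right of
    \<open>est\<close>; once \<open>\<epsilon> q < 1/2\<close>, half of the left side absorbs
    it.\<close>
  have "eventually (\<lambda>q. \<epsilon> q < 1/2) (at p)" using order_tendstoD(2)[OF lim\<epsilon>, of "1/2"] by simp
  moreover have "eventually (\<lambda>q. q \<in> V) (at p)" using V by (intro eventually_at_in_open') 
  ultimately have "eventually (\<lambda>q. norm (?L q - ?L p) \<le> 2 * (\<epsilon> q * norm (?L p) + \<beta> q)) (at p)"
  proof eventually_elim
    case (elim q)
    have e0: "0 \<le> \<epsilon> q" by (auto simp: \<epsilon>_def intro!: sum_nonneg)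
    have "norm (?L q) \<le> norm (?L p) + norm (?L q - ?L p)" by (metis norm_triangle_sub)
    then have "\<epsilon> q * norm (?L q) \<le> \<epsilon> q * norm (?L p) + \<epsilon> q * norm (?L q - ?L p)"
      using mult_left_mono[OF _ e0] by (fastforce simp: distrib_left)
    moreover have "\<epsilon> q * norm (?L q - ?L p) \<le> 1/2 * norm (?L q - ?L p)"
      using elim by (intro mult_right_mono) auto
    ultimately show ?case using est[OF elim(2)] by (simp add: algebra_simps)
  qed
  then have "((\<lambda>q. ?L q - ?L p) \<longlongrightarrow> 0) (at p)" by (rule Lim_null_comparison[OF _ lim])
  then show "isCont ?L p" by (simp add: isCont_def LIM_zero_iff)
qed

section \<open>Bounds for annihilator frames\<close>

text \<open>A vector orthogonal to the range of the frame map would be a linear relation among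
  independent forms, so this map is onto. It vanishes on the fibre, whence by transversality the
  vertical vectors already reach everything; equality of dimensions gives injectivity.\<close>

lemma frame_map_vertical_bij:
  fixes E :: "('m::finite, 'n::finite) distribution"
  assumes fr: "annihilator_frame V E \<alpha>" and "p \<in> V" and tr: "transverse_to_vertical U E" and "p \<in> U"
  shows "bij (\<lambda>w. frame_map \<alpha> p (0, w))"
proof -
  let ?F = "frame_map \<alpha> p"
  have linF: "linear ?F" by (intro linearI frame_map_add frame_map_scaleR)
  have inj\<alpha>: "inj (\<lambda>j. \<alpha> j p)" and ind: "independent (range (\<lambda>j. \<alpha> j p))" and E0: "\<And>v. v \<in> E p \<Longrightarrow> ?F v = 0"
    using fr \<open>p \<in> V\<close> unfolding annihilator_frame_def frame_map_def by (auto simp: vec_eq_iff)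
  have "span (range ?F) = UNIV"
  proof (rule ccontr)
    assume "span (range ?F) \<noteq> UNIV"
    then have "dim (range ?F) < DIM(real ^ 'n)"
      by (metis dim_eq_full dim_subset_UNIV le_neq_implies_less)
    then obtain c where c: "c \<noteq> 0" "\<And>y. y \<in> span (range ?F) \<Longrightarrow> orthogonal c y"
      using orthogonal_to_subspace_exists by blast
    have "c \<bullet> ?F x = 0" for x using c(2)[of "?F x"] by (auto simp: orthogonal_def span_base)
    then have "(\<Sum>j\<in>UNIV. (c $ j) *\<^sub>R \<alpha> j p) x = 0" for x
      by (simp add: blinfun.sum_left blinfun.scaleR_left inner_vec_def frame_map_def)
    then have z: "(\<Sum>j\<in>UNIV. (c $ j) *\<^sub>R \<alpha> j p) = 0" by (intro blinfun_eqI) simp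
    \<comment> \<open>Independence of a set takes coefficients indexed by its vectors, so the
      components of \<open>c\<close> are transported along the injection.\<close>
    define u where "u = (\<lambda>a. c $ (inv (\<lambda>j. \<alpha> j p) a))"
    have inv: "inv (\<lambda>j. \<alpha> j p) (\<alpha> j p) = j" for j using inv_f_f[OF inj\<alpha>, of j] by simp
    have "(\<Sum>a\<in>range (\<lambda>j. \<alpha> j p). u a *\<^sub>R a) = (\<Sum>j\<in>UNIV. (c $ j) *\<^sub>R \<alpha> j p)"
      using inj\<alpha> by (simp add: sum.reindex u_def inv)
    then have "u (\<alpha> j p) = 0" for j
      using independentD[OF ind, of "range (\<lambda>j. \<alpha> j p)" u "\<alpha> j p"] z by auto
    then have "c $ j = 0" for j by (simp add: u_def inv)
    then show False using c(1) by (simp add: vec_eq_iff)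
  qed
  then have "range ?F = UNIV"
    using linear_subspace_image[OF linF subspace_UNIV] by (metis span_eq_iff)
  have surj: "surj (\<lambda>w. ?F (0, w))"
  proof (unfold surj_def, rule allI)
    fix z
    obtain x where x: "?F x = z" using \<open>range ?F = UNIV\<close> by (metis surjD)
    have "x \<in> {u + v |u v. u \<in> E p \<and> v \<in> (vertical :: ('m, 'n) pt set)}"
      using tr \<open>p \<in> U\<close> unfolding transverse_to_vertical_def by blast
    then obtain u v where "x = u + v" "u \<in> E p" "fst v = 0" unfolding vertical_def by blast
    then have "z = ?F (0, snd v)" using x E0 by (metis add_0 frame_map_add prod.collapse)
    then show "\<exists>w. z = ?F (0, w)" by blast
  qed
  have "linear (\<lambda>w. ?F (0, w))"
    by (intro linearI) (simp_all add: frame_map_add[symmetric] frame_map_scaleR[symmetric])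
  then have "inj (\<lambda>w. ?F (0, w))" using surj by (rule linear_surjective_imp_injective) (rule refl)
  with surj show ?thesis by (simp add: bij_def)
qed

lemma frame_inv_eq:
  fixes E :: "('m::finite, 'n::finite) distribution"
  assumes "annihilator_frame V E \<alpha>" "p \<in> V" "transverse_to_vertical U E" "p \<in> U"
  shows "frame_inv \<alpha> p (frame_map \<alpha> p (0, w)) = (0, w)" "\<exists>w. frame_inv \<alpha> p z = (0, w) \<and> frame_map \<alpha> p (0, w) = z"
    "bounded_linear (frame_inv \<alpha> p)"
proof -
  note bij = frame_map_vertical_bij[OF assms]
  have "inj_on (frame_map \<alpha> p) vertical"
  proof (rule inj_onI)
    fix x y :: "('m, 'n) pt" assume "x \<in> vertical" "y \<in> vertical" "frame_map \<alpha> p x = frame_map \<alpha> p y"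
    then have "frame_map \<alpha> p (0, snd x) = frame_map \<alpha> p (0, snd y)" "fst x = 0" "fst y = 0"
      by (auto simp: vertical_def) (metis prod.collapse)
    then show "x = y" using injD[OF bij_is_inj[OF bij]] by (simp add: prod_eq_iff)
  qed
  then show 1: "frame_inv \<alpha> p (frame_map \<alpha> p (0, w)) = (0, w)" for w
    unfolding frame_inv_def by (intro inv_into_f_f) (simp_all add: vertical_def)
  show 2: "\<exists>w. frame_inv \<alpha> p z = (0, w) \<and> frame_map \<alpha> p (0, w) = z" for z
  proof -
    obtain w where "z = frame_map \<alpha> p (0, w)" using bij_is_surj[OF bij] by (rule surjE)
    then show ?thesis using 1[of w] by (intro exI[of _ w]) simp
  qed
  have "linear (frame_inv \<alpha> p)"
  proof (rule linearI)
    fix x y and c :: real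
    obtain a b where ab: "frame_map \<alpha> p (0, a) = x" "frame_map \<alpha> p (0, b) = y" using 2[of x] 2[of y] by blast
    have "x + y = frame_map \<alpha> p (0, a + b)" "c *\<^sub>R x = frame_map \<alpha> p (0, c *\<^sub>R a)"
      using ab by (auto simp: frame_map_add[symmetric] frame_map_scaleR[symmetric])
    then show "frame_inv \<alpha> p (x + y) = frame_inv \<alpha> p x + frame_inv \<alpha> p y"
      "frame_inv \<alpha> p (c *\<^sub>R x) = c *\<^sub>R frame_inv \<alpha> p x"
      using ab 1 by auto
  qed
  then show "bounded_linear (frame_inv \<alpha> p)" by (simp add: linear_conv_bounded_linear)
qed

text \<open>Since \<open>0 * \<infinity> = 0\<close>, a finite product of suprema bounds its factors
  only if no factor vanishes; this excludes a zero among the inverse norms.\<close>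

lemma inv_sup_norm_pos:
  fixes E :: "('m::finite, 'n::finite) distribution"
  assumes "annihilator_frame V E \<alpha>" "p \<in> V" "transverse_to_vertical U E" "p \<in> U"
  shows "inv_sup_norm V \<alpha> \<noteq> 0"
proof -
  have "frame_inv \<alpha> p (frame_map \<alpha> p (0, 1)) \<noteq> 0"
    using frame_inv_eq(1)[OF assms, of 1] by (simp add: zero_prod_def)
  then have "0 < onorm (frame_inv \<alpha> p)"
    using onorm_pos_lt[OF frame_inv_eq(3)[OF assms]] by blast
  then have "0 < ennreal (onorm (frame_inv \<alpha> p))" by simp
  also have "\<dots> \<le> inv_sup_norm V \<alpha>" unfolding inv_sup_norm_def by (rule SUP_upper) fact
  finally show ?thesis by simp
qed

lemma inv_sup_norm_bound:
  fixes E :: "('m::finite, 'n::finite) distribution"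
  assumes "annihilator_frame V E \<alpha>" "p \<in> V" "transverse_to_vertical U E" "p \<in> U"
    and "inv_sup_norm V \<alpha> \<le> ennreal S" "0 \<le> S"
  shows "norm w \<le> S * norm (frame_map \<alpha> p (0, w))"
proof -
  have "ennreal (onorm (frame_inv \<alpha> p)) \<le> inv_sup_norm V \<alpha>" unfolding inv_sup_norm_def by (rule SUP_upper) fact
  then have "onorm (frame_inv \<alpha> p) \<le> S" using assms(5,6) by (metis ennreal_le_iff order_trans)
  moreover have "norm (frame_inv \<alpha> p (frame_map \<alpha> p (0, w))) \<le> onorm (frame_inv \<alpha> p) * norm (frame_map \<alpha> p (0, w))"
    by (rule onorm[OF frame_inv_eq(3)[OF assms(1-4)]])
  ultimately show ?thesis
    using frame_inv_eq(1)[OF assms(1-4), of w] mult_right_mono[of _ S "norm (frame_map \<alpha> p (0, w))"]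
    by (fastforce simp: norm_Pair)
qed

lemma frame_d_swap: "frame_d \<alpha> p u v = - frame_d \<alpha> p v u"
  by (simp add: frame_d_def ext_deriv_def vec_eq_iff)

lemma frame_d_scaleR:
  assumes "\<And>j. C1_on V (\<alpha> j)" "p \<in> V"
  shows "frame_d \<alpha> p u (c *\<^sub>R x) = c *\<^sub>R frame_d \<alpha> p u x"
  unfolding frame_d_def ext_deriv_def vec_eq_iff
  using linear_cmul[OF linear_frechet_derivative[OF C1_on_imp_differentiable[OF assms]]]
  by (simp add: blinfun.scaleR_right blinfun.scaleR_left algebra_simps)

lemma frame_d_scaleR_left:
  assumes "\<And>j. C1_on V (\<alpha> j)" "p \<in> V"
  shows "frame_d \<alpha> p (c *\<^sub>R x) u = c *\<^sub>R frame_d \<alpha> p x u"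
  by (subst (1 2) frame_d_swap) (simp add: frame_d_scaleR[OF assms])

text \<open>Substituting the normalised \<open>frame_map \<alpha> p (0, w)\<close> for the unit
  vector in \<open>M_const\<close> makes \<open>frame_inv\<close> cancel. Bilinearity removes the
  normalisation, and antisymmetry exchanges the arguments.\<close>

lemma M_const_bound:
  fixes E :: "('m::finite, 'n::finite) distribution"
  assumes fr: "annihilator_frame V E \<alpha>" "p \<in> V" "transverse_to_vertical U E" "p \<in> U"
    and M: "M_const V E \<alpha> \<le> ennreal M" "0 \<le> M" and v: "v \<in> E p" and sub: "subspace (E p)"
  shows "norm (frame_d \<alpha> p v (0, w)) \<le> M * norm v * norm (frame_map \<alpha> p (0, w))"
proof (cases "v = 0 \<or> w = 0")
  case True
  have C1: "\<And>j. C1_on V (\<alpha> j)" using fr unfolding annihilator_frame_def by blast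
  have "frame_d \<alpha> p v (0, w) = 0"
    using True frame_d_scaleR[where \<alpha> = \<alpha>, OF C1 \<open>p \<in> V\<close>, of v 0 0] frame_d_scaleR_left[where \<alpha> = \<alpha>, OF C1 \<open>p \<in> V\<close>, of 0 0 "(0, w)"]
    by (auto simp: zero_prod_def)
  then show ?thesis using M by simp
next
  case False
  have C1: "\<And>j. C1_on V (\<alpha> j)" using fr unfolding annihilator_frame_def by blast
  define z where "z = frame_map \<alpha> p (0, w)"
  have "z \<noteq> 0"
  proof
    assume "z = 0"
    moreover have "frame_map \<alpha> p (0, 0) = 0" by (simp add: frame_map_def zero_prod_def[symmetric] blinfun.zero_right vec_eq_iff)
    ultimately have "(0, w) = ((0, 0) :: ('m, 'n) pt)" using frame_inv_eq(1)[OF fr] by (metis z_def)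
    then show False using False by simp
  qed
  let ?v = "(1 / norm v) *\<^sub>R v" and ?z = "(1 / norm z) *\<^sub>R z"
  have "frame_inv \<alpha> p ?z = (1 / norm z) *\<^sub>R frame_inv \<alpha> p z"
    using frame_inv_eq(3)[OF fr] by (simp add: linear_simps)
  also have "frame_inv \<alpha> p z = (0, w)" unfolding z_def by (rule frame_inv_eq(1)[OF fr])
  finally have inv: "frame_inv \<alpha> p ?z = (1 / norm z) *\<^sub>R (0, w)" .
  have "ennreal (norm (frame_d \<alpha> p (frame_inv \<alpha> p ?z) ?v)) \<le> M_const V E \<alpha>"
    unfolding M_const_def
  proof (rule Sup_upper, rule CollectI, intro exI conjI refl)
    show "?v \<in> E p" using v sub by (intro subspace_scale)
  qed (use False \<open>z \<noteq> 0\<close> \<open>p \<in> V\<close> in auto)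
  then have "norm (frame_d \<alpha> p (frame_inv \<alpha> p ?z) ?v) \<le> M" using M by (metis ennreal_le_iff order_trans)
  also have "frame_d \<alpha> p (frame_inv \<alpha> p ?z) ?v = (1 / norm z) *\<^sub>R (1 / norm v) *\<^sub>R frame_d \<alpha> p (0, w) v"
    unfolding inv frame_d_scaleR[where \<alpha> = \<alpha>, OF C1 \<open>p \<in> V\<close>] frame_d_scaleR_left[where \<alpha> = \<alpha>, OF C1 \<open>p \<in> V\<close>] by (simp add: mult.commute)
  also have "norm \<dots> = norm (frame_d \<alpha> p v (0, w)) / (norm z * norm v)"
    using frame_d_swap[of \<alpha> p v "(0, w)"] by simp
  finally show ?thesis using False \<open>z \<noteq> 0\<close> unfolding z_def[symmetric] by (simp add: field_simps)
qed

lemma C1_on_derivative_bound: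
  assumes "C1_on V f" "compact K" "K \<subseteq> V"
  obtains B where "0 < B" "\<And>p u. p \<in> K \<Longrightarrow> norm (frechet_derivative f (at p) u) \<le> B * norm u"
proof -
  obtain f' where der: "\<And>x. x \<in> V \<Longrightarrow> (f has_derivative blinfun_apply (f' x)) (at x)"
    and cont: "continuous_on V f'"
    using assms(1) unfolding C1_on_def by blast
  obtain B where B: "0 < B" "\<And>p. p \<in> K \<Longrightarrow> norm (f' p) \<le> B"
    using compact_bounded_image[OF cont assms(2,3)] by blast
  show ?thesis
  proof
    fix p u assume "p \<in> K"
    then have "frechet_derivative f (at p) = blinfun_apply (f' p)"
      using frechet_derivative_at[OF der[of p]] assms(3) by auto
    then show "norm (frechet_derivative f (at p) u) \<le> B * norm u"
      using norm_blinfun[of "f' p" u] mult_right_mono[OF B(2)[OF \<open>p \<in> K\<close>] norm_ge_zero[of u]] by simp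
  qed fact
qed

lemma frame_d_bounded_on_compact:
  fixes \<alpha> :: "'n::finite \<Rightarrow> ('m::finite, 'n) one_form"
  assumes "\<And>j. C1_on V (\<alpha> j)" "compact K" "K \<subseteq> V"
  obtains B where "0 < B" "\<And>p u v. p \<in> K \<Longrightarrow> norm (frame_d \<alpha> p u v) \<le> B * norm u * norm v"
proof -
  have "\<exists>B>0. \<forall>p\<in>K. \<forall>u. norm (frechet_derivative (\<alpha> j) (at p) u) \<le> B * norm u" for j
    using C1_on_derivative_bound[OF assms(1)[of j] assms(2,3)] by metis
  then obtain B where B: "\<And>j. B j > 0" "\<And>j p u. p \<in> K \<Longrightarrow> norm (frechet_derivative (\<alpha> j) (at p) u) \<le> B j * norm u"
    by metis
  show ?thesis
  proof
    show "0 < (\<Sum>j\<in>UNIV. 2 * B j)" using B(1) by (intro sum_pos) auto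
    fix p u v assume p: "p \<in> K"
    have 1: "\<bar>frechet_derivative (\<alpha> j) (at p) x y\<bar> \<le> B j * norm x * norm y" for j x y
      using norm_blinfun[of "frechet_derivative (\<alpha> j) (at p) x" y] mult_right_mono[OF B(2)[OF p, of j x] norm_ge_zero[of y]]
      by simp
    have "norm (frame_d \<alpha> p u v) \<le> (\<Sum>j\<in>UNIV. \<bar>frame_d \<alpha> p u v $ j\<bar>)" by (rule norm_le_l1_cart)
    also have "\<dots> \<le> (\<Sum>j\<in>UNIV. 2 * B j * norm u * norm v)"
    proof (rule sum_mono)
      fix j
      show "\<bar>frame_d \<alpha> p u v $ j\<bar> \<le> 2 * B j * norm u * norm v"
        using 1[of j u v] 1[of j v u] by (simp add: frame_d_def ext_deriv_def mult_ac)
    qed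
    also have "\<dots> = (\<Sum>j\<in>UNIV. 2 * B j) * norm u * norm v" by (simp add: sum_distrib_right)
    finally show "norm (frame_d \<alpha> p u v) \<le> (\<Sum>j\<in>UNIV. 2 * B j) * norm u * norm v" .
  qed
qed

lemma d_sup_norm_bound:
  fixes E :: "('m::finite, 'n::finite) distribution"
  assumes C1: "\<And>j. C1_on V (\<alpha> j)" and "p \<in> V" and D: "d_sup_norm V E \<alpha> \<le> ennreal D" "0 \<le> D"
    and uv: "u \<in> E p" "v \<in> E p"
  shows "norm (frame_d \<alpha> p u v) \<le> D * norm u * norm v"
proof -
  have "compact {p}" "{p} \<subseteq> V" using \<open>p \<in> V\<close> by auto
  then obtain B where B: "0 < B" "\<And>q u v. q \<in> {p} \<Longrightarrow> norm (frame_d \<alpha> q u v) \<le> B * norm u * norm v"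
    using frame_d_bounded_on_compact[where \<alpha> = \<alpha>, OF C1] by blast
  note B = B(1) B(2)[OF singletonI]
  \<comment> \<open>A supremum of reals bounds the members of a set only when the set is bounded
    above; the bound on the compact set \<open>{p}\<close> provides this.\<close>
  have "bdd_above ((\<lambda>(u, v). norm (frame_d \<alpha> p u v) / (norm u * norm v)) ` (E p \<times> E p))"
  proof (rule bdd_aboveI2, clarify)
    fix u v :: "('m, 'n) pt"
    show "norm (frame_d \<alpha> p u v) / (norm u * norm v) \<le> B"
      using B(1) B(2)[of u v] by (cases "norm u * norm v = 0") (auto simp: divide_le_eq mult.assoc)
  qed
  then have "norm (frame_d \<alpha> p u v) / (norm u * norm v) \<le> bilinear_onorm_on (E p) (frame_d \<alpha> p)"
    unfolding bilinear_onorm_on_def using uv by (intro cSUP_upper2[of _ _ "(u, v)"]) auto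
  moreover have "ennreal (bilinear_onorm_on (E p) (frame_d \<alpha> p)) \<le> ennreal D"
    using D(1) \<open>p \<in> V\<close> unfolding d_sup_norm_def by (meson SUP_le_iff)
  ultimately have le: "norm (frame_d \<alpha> p u v) / (norm u * norm v) \<le> D"
    using D(2) by (meson ennreal_le_iff order_trans)
  show ?thesis
  proof (cases "norm u * norm v = 0")
    case True
    then show ?thesis using B(2)[of u v] by (auto simp: mult.assoc)
  next
    case False
    then have "0 < norm u * norm v" by (simp add: less_le)
    then show ?thesis using le by (simp add: divide_le_eq mult.assoc)
  qed
qed

lemma restr_sup_norm_bound:
  fixes E :: "('m::finite, 'n::finite) distribution"
  assumes "p \<in> V" and R: "restr_sup_norm V E \<alpha> \<le> ennreal R" "0 \<le> R" and v: "v \<in> E p"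
  shows "norm (frame_map \<alpha> p v) \<le> R * norm v"
proof -
  have "linear (frame_map \<alpha> p)" by (intro linearI frame_map_add frame_map_scaleR)
  then obtain B where B: "0 < B" "\<And>x. norm (frame_map \<alpha> p x) \<le> B * norm x"
    using linear_bounded_pos by blast
  have "bdd_above ((\<lambda>x. norm (frame_map \<alpha> p x) / norm x) ` E p)"
  proof (rule bdd_aboveI2)
    fix x
    show "norm (frame_map \<alpha> p x) / norm x \<le> B"
      using B(1) B(2)[of x] by (cases "norm x = 0") (auto simp: divide_le_eq)
  qed
  then have "norm (frame_map \<alpha> p v) / norm v \<le> onorm_on (E p) (frame_map \<alpha> p)"
    unfolding onorm_on_def using v by (intro cSUP_upper2[of _ _ v]) auto
  moreover have "ennreal (onorm_on (E p) (frame_map \<alpha> p)) \<le> ennreal R"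
    using R(1) \<open>p \<in> V\<close> unfolding restr_sup_norm_def by (meson SUP_le_iff)
  ultimately have le: "norm (frame_map \<alpha> p v) / norm v \<le> R"
    using R(2) by (meson ennreal_le_iff order_trans)
  show ?thesis
    using le B(2)[of v] by (cases "v = 0") (auto simp: divide_le_eq)
qed

text \<open>The norm of the transition map is 1 in both directions, so neither frame norm exceeds
  the other on vertical vectors. Both frames annihilate the lifts, which reduces every vector to its
  vertical part.\<close>

lemma compatible_norm_eq:
  fixes E :: "('m::finite, 'n::finite) distribution"
  assumes cov: "compatible_cover U E s V \<alpha>" and tr: "transverse_to_vertical U E"
    and ij: "i \<in> {1..s}" "j \<in> {1..s}" "p \<in> V i" "p \<in> V j"
    and graph: "E p = range (lift_vector (slope E) p)"
  shows "norm (frame_map (\<alpha> i) p d) = norm (frame_map (\<alpha> j) p d)"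
proof -
  have fr: "annihilator_frame (V i) E (\<alpha> i)" if "i \<in> {1..s}" for i
    using cov that unfolding compatible_cover_def by blast
  have "p \<in> U" using cov ij unfolding compatible_cover_def by blast
  have le: "norm (frame_map (\<alpha> i) p (0, w)) \<le> norm (frame_map (\<alpha> j) p (0, w))"
    if ij: "i \<in> {1..s}" "j \<in> {1..s}" "p \<in> V i" "p \<in> V j" for i j w
  proof -
    have on: "onorm (frame_map (\<alpha> i) p \<circ> frame_inv (\<alpha> j) p) = 1"
      using cov ij unfolding compatible_cover_def by blast
    have "linear (frame_map (\<alpha> i) p)" by (intro linearI frame_map_add frame_map_scaleR)
    then have "bounded_linear (frame_map (\<alpha> i) p)" by (simp add: linear_conv_bounded_linear)
    then have "bounded_linear (frame_map (\<alpha> i) p \<circ> frame_inv (\<alpha> j) p)"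
      unfolding comp_def by (rule bounded_linear_compose[OF _ frame_inv_eq(3)[OF fr[OF ij(2)] ij(4) tr \<open>p \<in> U\<close>]])
    from onorm[OF this, of "frame_map (\<alpha> j) p (0, w)"] show ?thesis
      by (simp add: on frame_inv_eq(1)[OF fr[OF ij(2)] ij(4) tr \<open>p \<in> U\<close>])
  qed
  have vert: "frame_map (\<alpha> i) p d = frame_map (\<alpha> i) p (0, snd d - slope E p (fst d))" if "i \<in> {1..s}" "p \<in> V i" for i
  proof -
    have "lift_vector (slope E) p (fst d) \<in> E p" using graph by blast
    then have "frame_map (\<alpha> i) p (lift_vector (slope E) p (fst d)) = 0"
      using fr[OF that(1)] that(2) unfolding annihilator_frame_def frame_map_def by (simp add: vec_eq_iff)
    moreover have "d = lift_vector (slope E) p (fst d) + (0, snd d - slope E p (fst d))"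
      by (simp add: lift_vector_def prod_eq_iff)
    ultimately show ?thesis
      using frame_map_add[of "\<alpha> i" p "lift_vector (slope E) p (fst d)" "(0, snd d - slope E p (fst d))"] by simp
  qed
  show ?thesis
    unfolding vert[OF ij(1,3)] vert[OF ij(2,4)] by (rule order_antisym) (rule le; fact ij)+
qed

text \<open>The maximum runs over independent indices, so it dominates the product of the three
  separate maxima. If the largest \<open>X\<close> is not 0, finiteness of that product forces each
  factor to be finite; if it is 0, nothing follows about \<open>Y\<close> and \<open>Z\<close>,
  whence the two cases.\<close>

lemma finite_MAX_product_bound:
  fixes X Y Z :: "nat \<Rightarrow> ennreal" and \<epsilon> :: real and s :: nat
  defines "T \<equiv> MAX (i, j, l) \<in> {1..s} \<times> {1..s} \<times> {1..s}. X i * Y j * exp_ennreal (ennreal \<epsilon> * Z l)"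
  assumes "1 \<le> s" "j \<in> {1..s}" "Y j \<noteq> 0" "0 < \<epsilon>" "T < top"
  obtains "\<And>i. i \<in> {1..s} \<Longrightarrow> X i = 0"
  | D S M where "0 \<le> D" "0 \<le> S" "0 \<le> M" "S * exp (\<epsilon> * M) * D \<le> enn2real T"
      "\<And>i. i \<in> {1..s} \<Longrightarrow> X i \<le> ennreal D \<and> Y i \<le> ennreal S \<and> Z i \<le> ennreal M"
proof -
  have ne: "{1..s} \<noteq> {}" using \<open>1 \<le> s\<close> by simp
  have max: "\<exists>i\<in>{1..s}. \<forall>j\<in>{1..s}. f j \<le> f i" for f :: "nat \<Rightarrow> ennreal"
  proof -
    have "Max (f ` {1..s}) \<in> f ` {1..s}" using ne by (intro Max_in) auto
    then obtain i where "i \<in> {1..s}" "Max (f ` {1..s}) = f i" by blast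
    moreover have "f j \<le> Max (f ` {1..s})" if "j \<in> {1..s}" for j using that by (intro Max_ge) auto
    ultimately show ?thesis by (intro bexI[of _ i]) auto
  qed
  obtain a where a: "a \<in> {1..s}" "\<And>i. i \<in> {1..s} \<Longrightarrow> X i \<le> X a" using max[of X] by blast
  obtain b where b: "b \<in> {1..s}" "\<And>i. i \<in> {1..s} \<Longrightarrow> Y i \<le> Y b" using max[of Y] by blast
  obtain c where c: "c \<in> {1..s}" "\<And>i. i \<in> {1..s} \<Longrightarrow> Z i \<le> Z c" using max[of Z] by blast
  let ?E = "exp_ennreal (ennreal \<epsilon> * Z c)"
  have prod: "X a * Y b * ?E \<le> T"
    unfolding T_def
  proof (rule Max_ge)
    show "X a * Y b * ?E \<in> (\<lambda>(i, j, l). X i * Y j * exp_ennreal (ennreal \<epsilon> * Z l)) ` ({1..s} \<times> {1..s} \<times> {1..s})"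
      by (rule image_eqI[where x = "(a, b, c)"]) (use a(1) b(1) c(1) in auto)
  qed simp
  show ?thesis
  proof (cases "X a = 0")
    case True
    then have "X i = 0" if "i \<in> {1..s}" for i using a(2)[OF that] by simp
    then show ?thesis by (rule that(1))
  next
    case False
    have "Y b \<noteq> 0" using b(2)[OF \<open>j \<in> {1..s}\<close>] \<open>Y j \<noteq> 0\<close> by auto
    have "?E \<noteq> 0" by (simp add: exp_ennreal_def ennreal_eq_0_iff not_le)
    have fin: "X a * Y b * ?E \<noteq> top" using order_le_less_trans[OF prod \<open>T < top\<close>] by simp
    then have "?E \<noteq> top" "X a * Y b \<noteq> top"
      using False \<open>Y b \<noteq> 0\<close> \<open>?E \<noteq> 0\<close> by (auto simp: ennreal_mult_eq_top_iff)
    then have "X a \<noteq> top" "Y b \<noteq> top" using False \<open>Y b \<noteq> 0\<close> by (auto simp: ennreal_mult_eq_top_iff)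
    have "Z c \<noteq> top" using \<open>?E \<noteq> top\<close> \<open>0 < \<epsilon>\<close> by (auto simp: exp_ennreal_def ennreal_mult_top)
    obtain D where D: "0 \<le> D" "X a = ennreal D" using \<open>X a \<noteq> top\<close> by (cases "X a") auto
    obtain S where S: "0 \<le> S" "Y b = ennreal S" using \<open>Y b \<noteq> top\<close> by (cases "Y b") auto
    obtain M where M: "0 \<le> M" "Z c = ennreal M" using \<open>Z c \<noteq> top\<close> by (cases "Z c") auto
    have "?E = ennreal (exp (\<epsilon> * M))"
      using M \<open>0 < \<epsilon>\<close> by (simp add: exp_ennreal_def ennreal_mult[symmetric])
    then have "X a * Y b * ?E = ennreal (S * exp (\<epsilon> * M) * D)"
      using D S by (simp add: ennreal_mult[symmetric] mult_ac)
    then have "ennreal (S * exp (\<epsilon> * M) * D) \<le> T" using prod by simp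
    then have "enn2real (ennreal (S * exp (\<epsilon> * M) * D)) \<le> enn2real T"
      using \<open>T < top\<close> by (intro enn2real_mono)
    then have "S * exp (\<epsilon> * M) * D \<le> enn2real T" using D S by simp
    then show ?thesis using a b c D S M by (intro that(2)[of D S M]) auto
  qed
qed

section \<open>Constants from compactness\<close>

lemma obtain_compact_cover:
  fixes V :: "nat \<Rightarrow> 'a::heine_borel set"
  assumes "compact K" "K \<subseteq> (\<Union>i\<in>I. V i)" "\<And>i. i \<in> I \<Longrightarrow> open (V i)"
  obtains Kc where "\<And>i. compact (Kc i)" "\<And>i. i \<in> I \<Longrightarrow> Kc i \<subseteq> V i" "K \<subseteq> (\<Union>i\<in>I. Kc i)"
proof -
  obtain e where e: "0 < e" "\<And>x. x \<in> K \<Longrightarrow> \<exists>G\<in>V ` I. ball x e \<subseteq> G"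
    using Heine_Borel_lemma[OF assms(1), of "V ` I"] assms(2,3) by blast
  \<comment> \<open>With the Lebesgue number \<open>e\<close> of the cover, these are the points of
    \<open>K\<close> whose \<open>e\<close>-ball lies in \<open>V i\<close>. Written as the removal
    of an open set, it is visibly compact.\<close>
  define Kc where "Kc i = K - (\<Union>y\<in>- V i. ball y e)" for i
  have Kc: "x \<in> Kc i \<longleftrightarrow> x \<in> K \<and> ball x e \<subseteq> V i" for x i
  proof -
    have "ball x e \<subseteq> V i \<longleftrightarrow> x \<notin> (\<Union>y\<in>- V i. ball y e)"
      unfolding subset_iff by (auto simp: dist_commute[of x])
    then show ?thesis by (simp add: Kc_def)
  qed
  show ?thesis
  proof
    show "compact (Kc i)" for i unfolding Kc_def using assms(1) by (intro compact_diff open_UN) auto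
    show "Kc i \<subseteq> V i" for i
    proof
      fix x assume "x \<in> Kc i"
      then have "ball x e \<subseteq> V i" using Kc[of x i] by simp
      then show "x \<in> V i" using e(1) centre_in_ball[of x e] by blast
    qed
    show "K \<subseteq> (\<Union>i\<in>I. Kc i)"
    proof
      fix x assume "x \<in> K"
      then obtain i where "i \<in> I" "ball x e \<subseteq> V i" using e(2) by blast
      then show "x \<in> (\<Union>i\<in>I. Kc i)" using Kc[of x i] \<open>x \<in> K\<close> by blast
    qed
  qed
qed

text \<open>By bijectivity the continuous function \<open>norm (frame_map \<alpha> p (0, w))\<close>
  is positive on the compact product of \<open>K\<close> with the unit sphere, so it has a positive
  minimum there.\<close>

lemma inverse_bound_on_compact:
  fixes E :: "('m::finite, 'n::finite) distribution"
  assumes fr: "annihilator_frame V E \<alpha>" and tr: "transverse_to_vertical U E"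
    and K: "compact K" "K \<subseteq> V" "V \<subseteq> U"
  obtains S where "0 \<le> S" "\<And>p w. p \<in> K \<Longrightarrow> norm w \<le> S * norm (frame_map \<alpha> p (0, w))"
proof (cases "K = {}")
  case True
  then show ?thesis using that[of 0] by auto
next
  case False
  have cont: "continuous_on V (\<alpha> j)" for j
  proof -
    have "C1_on V (\<alpha> j)" using fr unfolding annihilator_frame_def by blast
    from C1_on_imp_differentiable[OF this] show ?thesis
      by (meson continuous_at_imp_continuous_on differentiable_imp_continuous_within)
  qed
  let ?K = "K \<times> sphere (0 :: real ^ 'n) 1"
  let ?f = "\<lambda>z. norm (frame_map \<alpha> (fst z) (0, snd z))"
  have "sphere (0 :: real ^ 'n) 1 \<noteq> {}" by simp
  then have "?K \<noteq> {}" using False by blast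
  moreover have "compact ?K" using K by (intro compact_Times) auto
  moreover have "continuous_on ?K ?f"
  proof -
    have *: "continuous_on ?K (\<lambda>z. \<alpha> j (fst z))" for j
      by (rule continuous_on_compose2[OF cont continuous_on_fst[OF continuous_on_id]]) (use K in auto)
    show ?thesis
      unfolding frame_map_def
      by (intro continuous_on_norm continuous_on_vec_lambda continuous_on_Pair continuous_on_const
          continuous_on_snd continuous_on_id bounded_bilinear.continuous_on[OF bounded_bilinear_blinfun_apply] *)
  qed
  ultimately obtain z where z: "z \<in> ?K" "\<And>y. y \<in> ?K \<Longrightarrow> ?f z \<le> ?f y"
    using continuous_attains_inf[of ?K ?f] by blast
  have "0 < ?f z"
  proof -
    obtain p w where pw: "z = (p, w)" "p \<in> K" "norm w = 1" using z(1) by auto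
    then have "p \<in> V" "p \<in> U" using K by auto
    note bij = frame_map_vertical_bij[OF fr \<open>p \<in> V\<close> tr \<open>p \<in> U\<close>]
    have "frame_map \<alpha> p (0, w) \<noteq> frame_map \<alpha> p (0, 0)"
      using injD[OF bij_is_inj[OF bij], of w 0] pw by auto
    moreover have "frame_map \<alpha> p (0, 0) = 0"
      by (simp add: frame_map_def zero_prod_def[symmetric] blinfun.zero_right vec_eq_iff)
    ultimately show ?thesis by (simp add: pw)
  qed
  show ?thesis
  proof
    show "0 \<le> 1 / ?f z" by simp
    fix p and w :: "real ^ 'n" assume "p \<in> K"
    show "norm w \<le> 1 / ?f z * norm (frame_map \<alpha> p (0, w))"
    proof (cases "w = 0")
      case False
      then have "(p, (1 / norm w) *\<^sub>R w) \<in> ?K" using \<open>p \<in> K\<close> by simp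
      from z(2)[OF this] have "?f z \<le> norm (frame_map \<alpha> p ((1 / norm w) *\<^sub>R (0, w)))" by simp
      then have "?f z \<le> norm (frame_map \<alpha> p (0, w)) / norm w" unfolding frame_map_scaleR by simp
      then show ?thesis using False \<open>0 < ?f z\<close> by (simp add: field_simps)
    qed simp
  qed
qed

text \<open>These constants are merely finite, without control in \<open>k\<close>. They provide the
  framed bundle whose constants are improved afterwards, and they remain in force where the
  hypotheses bound nothing.\<close>

lemma obtain_framed_bundle:
  fixes E :: "('m::finite, 'n::finite) distribution"
  assumes cov: "compatible_cover U E s V \<alpha>" and C1: "C1_subbundle U E" and tr: "transverse_to_vertical U E"
    and K: "compact K" "K \<subseteq> U" and C: "\<And>p. p \<in> K \<Longrightarrow> norm (slope E p) \<le> C" "0 \<le> C"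
  obtains Kc S M D where "framed_bundle K (slope E) {1..s} Kc V \<alpha> C S M D"
proof -
  have op: "\<And>i. i \<in> {1..s} \<Longrightarrow> open (V i)" and U: "(\<Union>i\<in>{1..s}. V i) = U"
    and fr: "\<And>i. i \<in> {1..s} \<Longrightarrow> annihilator_frame (V i) E (\<alpha> i)"
    using cov unfolding compatible_cover_def by blast+
  have VU: "V i \<subseteq> U" if "i \<in> {1..s}" for i using U that by blast
  have graph: "p \<in> U \<Longrightarrow> E p = range (lift_vector (slope E) p)" for p
    by (rule C1_subbundle_graph[OF C1 tr])
  obtain Kc where Kc: "\<And>i. compact (Kc i)" "\<And>i. i \<in> {1..s} \<Longrightarrow> Kc i \<subseteq> V i" "K \<subseteq> (\<Union>i\<in>{1..s}. Kc i)"
    using obtain_compact_cover[where K = K and I = "{1..s}" and V = V] K U op by blast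
  have frC1: "C1_on (V i) (\<alpha> i j)" if "i \<in> {1..s}" for i j
    using fr[OF that] unfolding annihilator_frame_def by blast
  have "\<exists>S\<ge>0. \<forall>p\<in>Kc i. \<forall>w. norm w \<le> S * norm (frame_map (\<alpha> i) p (0, w))" if i: "i \<in> {1..s}" for i
    using inverse_bound_on_compact[OF fr[OF i] tr Kc(1) Kc(2)[OF i] VU[OF i]] by metis
  then obtain S where S: "\<And>i. i \<in> {1..s} \<Longrightarrow> 0 \<le> S i"
    "\<And>i p w. i \<in> {1..s} \<Longrightarrow> p \<in> Kc i \<Longrightarrow> norm w \<le> S i * norm (frame_map (\<alpha> i) p (0, w))" by metis
  have "\<exists>B>0. \<forall>p\<in>Kc i. \<forall>u v. norm (frame_d (\<alpha> i) p u v) \<le> B * norm u * norm v" if i: "i \<in> {1..s}" for i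
    using frame_d_bounded_on_compact[where \<alpha> = "\<alpha> i", OF frC1[OF i] Kc(1) Kc(2)[OF i]] by metis
  then obtain B where B: "\<And>i. i \<in> {1..s} \<Longrightarrow> 0 < B i"
    "\<And>i p u v. i \<in> {1..s} \<Longrightarrow> p \<in> Kc i \<Longrightarrow> norm (frame_d (\<alpha> i) p u v) \<le> B i * norm u * norm v" by metis
  define S' where "S' = sum S {1..s}"
  define B' where "B' = sum B {1..s}"
  have S': "0 \<le> S'" "\<And>i. i \<in> {1..s} \<Longrightarrow> S i \<le> S'"
    unfolding S'_def using S(1) by (auto intro!: sum_nonneg member_le_sum)
  have B': "0 \<le> B'" "\<And>i. i \<in> {1..s} \<Longrightarrow> B i \<le> B'"
    unfolding B'_def using less_imp_le[OF B(1)] by (auto intro!: sum_nonneg member_le_sum)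
  have inv: "norm w \<le> S' * norm (frame_map (\<alpha> i) p (0, w))" if "i \<in> {1..s}" "p \<in> Kc i" for i p w
    using S(2)[OF that, of w] mult_right_mono[OF S'(2)[OF that(1)] norm_ge_zero[of "frame_map (\<alpha> i) p (0, w)"]]
    by linarith
  have dB: "norm (frame_d (\<alpha> i) p u v) \<le> B' * norm u * norm v" if "i \<in> {1..s}" "p \<in> Kc i" for i p u v
  proof -
    have "B i * norm u * norm v \<le> B' * norm u * norm v" by (intro mult_right_mono B'(2) that(1)) auto
    then show ?thesis using B(2)[OF that, of u v] by linarith
  qed
  \<comment> \<open>The mixed constant is \<open>B' * S'\<close> because \<open>mixed_bound\<close>
    measures the vertical argument by the frame: \<open>norm w\<close> has to be replaced at the
    price of \<open>S'\<close>.\<close>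
  have "framed_bundle K (slope E) {1..s} Kc V \<alpha> C S' (B' * S') B'"
  proof
    show "frame_map (\<alpha> i) p (lift_vector (slope E) p u) = 0" if "i \<in> {1..s}" "p \<in> V i" for i p u
    proof -
      have "lift_vector (slope E) p u \<in> E p" using graph[of p] VU[OF that(1)] that(2) by blast
      then show ?thesis using fr[OF that(1)] that(2)
        unfolding annihilator_frame_def frame_map_def by (simp add: vec_eq_iff)
    qed
    show "norm (frame_map (\<alpha> i) p d) = norm (frame_map (\<alpha> i') p d)"
      if "i \<in> {1..s}" "i' \<in> {1..s}" "p \<in> V i" "p \<in> V i'" for i i' p d
      by (rule compatible_norm_eq[OF cov tr that graph]) (use VU[OF that(1)] that(3) in blast)
    show "norm (frame_d (\<alpha> i) p (lift_vector (slope E) p u) (0, w))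
        \<le> B' * S' * norm (lift_vector (slope E) p u) * norm (frame_map (\<alpha> i) p (0, w))"
      if "i \<in> {1..s}" "p \<in> Kc i" for i p u w
    proof -
      have "norm (frame_d (\<alpha> i) p (lift_vector (slope E) p u) (0, w))
        \<le> B' * norm (lift_vector (slope E) p u) * norm w"
        using dB[OF that, of "lift_vector (slope E) p u" "(0, w)"] by (simp add: norm_Pair)
      also have "\<dots> \<le> B' * norm (lift_vector (slope E) p u) * (S' * norm (frame_map (\<alpha> i) p (0, w)))"
        using B'(1) by (intro mult_left_mono inv that) auto
      finally show ?thesis by (simp add: mult_ac)
    qed
  qed (use Kc op frC1 C inv dB S' B' in auto)
  then show ?thesis by (rule that)
qed

lemma framed_bundle_change_bounds:
  assumes "framed_bundle K L I Kc V \<alpha> C S0 M0 D0"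
    and "\<And>i p w. i \<in> I \<Longrightarrow> p \<in> Kc i \<Longrightarrow> norm w \<le> S * norm (frame_map (\<alpha> i) p (0, w))"
    and "\<And>i p u w. i \<in> I \<Longrightarrow> p \<in> Kc i \<Longrightarrow> norm (frame_d (\<alpha> i) p (lift_vector L p u) (0, w))
        \<le> M * norm (lift_vector L p u) * norm (frame_map (\<alpha> i) p (0, w))"
    and "\<And>i p u u'. i \<in> I \<Longrightarrow> p \<in> Kc i \<Longrightarrow> norm (frame_d (\<alpha> i) p (lift_vector L p u) (lift_vector L p u'))
        \<le> D * norm (lift_vector L p u) * norm (lift_vector L p u')"
    and "0 \<le> S" "0 \<le> M" "0 \<le> D"
  shows "framed_bundle K L I Kc V \<alpha> C S M D"
proof -
  interpret framed_bundle K L I Kc V \<alpha> C S0 M0 D0 by fact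
  show ?thesis
    by unfold_locales (fact finite_I compact_Kc Kc_subset open_V K_covered C1_frame L_bound annihilates compatible nonneg(1) assms)+
qed

text \<open>A unit vector of \<open>E p\<close> has a first component of length at least
  \<open>1 / (1 + C)\<close>. By the bound on \<theta> the nearby unit vector of \<open>F p\<close>
  keeps at least half of it, so comparing second components over this \<open>u'\<close> and dividing
  by its length is safe.\<close>

lemma slope_dist_le:
  fixes E F :: "('m::finite, 'n::finite) distribution"
  assumes E: "E p = range (lift_vector (slope E) p)" and F: "F p = range (lift_vector (slope F) p)"
    and C: "norm (slope E p) \<le> C" "0 \<le> C"
    and hd: "hausdorff_dist (F p \<inter> sphere 0 1) (E p \<inter> sphere 0 1) < \<theta>" "\<theta> \<le> 1 / (2 * (1 + C))"
  shows "norm (slope F p - slope E p) \<le> 2 * (1 + C)\<^sup>2 * \<theta>"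
proof (rule norm_blinfun_bound)
  have sphere_unit: "(1 / norm (lift_vector L p u)) *\<^sub>R lift_vector L p u \<in> range (lift_vector L p) \<inter> sphere 0 1"
    if "u \<noteq> 0" for L and u :: "real ^ 'm"
  proof -
    have "lift_vector L p u \<noteq> 0" using that by (simp add: lift_vector_def zero_prod_def)
    then have "norm ((1 / norm (lift_vector L p u)) *\<^sub>R lift_vector L p u) = 1" by simp
    moreover have "c *\<^sub>R lift_vector L p u \<in> range (lift_vector L p)" for c
      by (rule range_eqI[of _ _ "c *\<^sub>R u"]) (simp add: lift_vector_def blinfun.scaleR_right)
    ultimately show ?thesis by simp
  qed
  have ne: "E p \<inter> sphere 0 1 \<noteq> {}" using sphere_unit[of 1 "slope E"] unfolding E[symmetric] by auto
  have bdd: "bdd_above ((\<lambda>x. infdist x (E p \<inter> sphere 0 1)) ` (F p \<inter> sphere 0 1))"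
  proof (rule bdd_aboveI2)
    fix x assume x: "x \<in> F p \<inter> sphere 0 1"
    obtain a where a: "a \<in> E p \<inter> sphere 0 1" using ne by blast
    have "infdist x (E p \<inter> sphere 0 1) \<le> dist x a" by (rule infdist_le[OF a])
    also have "\<dots> \<le> 2" using norm_triangle_ineq4[of x a] x a by (simp add: dist_norm)
    finally show "infdist x (E p \<inter> sphere 0 1) \<le> 2" .
  qed
  \<comment> \<open>\<open>hausdorff_dist\<close> is built from real suprema, so even its
    nonnegativity requires a member of a bounded set; it is needed for
    \<open>0 < \<theta>\<close>.\<close>
  have "0 \<le> infdist ((1 / norm (lift_vector (slope F) p 1)) *\<^sub>R lift_vector (slope F) p 1) (E p \<inter> sphere 0 1)"
    by (rule infdist_nonneg)
  also have "\<dots> \<le> hausdorff_dist (F p \<inter> sphere 0 1) (E p \<inter> sphere 0 1)"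
    unfolding hausdorff_dist_def
    by (intro max.coboundedI1 cSUP_upper bdd) (use sphere_unit[of 1 "slope F"] F in auto)
  finally have "0 < \<theta>" using hd by simp
  then show "0 \<le> 2 * (1 + C)\<^sup>2 * \<theta>" by simp
  fix u :: "real ^ 'm"
  show "norm ((slope F p - slope E p) u) \<le> 2 * (1 + C)\<^sup>2 * \<theta> * norm u"
  proof (cases "u = 0")
    case True
    then show ?thesis by (simp add: blinfun.zero_right)
  next
    case False
    define c where "c = 1 / norm (lift_vector (slope F) p u)"
    define u' where "u' = c *\<^sub>R u"
    have "lift_vector (slope F) p u \<noteq> 0" using False by (simp add: lift_vector_def zero_prod_def)
    then have "0 < c" by (simp add: c_def)
    have e: "lift_vector (slope F) p u' = c *\<^sub>R lift_vector (slope F) p u"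
      by (simp add: u'_def lift_vector_def blinfun.scaleR_right)
    then have eF: "lift_vector (slope F) p u' \<in> F p \<inter> sphere 0 1"
      using sphere_unit[OF False, of "slope F"] F by (simp add: c_def)
    have "infdist (lift_vector (slope F) p u') (E p \<inter> sphere 0 1)
        \<le> hausdorff_dist (F p \<inter> sphere 0 1) (E p \<inter> sphere 0 1)"
      unfolding hausdorff_dist_def by (intro max.coboundedI1 cSUP_upper bdd eF)
    then have "infdist (lift_vector (slope F) p u') (E p \<inter> sphere 0 1) < \<theta>" using hd(1) by simp
    then have "(INF a\<in>E p \<inter> sphere 0 1. dist (lift_vector (slope F) p u') a) < \<theta>"
      using ne by (simp add: infdist_notempty)
    moreover have "bdd_below ((\<lambda>a. dist (lift_vector (slope F) p u') a) ` (E p \<inter> sphere 0 1))"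
      by (rule bdd_belowI2[of _ 0]) simp
    ultimately obtain a where a: "a \<in> E p \<inter> sphere 0 1" "dist (lift_vector (slope F) p u') a < \<theta>"
      using cINF_less_iff[OF ne] by blast
    then obtain w where w: "a = lift_vector (slope E) p w" using E by blast
    have d: "norm (u' - w) < \<theta>" "norm (slope F p u' - slope E p w) < \<theta>"
    proof -
      have n: "norm (lift_vector (slope F) p u' - lift_vector (slope E) p w) < \<theta>" using a w by (simp add: dist_norm)
      show "norm (u' - w) < \<theta>"
        using norm_fst_le[of "u' - w" "slope F p u' - slope E p w"] n by (simp add: lift_vector_def)
      show "norm (slope F p u' - slope E p w) < \<theta>"
        using norm_snd_le[of "slope F p u' - slope E p w" "u' - w"] n by (simp add: lift_vector_def)
    qed
    have "1 \<le> (1 + C) * norm w" using a(1) norm_lift_vector_le[of "slope E" p C w] C by (simp add: w)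
    define \<kappa> where "\<kappa> = 1 / (2 * (1 + C))"
    have "2 * \<kappa> \<le> norm w"
      using \<open>1 \<le> (1 + C) * norm w\<close> C(2) by (simp add: \<kappa>_def field_simps)
    moreover have "\<theta> \<le> \<kappa>" using hd(2) by (simp add: \<kappa>_def)
    ultimately have "\<kappa> \<le> norm u'"
      using d(1) norm_triangle_ineq3[of u' w] by linarith
    then have u': "1 \<le> 2 * (1 + C) * norm u'" using C(2) by (simp add: \<kappa>_def field_simps)
    have "(slope F p - slope E p) u' = (slope F p u' - slope E p w) - slope E p (u' - w)"
      by (simp add: blinfun.diff_left blinfun.diff_right)
    then have "norm ((slope F p - slope E p) u') \<le> norm (slope F p u' - slope E p w) + norm (slope E p (u' - w))"
      by (simp add: norm_triangle_ineq4)
    also have "\<dots> \<le> \<theta> + C * \<theta>"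
    proof (rule add_mono)
      have "norm (slope E p (u' - w)) \<le> norm (slope E p) * norm (u' - w)" by (rule norm_blinfun)
      also have "\<dots> \<le> C * \<theta>" using C d(1) by (intro mult_mono) auto
      finally show "norm (slope E p (u' - w)) \<le> C * \<theta>" .
    qed (use d in simp)
    also have "\<dots> = (1 + C) * \<theta> * 1" by (simp add: algebra_simps)
    also have "\<dots> \<le> (1 + C) * \<theta> * (2 * (1 + C) * norm u')"
      using C(2) \<open>0 < \<theta>\<close> by (intro mult_left_mono u') auto
    also have "\<dots> = c * (2 * (1 + C)\<^sup>2 * \<theta> * norm u)"
      using \<open>0 < c\<close> by (simp add: u'_def power2_eq_square)
    finally have "c * norm ((slope F p - slope E p) u) \<le> c * (2 * (1 + C)\<^sup>2 * \<theta> * norm u)"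
      using \<open>0 < c\<close> by (simp add: u'_def blinfun.scaleR_right)
    then show ?thesis using \<open>0 < c\<close> by (rule mult_left_le_imp_le)
  qed
qed

lemma slope_uniform_limit:
  fixes E :: "('m::finite, 'n::finite) distribution"
  assumes conv: "converges_in_angle U Ek E" and "K \<subseteq> U"
    and E: "\<And>p. p \<in> U \<Longrightarrow> E p = range (lift_vector (slope E) p)"
    and Ek: "\<And>k p. p \<in> U \<Longrightarrow> Ek k p = range (lift_vector (slope (Ek k)) p)"
    and C: "\<And>p. p \<in> K \<Longrightarrow> norm (slope E p) \<le> C" "0 \<le> C" and "0 < e"
  obtains N where "\<And>k p. k \<ge> N \<Longrightarrow> p \<in> K \<Longrightarrow> norm (slope (Ek k) p - slope E p) \<le> e"
proof -
  define \<theta> where "\<theta> = min (1 / (2 * (1 + C))) (e / (2 * (1 + C)\<^sup>2))"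
  have "0 < \<theta>" using C(2) \<open>0 < e\<close> by (simp add: \<theta>_def)
  have "\<theta> \<le> e / (2 * (1 + C)\<^sup>2)" by (simp add: \<theta>_def)
  then have \<theta>e: "2 * (1 + C)\<^sup>2 * \<theta> \<le> e" using C(2) by (simp add: field_simps)
  have "\<forall>\<^sub>F k in sequentially. \<forall>p\<in>U. dist (hausdorff_dist (Ek k p \<inter> sphere 0 1) (E p \<inter> sphere 0 1)) 0 < \<theta>"
    using conv \<open>0 < \<theta>\<close> unfolding converges_in_angle_def uniform_limit_iff by blast
  then obtain N where N: "\<And>k p. k \<ge> N \<Longrightarrow> p \<in> U \<Longrightarrow> \<bar>hausdorff_dist (Ek k p \<inter> sphere 0 1) (E p \<inter> sphere 0 1)\<bar> < \<theta>"
    unfolding eventually_sequentially by auto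
  show ?thesis
  proof
    fix k p assume k: "k \<ge> N" and p: "p \<in> K"
    then have "p \<in> U" using \<open>K \<subseteq> U\<close> by blast
    have "norm (slope (Ek k) p - slope E p) \<le> 2 * (1 + C)\<^sup>2 * \<theta>"
      by (rule slope_dist_le[where E = E and F = "Ek k", OF E[OF \<open>p \<in> U\<close>] Ek[OF \<open>p \<in> U\<close>] C(1)[OF p] C(2)])
        (use N[OF k \<open>p \<in> U\<close>] in \<open>auto simp: \<theta>_def\<close>)
    then show "norm (slope (Ek k) p - slope E p) \<le> e" using \<theta>e by linarith
  qed
qed

section \<open>Existence of integral manifolds\<close>

lemma subspace_range_lift: "subspace (range (lift_vector L p))"
proof -
  have "linear (lift_vector L p)"
    by (intro linearI) (simp_all add: lift_vector_def blinfun.add_right blinfun.scaleR_right)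
  then show ?thesis by (intro linear_subspace_image) auto
qed

text \<open>The two regularity notions differ only in the first factor of the product.
  \<open>X\<close> stands for either, so that both halves of the theorem share this
  argument.\<close>

lemma framed_bundle_product_bound:
  fixes F :: "('m::finite, 'n::finite) distribution" and X :: "nat \<Rightarrow> ennreal" and \<epsilon> :: real and s :: nat
  defines "T \<equiv> \<lambda>V \<alpha>. MAX (i, j, l) \<in> {1..s} \<times> {1..s} \<times> {1..s}.
    X i * inv_sup_norm (V j) (\<alpha> j) * exp_ennreal (ennreal \<epsilon> * M_const (V l) F (\<alpha> l))"
  assumes cov: "compatible_cover U F s V \<alpha>" and C1: "C1_subbundle U F" and tr: "transverse_to_vertical U F"
    and K: "compact K" "K \<subseteq> U" "K \<noteq> {}" and C: "\<And>p. p \<in> K \<Longrightarrow> norm (slope F p) \<le> C" "0 \<le> C"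
    and "0 < \<epsilon>" "T V \<alpha> < top"
  obtains Kc S M D R where "framed_bundle K (slope F) {1..s} Kc V \<alpha> C S M D" "0 \<le> R"
    "S * exp (\<epsilon> * M) * R \<le> enn2real (T V \<alpha>)" "\<And>i. i \<in> {1..s} \<Longrightarrow> X i \<le> ennreal R"
proof -
  obtain Kc S0 M0 D0 where fb: "framed_bundle K (slope F) {1..s} Kc V \<alpha> C S0 M0 D0"
    by (rule obtain_framed_bundle[OF cov C1 tr K(1,2) C])
  interpret framed_bundle K "slope F" "{1..s}" Kc V \<alpha> C S0 M0 D0 by fact
  have s: "1 \<le> s" and U: "(\<Union>i\<in>{1..s}. V i) = U"
    and fr: "\<And>i. i \<in> {1..s} \<Longrightarrow> annihilator_frame (V i) F (\<alpha> i)"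
    using cov unfolding compatible_cover_def by blast+
  have inU: "p \<in> U" and inV: "p \<in> V i" if "i \<in> {1..s}" "p \<in> Kc i" for i p
    using that U Kc_subset[OF that(1)] by blast+
  have graph: "p \<in> U \<Longrightarrow> F p = range (lift_vector (slope F) p)" for p by (rule C1_subbundle_graph[OF C1 tr])
  have lift: "lift_vector (slope F) p u \<in> F p" if "p \<in> U" for p u using graph[OF that] by blast
  have sub: "subspace (F p)" if "p \<in> U" for p unfolding graph[OF that] by (rule subspace_range_lift)
  \<comment> \<open>A point of the nonempty \<open>K\<close> provides a nonempty chart, where
    \<open>inv_sup_norm_pos\<close> applies.\<close>
  obtain p0 j where j: "p0 \<in> U" "j \<in> {1..s}" "p0 \<in> V j" using K U by blast
  show ?thesis
  proof (rule finite_MAX_product_bound[of s j "\<lambda>j. inv_sup_norm (V j) (\<alpha> j)" \<epsilon> X "\<lambda>l. M_const (V l) F (\<alpha> l)"])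
    show "inv_sup_norm (V j) (\<alpha> j) \<noteq> 0" by (rule inv_sup_norm_pos[OF fr[OF j(2)] j(3) tr j(1)])
    show "(MAX (i, j, l)\<in>{1..s} \<times> {1..s} \<times> {1..s}.
        X i * inv_sup_norm (V j) (\<alpha> j) * exp_ennreal (ennreal \<epsilon> * M_const (V l) F (\<alpha> l))) < top"
      using \<open>T V \<alpha> < top\<close> by (simp add: T_def)
  next
    \<comment> \<open>Here \<open>M_const\<close> may be infinite, since \<open>0 * \<infinity> = 0\<close>; the constants from compactness serve.\<close>
    assume "\<And>i. i \<in> {1..s} \<Longrightarrow> X i = 0"
    then show ?thesis by (intro that[OF fb, of 0]) auto
  next
    fix R S M :: real assume nn: "0 \<le> R" "0 \<le> S" "0 \<le> M"
      and le: "S * exp (\<epsilon> * M) * R \<le> enn2real (MAX (i, j, l)\<in>{1..s} \<times> {1..s} \<times> {1..s}.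
        X i * inv_sup_norm (V j) (\<alpha> j) * exp_ennreal (ennreal \<epsilon> * M_const (V l) F (\<alpha> l)))"
      and b: "\<And>i. i \<in> {1..s} \<Longrightarrow> X i \<le> ennreal R \<and>
        inv_sup_norm (V i) (\<alpha> i) \<le> ennreal S \<and> M_const (V i) F (\<alpha> i) \<le> ennreal M"
    \<comment> \<open>Only \<open>S\<close> and \<open>M\<close> are replaced. For a general
      \<open>X\<close> nothing relates \<open>R\<close> to the curvature, so \<open>D0\<close> stays
      the constant from compactness.\<close>
    have "framed_bundle K (slope F) {1..s} Kc V \<alpha> C S M D0"
    proof (rule framed_bundle_change_bounds[OF fb _ _ curvature_bound])
      fix i p u w assume i: "i \<in> {1..s}" "p \<in> Kc i"
      show "norm w \<le> S * norm (frame_map (\<alpha> i) p (0, w))"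
        by (rule inv_sup_norm_bound[OF fr[OF i(1)] inV[OF i] tr inU[OF i]]) (use b i nn in auto)
      show "norm (frame_d (\<alpha> i) p (lift_vector (slope F) p u) (0, w))
        \<le> M * norm (lift_vector (slope F) p u) * norm (frame_map (\<alpha> i) p (0, w))"
        by (rule M_const_bound[OF fr[OF i(1)] inV[OF i] tr inU[OF i] _ nn(3) lift[OF inU[OF i]] sub[OF inU[OF i]]])
          (use b i in auto)
    qed (use nn nonneg in auto)
    moreover have "X i \<le> ennreal R" if "i \<in> {1..s}" for i using b[OF that] by blast
    ultimately show ?thesis using le by (intro that[unfolded T_def, OF _ nn(1)])
  qed (use s j \<open>0 < \<epsilon>\<close> in auto)
qed

text \<open>Here the first factor of the product is the curvature itself, so its bound can take the
  place of \<open>D0\<close>.\<close>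

lemma involutive_framed_bundle:
  fixes F :: "('m::finite, 'n::finite) distribution" and \<epsilon> :: real and s :: nat
  defines "T \<equiv> \<lambda>V \<alpha>. MAX (i, j, l) \<in> {1..s} \<times> {1..s} \<times> {1..s}.
    d_sup_norm (V i) F (\<alpha> i) * inv_sup_norm (V j) (\<alpha> j) * exp_ennreal (ennreal \<epsilon> * M_const (V l) F (\<alpha> l))"
  assumes cov: "compatible_cover U F s V \<alpha>" and C1: "C1_subbundle U F" and tr: "transverse_to_vertical U F"
    and K: "compact K" "K \<subseteq> U" "K \<noteq> {}" and C: "\<And>p. p \<in> K \<Longrightarrow> norm (slope F p) \<le> C" "0 \<le> C"
    and "0 < \<epsilon>" "T V \<alpha> < top"
  obtains Kc S M D where "framed_bundle K (slope F) {1..s} Kc V \<alpha> C S M D"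
    "S * exp (\<epsilon> * M) * D \<le> enn2real (T V \<alpha>)"
proof (rule framed_bundle_product_bound[OF cov C1 tr K C \<open>0 < \<epsilon>\<close> \<open>T V \<alpha> < top\<close>[unfolded T_def]])
  fix Kc S M D0 D
  assume fb: "framed_bundle K (slope F) {1..s} Kc V \<alpha> C S M D0" and "0 \<le> D"
    and le: "S * exp (\<epsilon> * M) * D \<le> enn2real (MAX (i, j, l) \<in> {1..s} \<times> {1..s} \<times> {1..s}.
      d_sup_norm (V i) F (\<alpha> i) * inv_sup_norm (V j) (\<alpha> j) * exp_ennreal (ennreal \<epsilon> * M_const (V l) F (\<alpha> l)))"
    and D: "\<And>i. i \<in> {1..s} \<Longrightarrow> d_sup_norm (V i) F (\<alpha> i) \<le> ennreal D"
  interpret framed_bundle K "slope F" "{1..s}" Kc V \<alpha> C S M D0 by fact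
  have "framed_bundle K (slope F) {1..s} Kc V \<alpha> C S M D"
  proof (rule framed_bundle_change_bounds[OF fb inverse_bound mixed_bound])
    fix i p u u' assume i: "i \<in> {1..s}" "p \<in> Kc i"
    then have pV: "p \<in> V i" using Kc_subset by blast
    then have "p \<in> U" using cov i unfolding compatible_cover_def by blast
    then have lift: "lift_vector (slope F) p u \<in> F p" for u using C1_subbundle_graph[OF C1 tr] by blast
    show "norm (frame_d (\<alpha> i) p (lift_vector (slope F) p u) (lift_vector (slope F) p u'))
        \<le> D * norm (lift_vector (slope F) p u) * norm (lift_vector (slope F) p u')"
      by (rule d_sup_norm_bound[OF C1_frame[OF i(1)] pV D[OF i(1)] \<open>0 \<le> D\<close> lift lift])
  qed (use nonneg \<open>0 \<le> D\<close> in auto)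
  then show ?thesis by (rule that) (use le in \<open>simp add: T_def\<close>)
qed

text \<open>Exterior regularity bounds the frame on \<open>E\<close> and not the curvature;
  \<open>D\<close> may thus be arbitrarily large. This is harmless for uniqueness, where the
  polygons compared have equal velocities and \<open>D\<close> enters multiplied by the norm of
  their difference.\<close>

lemma regular_framed_bundle:
  fixes E F :: "('m::finite, 'n::finite) distribution" and \<epsilon> :: real and s :: nat
  defines "T \<equiv> \<lambda>V \<alpha>. MAX (i, j, l) \<in> {1..s} \<times> {1..s} \<times> {1..s}.
    restr_sup_norm (V i) E (\<alpha> i) * inv_sup_norm (V j) (\<alpha> j) * exp_ennreal (ennreal \<epsilon> * M_const (V l) F (\<alpha> l))"
  assumes cov: "compatible_cover U F s V \<alpha>" and C1: "C1_subbundle U F" and tr: "transverse_to_vertical U F"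
    and K: "compact K" "K \<subseteq> U" "K \<noteq> {}" and C: "\<And>p. p \<in> K \<Longrightarrow> norm (slope F p) \<le> C" "0 \<le> C"
    and "0 < \<epsilon>" "T V \<alpha> < top"
  obtains Kc S M D R where "framed_bundle K (slope F) {1..s} Kc V \<alpha> C S M D" "0 \<le> R"
    "S * exp (\<epsilon> * M) * R \<le> enn2real (T V \<alpha>)"
    "\<And>i p v. i \<in> {1..s} \<Longrightarrow> p \<in> Kc i \<Longrightarrow> v \<in> E p \<Longrightarrow> norm (frame_map (\<alpha> i) p v) \<le> R * norm v"
proof (rule framed_bundle_product_bound[OF cov C1 tr K C \<open>0 < \<epsilon>\<close> \<open>T V \<alpha> < top\<close>[unfolded T_def]])
  fix Kc S M D R
  assume fb: "framed_bundle K (slope F) {1..s} Kc V \<alpha> C S M D" and "0 \<le> R"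
    and le: "S * exp (\<epsilon> * M) * R \<le> enn2real (MAX (i, j, l) \<in> {1..s} \<times> {1..s} \<times> {1..s}.
      restr_sup_norm (V i) E (\<alpha> i) * inv_sup_norm (V j) (\<alpha> j) * exp_ennreal (ennreal \<epsilon> * M_const (V l) F (\<alpha> l)))"
    and R: "\<And>i. i \<in> {1..s} \<Longrightarrow> restr_sup_norm (V i) E (\<alpha> i) \<le> ennreal R"
  show ?thesis
  proof (rule that[OF fb \<open>0 \<le> R\<close>])
    fix i p v assume i: "i \<in> {1..s}" "p \<in> Kc i" "v \<in> E p"
    have "p \<in> V i" using framed_bundle.Kc_subset[OF fb i(1)] i(2) by blast
    from restr_sup_norm_bound[where E = E, OF this R[OF i(1)] \<open>0 \<le> R\<close> i(3)]
    show "norm (frame_map (\<alpha> i) p v) \<le> R * norm v" .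
  qed (use le in \<open>simp add: T_def\<close>)
qed

section \<open>Limits of approximate solutions\<close>

lemma local_estimate_imp_segment_estimate:
  fixes f :: "'a::real_normed_vector \<Rightarrow> 'b::real_normed_vector" and \<Lambda> :: "'a \<Rightarrow>\<^sub>L 'b"
  assumes "0 < d" and local: "\<And>a b. \<lbrakk>a \<in> closed_segment v w; b \<in> closed_segment v w; norm (b - a) < d\<rbrakk> \<Longrightarrow>
    norm (f b - f a - \<Lambda> (b - a)) \<le> c * norm (b - a)"
  shows "norm (f w - f v - \<Lambda> (w - v)) \<le> c * norm (w - v)"
proof -
  obtain n :: nat where n: "norm (w - v) / d < real n" using reals_Archimedean2 by blast
  have "0 \<le> norm (w - v) / d" using \<open>0 < d\<close> by simp
  then have "0 < real n" using n by linarith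
  define a where "a i = v + (real i / real n) *\<^sub>R (w - v)" for i :: nat
  \<comment> \<open>Subtracting the fixed linear map makes the increments of \<open>g\<close> along
    a fine subdivision telescope; the errors add up to \<open>c\<close> times the full length,
    independently of \<open>d\<close>.\<close>
  define g where "g x = f x - \<Lambda> x" for x
  have seg: "a i \<in> closed_segment v w" if "i \<le> n" for i
    unfolding in_segment a_def using that \<open>0 < real n\<close>
    by (intro exI[of _ "real i / real n"]) (auto simp: algebra_simps)
  have diff: "a (Suc i) - a i = (1 / real n) *\<^sub>R (w - v)" for i
    by (simp add: a_def add_divide_distrib algebra_simps)
  then have na: "norm (a (Suc i) - a i) = norm (w - v) / real n" for i by simp
  have small: "norm (w - v) / real n < d" using n \<open>0 < d\<close> \<open>0 < real n\<close> by (simp add: field_simps)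
  have "a n = w" "a 0 = v" using \<open>0 < real n\<close> by (simp_all add: a_def)
  then have "g w - g v = (\<Sum>i<n. g (a (Suc i)) - g (a i))"
    using sum_lessThan_telescope[of "\<lambda>i. g (a i)" n] by simp
  also have "norm \<dots> \<le> of_nat (card {..<n}) * (c * (norm (w - v) / real n))"
  proof (rule order_trans[OF norm_sum], rule sum_bounded_above)
    fix i assume "i \<in> {..<n}"
    then have "norm (f (a (Suc i)) - f (a i) - \<Lambda> (a (Suc i) - a i)) \<le> c * norm (a (Suc i) - a i)"
      by (intro local seg) (use small na in auto)
    then show "norm (g (a (Suc i)) - g (a i)) \<le> c * (norm (w - v) / real n)"
      unfolding na by (simp add: g_def blinfun.diff_right algebra_simps)
  qed
  also have "\<dots> = c * norm (w - v)" using \<open>0 < real n\<close> by simp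
  finally show ?thesis by (simp add: g_def blinfun.diff_right algebra_simps)
qed

lemma approximate_solutions_limit:
  fixes f :: "nat \<Rightarrow> real ^ 'm \<Rightarrow> real ^ 'n" and L :: "('m::finite, 'n::finite) pt \<Rightarrow> (real ^ 'm) \<Rightarrow>\<^sub>L (real ^ 'n)"
  assumes K: "compact K" and "0 < \<rho>" and inK: "\<And>k v. norm v \<le> \<rho> \<Longrightarrow> (x0 + v, f k v) \<in> K"
    and f0: "\<And>k. f k 0 = y0" and L: "continuous_on K L"
    and Lk: "\<And>e. 0 < e \<Longrightarrow> \<exists>N. \<forall>k\<ge>N. \<forall>p\<in>K. norm (Lk k p - L p) \<le> e"
    and C: "\<And>k p. p \<in> K \<Longrightarrow> norm (Lk k p) \<le> C"
    and \<tau>: "\<tau> \<longlonglongrightarrow> 0" and d: "\<And>k. 0 < d k"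
    and est: "\<And>k v v'. \<lbrakk>norm v \<le> \<rho>; norm v' \<le> \<rho>; norm (v' - v) < d k\<rbrakk> \<Longrightarrow>
      norm (f k v' - f k v - Lk k (x0 + v, f k v) (v' - v)) \<le> \<tau> k * norm (v' - v)"
  obtains g where "g 0 = y0" "\<And>v. norm v \<le> \<rho> \<Longrightarrow> (x0 + v, g v) \<in> K"
    "\<And>v. norm v \<le> \<rho> \<Longrightarrow> (g has_derivative L (x0 + v, g v)) (at v within cball 0 \<rho>)"
proof -
  have "Bseq \<tau>" using \<tau> by (intro convergent_imp_Bseq convergentI)
  then obtain t where t: "0 < t" "\<And>k. \<bar>\<tau> k\<bar> \<le> t" by (auto simp: Bseq_def)
  obtain B where B: "\<And>p. p \<in> K \<Longrightarrow> norm p \<le> B"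
    using compact_imp_bounded[OF K] unfolding bounded_iff by blast
  have "(x0 + 0, f 0 0) \<in> K" using inK[of 0 0] \<open>0 < \<rho>\<close> by simp
  then have "0 \<le> C" using C norm_ge_zero order_trans by blast
  have seg: "norm a \<le> \<rho>" if "a \<in> closed_segment v w" "norm v \<le> \<rho>" "norm w \<le> \<rho>" for a v w :: "real ^ 'm"
    using that closed_segment_subset[of v "cball 0 \<rho>" w] convex_cball by auto
  have lip: "norm (f k w - f k v) \<le> (C + t) * norm (w - v)" if "norm v \<le> \<rho>" "norm w \<le> \<rho>" for k v w
  proof -
    \<comment> \<open>The linear map 0 turns the segment estimate into a Lipschitz bound uniform in
      \<open>k\<close>, which gives the equicontinuity for Arzela and Ascoli.\<close>
    have "norm (f k w - f k v - (0 :: (real ^ 'm) \<Rightarrow>\<^sub>L (real ^ 'n)) (w - v)) \<le> (C + t) * norm (w - v)"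
    proof (rule local_estimate_imp_segment_estimate[OF d[of k]])
      fix a b assume a: "a \<in> closed_segment v w" "b \<in> closed_segment v w" and ab: "norm (b - a) < d k"
      have n: "norm a \<le> \<rho>" "norm b \<le> \<rho>" using a seg that by blast+
      have "norm (Lk k (x0 + a, f k a) (b - a)) \<le> C * norm (b - a)"
        by (rule order_trans[OF norm_blinfun]) (intro mult_right_mono C inK n norm_ge_zero)
      moreover have "\<tau> k * norm (b - a) \<le> t * norm (b - a)" using t(2)[of k] by (intro mult_right_mono) auto
      moreover have "norm (f k b - f k a) \<le> norm (f k b - f k a - Lk k (x0 + a, f k a) (b - a)) + norm (Lk k (x0 + a, f k a) (b - a))"
        using norm_triangle_ineq[of "f k b - f k a - Lk k (x0 + a, f k a) (b - a)" "Lk k (x0 + a, f k a) (b - a)"] by simp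
      ultimately have "norm (f k b - f k a) \<le> (C + t) * norm (b - a)"
        using est[OF n ab] by (simp add: distrib_right)
      then show "norm (f k b - f k a - (0 :: (real ^ 'm) \<Rightarrow>\<^sub>L (real ^ 'n)) (b - a)) \<le> (C + t) * norm (b - a)" by simp
    qed
    then show ?thesis by simp
  qed
  have Ct: "0 < C + t" using \<open>0 \<le> C\<close> t by simp
  obtain g k where g: "continuous_on (cball 0 \<rho>) g" "strict_mono (k :: nat \<Rightarrow> nat)"
    "\<And>e. 0 < e \<Longrightarrow> \<exists>N. \<forall>n x. n \<ge> N \<and> x \<in> cball 0 \<rho> \<longrightarrow> norm (f (k n) x - g x) < e"
  proof (rule Arzela_Ascoli[of "cball 0 \<rho>" f B])
    show "norm (f n x) \<le> B" if "x \<in> cball 0 \<rho>" for n x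
      using B[OF inK[of x n]] norm_snd_le[of "f n x" "x0 + x"] that by simp
    show "\<exists>d>0. \<forall>n y. y \<in> cball 0 \<rho> \<and> norm (x - y) < d \<longrightarrow> norm (f n x - f n y) < e"
      if "x \<in> cball 0 \<rho>" "0 < e" for x e
    proof (intro exI[of _ "e / (C + t)"] conjI allI impI)
      fix n y assume "y \<in> cball 0 \<rho> \<and> norm (x - y) < e / (C + t)"
      then show "norm (f n x - f n y) < e"
        using lip[of y x n] that Ct by (simp add: pos_less_divide_eq mult.commute)
    qed (use that Ct in simp)
  qed auto
  have lim: "(\<lambda>n. f (k n) v) \<longlonglongrightarrow> g v" if "norm v \<le> \<rho>" for v
  proof (rule LIMSEQ_I)
    fix e :: real assume "0 < e"
    then obtain N where "\<forall>n x. n \<ge> N \<and> x \<in> cball 0 \<rho> \<longrightarrow> norm (f (k n) x - g x) < e" using g(3) by blast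
    then show "\<exists>N. \<forall>n\<ge>N. norm (f (k n) v - g v) < e" using that by (intro exI[of _ N]) auto
  qed
  have gK: "(x0 + v, g v) \<in> K" if "norm v \<le> \<rho>" for v
  proof (rule closed_sequentially[OF compact_imp_closed[OF K]])
    show "(x0 + v, f (k n) v) \<in> K" for n using inK that by blast
    show "(\<lambda>n. (x0 + v, f (k n) v)) \<longlonglongrightarrow> (x0 + v, g v)" by (intro tendsto_Pair tendsto_const lim that)
  qed
  show ?thesis
  proof (rule that)
    show "g 0 = y0" using lim[of 0] \<open>0 < \<rho>\<close> by (simp add: f0 LIMSEQ_const_iff)
    show "(x0 + v, g v) \<in> K" if "norm v \<le> \<rho>" for v by (rule gK[OF that])
    fix v :: "real ^ 'm" assume v: "norm v \<le> \<rho>"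
    let ?P = "(x0 + v, g v)"
    have "\<exists>\<delta>>0. \<forall>w\<in>cball 0 \<rho>. norm (w - v) < \<delta> \<longrightarrow> norm (g w - g v - L ?P (w - v)) \<le> e * norm (w - v)"
      if "0 < e" for e
    proof -
      obtain \<delta>1 where \<delta>1: "0 < \<delta>1" "\<And>p. p \<in> K \<Longrightarrow> dist p ?P < \<delta>1 \<Longrightarrow> dist (L p) (L ?P) < e / 3"
      proof -
        have "0 < e / 3" using \<open>0 < e\<close> by simp
        with L gK[OF v] show ?thesis unfolding continuous_on_iff using that by blast
      qed
      \<comment> \<open>The graph of \<open>f (k n)\<close> over the \<delta>-ball has to stay
        within \<delta>1 of \<open>?P\<close>: one half of \<delta>1 goes to the Lipschitz bound,
        the other to the convergence at \<open>v\<close>.\<close>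
      define \<delta> where "\<delta> = \<delta>1 / (2 * (1 + C + t))"
      have "0 < \<delta>" using \<delta>1 Ct by (simp add: \<delta>_def)
      have \<delta>: "(1 + C + t) * \<delta> = \<delta>1 / 2" using Ct by (simp add: \<delta>_def field_simps)
      have "norm (g w - g v - L ?P (w - v)) \<le> e * norm (w - v)" if w: "norm w \<le> \<rho>" "norm (w - v) < \<delta>" for w
      proof -
        obtain N1 where N1: "\<And>n. n \<ge> N1 \<Longrightarrow> norm (f (k n) v - g v) < \<delta>1 / 2"
          using LIMSEQ_D[OF lim[OF v], of "\<delta>1 / 2"] \<delta>1 by auto
        obtain N2 where N2: "\<And>n p. n \<ge> N2 \<Longrightarrow> p \<in> K \<Longrightarrow> norm (Lk n p - L p) \<le> e / 3"
          using Lk[of "e / 3"] \<open>0 < e\<close> by auto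
        obtain N3 where N3: "\<And>n. n \<ge> N3 \<Longrightarrow> \<bar>\<tau> n\<bar> < e / 3"
          using LIMSEQ_D[OF \<tau>, of "e / 3"] \<open>0 < e\<close> by auto
        \<comment> \<open>The three thirds of \<open>e\<close> pay for the error
          \<open>\<tau>\<close>, for replacing \<open>Lk\<close> by \<open>L\<close>, and for
          freezing \<open>L\<close> at \<open>?P\<close>.\<close>
        have ev: "norm (f (k n) w - f (k n) v - L ?P (w - v)) \<le> e * norm (w - v)"
          if n: "n \<ge> max N1 (max N2 N3)" for n
        proof (rule local_estimate_imp_segment_estimate[OF d[of "k n"]])
          fix a b assume a: "a \<in> closed_segment v w" and b: "b \<in> closed_segment v w" and ab: "norm (b - a) < d (k n)"
          have na: "norm a \<le> \<rho>" "norm b \<le> \<rho>" using a b seg v w by blast+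
          let ?Q = "(x0 + a, f (k n) a)"
          have kn: "n \<le> k n" using seq_suble[OF g(2)] by simp
          have "norm (a - v) \<le> norm (w - v)" using segment_bound1[OF a] by (simp add: norm_minus_commute)
          then have av: "norm (a - v) < \<delta>" using w by simp
          have "dist ?Q ?P \<le> norm (a - v) + norm (f (k n) a - g v)"
            using norm_Pair_le[of "a - v" "f (k n) a - g v"] by (simp add: dist_norm)
          also have "norm (f (k n) a - g v) \<le> norm (f (k n) a - f (k n) v) + norm (f (k n) v - g v)"
            using norm_triangle_ineq[of "f (k n) a - f (k n) v" "f (k n) v - g v"] by simp
          also have "norm (f (k n) a - f (k n) v) \<le> (C + t) * norm (a - v)" by (rule lip[OF v na(1)])
          finally have "dist ?Q ?P \<le> (1 + C + t) * norm (a - v) + norm (f (k n) v - g v)" by (simp add: algebra_simps)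
          also have "\<dots> < (1 + C + t) * \<delta> + \<delta>1 / 2"
            using av Ct N1[of n] n by (intro add_strict_mono mult_strict_left_mono) auto
          finally have "dist ?Q ?P < \<delta>1" using \<delta> by simp
          then have "norm (L ?Q - L ?P) \<le> e / 3" using \<delta>1(2)[OF inK[OF na(1), of "k n"]] by (simp add: dist_norm less_imp_le)
          moreover have "norm (Lk (k n) ?Q - L ?Q) \<le> e / 3" using N2[OF _ inK[OF na(1)]] n kn by simp
          ultimately have "norm (Lk (k n) ?Q - L ?P) \<le> 2 * (e / 3)"
            using norm_triangle_ineq[of "Lk (k n) ?Q - L ?Q" "L ?Q - L ?P"] by simp
          then have "norm ((Lk (k n) ?Q - L ?P) (b - a)) \<le> 2 * (e / 3) * norm (b - a)"
            by (intro order_trans[OF norm_blinfun] mult_right_mono) auto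
          moreover have "norm (f (k n) b - f (k n) a - Lk (k n) ?Q (b - a)) \<le> (e / 3) * norm (b - a)"
          proof -
            have "\<tau> (k n) \<le> e / 3" using N3[of "k n"] n kn by simp
            then show ?thesis using est[OF na ab] mult_right_mono[of "\<tau> (k n)" "e / 3" "norm (b - a)"] by simp
          qed
          moreover have "norm (f (k n) b - f (k n) a - L ?P (b - a))
              \<le> norm (f (k n) b - f (k n) a - Lk (k n) ?Q (b - a)) + norm ((Lk (k n) ?Q - L ?P) (b - a))"
            using norm_triangle_ineq[of "f (k n) b - f (k n) a - Lk (k n) ?Q (b - a)" "(Lk (k n) ?Q - L ?P) (b - a)"]
            by (simp add: blinfun.diff_left algebra_simps)
          moreover have "e / 3 * norm (b - a) + 2 * (e / 3) * norm (b - a) = e * norm (b - a)" by simp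
          ultimately show "norm (f (k n) b - f (k n) a - L ?P (b - a)) \<le> e * norm (b - a)" by linarith
        qed
        have L2: "(\<lambda>n. norm (f (k n) w - f (k n) v - L ?P (w - v))) \<longlonglongrightarrow> norm (g w - g v - L ?P (w - v))"
          by (intro tendsto_intros lim v w)
        show ?thesis by (rule LIMSEQ_le_const2[OF L2]) (intro exI[of _ "max N1 (max N2 N3)"] allI impI ev)
      qed
      then show ?thesis using \<open>0 < \<delta>\<close> by (intro exI[of _ \<delta>]) auto
    qed
    then show "(g has_derivative L ?P) (at v within cball 0 \<rho>)"
      unfolding has_derivative_within_alt using blinfun.bounded_linear_right by blast
  qed
qed

section \<open>Graphs of solutions as integral manifolds\<close>

lemma C1_on_curve:
  fixes \<gamma> :: "real \<Rightarrow> 'a::real_normed_vector"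
  assumes "\<And>t. t \<in> T \<Longrightarrow> (\<gamma> has_vector_derivative \<gamma>' t) (at t)" "continuous_on T \<gamma>'"
  shows "C1_on T \<gamma>"
  unfolding C1_on_def
proof (intro exI conjI ballI)
  show "(\<gamma> has_derivative blinfun_apply (blinfun_scaleR_left (\<gamma>' t))) (at t)" if "t \<in> T" for t
    using assms(1)[OF that] by (simp add: has_vector_derivative_def blinfun_scaleR_left.rep_eq)
  show "continuous_on T (\<lambda>t. blinfun_scaleR_left (\<gamma>' t))"
    by (rule bounded_linear.continuous_on[OF bounded_linear_blinfun_scaleR_left assms(2)])
qed

text \<open>With \<open>c = -1\<close> the shear flattens the graph of \<open>G\<close>, and with
  \<open>c = 1\<close> it undoes this; together they form a submanifold chart.\<close>

lemma C1_on_shear: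
  fixes G :: "'a::real_normed_vector \<Rightarrow> 'b::real_normed_vector" and G' :: "'a \<Rightarrow> 'a \<Rightarrow>\<^sub>L 'b"
  assumes der: "\<And>x. x \<in> B \<Longrightarrow> (G has_derivative blinfun_apply (G' x)) (at x)" and cont: "continuous_on B G'"
  shows "C1_on (B \<times> UNIV) (\<lambda>p. (fst p, snd p + c *\<^sub>R G (fst p)))"
  unfolding C1_on_def
proof (intro exI conjI ballI)
  let ?fst = "Blinfun fst :: ('a \<times> 'b) \<Rightarrow>\<^sub>L 'a" and ?inr = "Blinfun (\<lambda>w. (0, w)) :: 'b \<Rightarrow>\<^sub>L ('a \<times> 'b)"
  let ?\<phi>' = "\<lambda>p. id_blinfun + c *\<^sub>R (?inr o\<^sub>L (G' (fst p) o\<^sub>L ?fst))"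
  have f: "blinfun_apply ?fst = fst" by (simp add: bounded_linear_Blinfun_apply bounded_linear_fst)
  have "bounded_linear (\<lambda>w :: 'b. (0 :: 'a, w))" by (intro bounded_linear_Pair bounded_linear_zero bounded_linear_ident)
  then have i: "blinfun_apply ?inr w = (0, w)" for w by (simp add: bounded_linear_Blinfun_apply)
  show "((\<lambda>p. (fst p, snd p + c *\<^sub>R G (fst p))) has_derivative blinfun_apply (?\<phi>' p)) (at p)" if "p \<in> B \<times> UNIV" for p
  proof -
    have "fst p \<in> B" using that by auto
    have "((\<lambda>p :: 'a \<times> 'b. G (fst p)) has_derivative (\<lambda>h. G' (fst p) (fst h))) (at p)"
      by (rule has_derivative_compose[OF has_derivative_fst[OF has_derivative_ident] der[OF \<open>fst p \<in> B\<close>]])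
    then have "((\<lambda>p. (fst p, snd p + c *\<^sub>R G (fst p))) has_derivative (\<lambda>h. (fst h, snd h + c *\<^sub>R G' (fst p) (fst h)))) (at p)"
      by (intro has_derivative_Pair has_derivative_add has_derivative_scaleR_right has_derivative_fst has_derivative_snd has_derivative_ident)
    moreover have "(\<lambda>h. (fst h, snd h + c *\<^sub>R G' (fst p) (fst h))) = blinfun_apply (?\<phi>' p)"
      by (rule ext) (simp add: blinfun.add_left blinfun.scaleR_left f i prod_eq_iff)
    ultimately show ?thesis by simp
  qed
  have "continuous_on (B \<times> (UNIV :: 'b set)) (\<lambda>p. G' (fst p))"
    by (rule continuous_on_compose2[OF cont continuous_on_fst[OF continuous_on_id]]) auto
  then show "continuous_on (B \<times> (UNIV :: 'b set)) ?\<phi>'"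
    by (intro continuous_on_add continuous_on_const continuous_on_scaleR
        bounded_bilinear.continuous_on[OF bounded_bilinear_blinfun_compose])
qed

lemma tangent_spaceE:
  assumes "v \<in> tangent_space N q"
  obtains \<delta> \<gamma> where "0 < \<delta>" "\<gamma> ` {-\<delta><..<\<delta>} \<subseteq> N" "\<gamma> 0 = q" "(\<gamma> has_vector_derivative v) (at (0 :: real))"
  using assms unfolding tangent_space_def by blast

lemma tangent_spaceI:
  assumes "0 < \<delta>" "C1_on {-\<delta><..<\<delta>} \<gamma>" "\<gamma> ` {-\<delta><..<\<delta>} \<subseteq> N" "\<gamma> 0 = q" "(\<gamma> has_vector_derivative v) (at (0 :: real))"
  shows "v \<in> tangent_space N q"
  using assms unfolding tangent_space_def by blast

lemma C1_submanifold_of_chart: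
  fixes \<phi> \<psi> :: "('m::finite, 'n::finite) pt \<Rightarrow> ('m, 'n) pt"
  assumes "open W" "N \<subseteq> W" "open Z" "homeomorphism W Z \<phi> \<psi>" "C1_on W \<phi>" "C1_on Z \<psi>"
    "\<phi> ` (N \<inter> W) = {z \<in> Z. snd z = 0}"
  shows "C1_submanifold N"
  unfolding C1_submanifold_def
  by (rule ballI, rule exI[of _ W], rule exI[of _ Z], rule exI[of _ \<phi>], rule exI[of _ \<psi>])
    (use assms in blast)

text \<open>Curves in the graph have velocities in the graph of the derivative by the chain rule,
  and lifting straight lines realises all of these. The derivative of \<open>G\<close> is continuous
  because it is the slope along the graph.\<close>

lemma graph_integral_manifold:
  fixes E :: "('m::finite, 'n::finite) distribution" and G :: "real ^ 'm \<Rightarrow> real ^ 'n"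
  assumes "open B" and inU: "\<And>x. x \<in> B \<Longrightarrow> (x, G x) \<in> U"
    and der: "\<And>x. x \<in> B \<Longrightarrow> (G has_derivative blinfun_apply (slope E (x, G x))) (at x)"
    and cont: "continuous_on U (slope E)"
    and graph: "\<And>p. p \<in> U \<Longrightarrow> E p = range (lift_vector (slope E) p)"
  shows "integral_manifold U E ((\<lambda>x. (x, G x)) ` B)"
proof -
  let ?N = "(\<lambda>x. (x, G x)) ` B" and ?G' = "\<lambda>x. slope E (x, G x)"
  have contG: "continuous_on B G"
    using der by (meson continuous_at_imp_continuous_on has_derivative_continuous)
  have contG': "continuous_on B ?G'"
    by (rule continuous_on_compose2[OF cont]) (use inU contG in \<open>auto intro!: continuous_on_Pair continuous_on_id\<close>)
  have "C1_submanifold ?N"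
  proof -
    let ?W = "B \<times> (UNIV :: (real ^ 'n) set)"
    let ?\<phi> = "\<lambda>p. (fst p, snd p + (-1) *\<^sub>R G (fst p))" and ?\<psi> = "\<lambda>p. (fst p, snd p + 1 *\<^sub>R G (fst p))"
    have C1: "C1_on ?W ?\<phi>" "C1_on ?W ?\<psi>" using C1_on_shear[OF der contG', of "-1"] C1_on_shear[OF der contG', of 1] by blast+
    have cG: "continuous_on ?W (\<lambda>p. G (fst p))"
      by (rule continuous_on_compose2[OF contG continuous_on_fst[OF continuous_on_id]]) auto
    have c\<phi>: "continuous_on ?W ?\<phi>" "continuous_on ?W ?\<psi>"
      by (intro continuous_on_Pair continuous_on_add continuous_on_scaleR continuous_on_const
          continuous_on_fst continuous_on_snd continuous_on_id cG)+
    have "homeomorphism ?W ?W ?\<phi> ?\<psi>"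
      by (rule homeomorphismI[OF c\<phi>]) auto
    moreover have "?\<phi> ` (?N \<inter> ?W) = {z \<in> ?W. snd z = 0}"
    proof (intro equalityI subsetI)
      fix z assume "z \<in> {z \<in> ?W. snd z = 0}"
      then have "z = ?\<phi> (fst z, G (fst z))" "(fst z, G (fst z)) \<in> ?N \<inter> ?W" by (auto simp: prod_eq_iff)
      then show "z \<in> ?\<phi> ` (?N \<inter> ?W)" by (rule image_eqI)
    qed auto
    moreover have "open ?W" using \<open>open B\<close> by (simp add: open_Times)
    moreover have "?N \<subseteq> ?W" by auto
    ultimately show ?thesis using C1 by (intro C1_submanifold_of_chart[of ?W ?N ?W ?\<phi> ?\<psi>])
  qed
  moreover have "tangent_space ?N q = E q" if q: "q \<in> ?N" for q
  proof -
    obtain x where x: "x \<in> B" "q = (x, G x)" using q by blast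
    have Eq: "E q = range (lift_vector (slope E) q)" using graph inU x by blast
    show ?thesis
    proof (intro equalityI subsetI)
      fix v assume "v \<in> tangent_space ?N q"
      then obtain \<delta> \<gamma> where \<gamma>: "\<delta> > 0" "\<gamma> ` {-\<delta><..<\<delta>} \<subseteq> ?N" "\<gamma> 0 = q" "(\<gamma> has_vector_derivative v) (at (0::real))"
        by (rule tangent_spaceE)
      have sg: "snd (\<gamma> t) = G (fst (\<gamma> t))" if "t \<in> {-\<delta><..<\<delta>}" for t
      proof -
        have "\<gamma> t \<in> ?N" using \<gamma>(2) that by blast
        then show ?thesis by auto
      qed
      have f: "((\<lambda>t. fst (\<gamma> t)) has_derivative (\<lambda>h. fst (h *\<^sub>R v))) (at 0)"
        using \<gamma>(4) unfolding has_vector_derivative_def by (rule has_derivative_fst)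
      have s: "((\<lambda>t. snd (\<gamma> t)) has_derivative (\<lambda>h. snd (h *\<^sub>R v))) (at 0)"
        using \<gamma>(4) unfolding has_vector_derivative_def by (rule has_derivative_snd)
      have "(G has_derivative blinfun_apply (slope E q)) (at (fst (\<gamma> 0)))" using der[OF x(1)] x \<gamma>(3) by simp
      from has_derivative_compose[OF f this]
      have "((\<lambda>t. G (fst (\<gamma> t))) has_derivative (\<lambda>h. slope E q (fst (h *\<^sub>R v)))) (at 0)" .
      then have "((\<lambda>t. snd (\<gamma> t)) has_derivative (\<lambda>h. slope E q (fst (h *\<^sub>R v)))) (at 0)"
        by (rule has_derivative_transform_within_open[where s = "{-\<delta><..<\<delta>}"]) (use \<gamma>(1) sg in auto)
      from has_derivative_unique[OF s this] have "snd (1 *\<^sub>R v) = slope E q (fst (1 *\<^sub>R v))" by (rule fun_cong)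
      then have "v = lift_vector (slope E) q (fst v)" by (simp add: lift_vector_def prod_eq_iff)
      then show "v \<in> E q" unfolding Eq by (rule range_eqI)
    next
      fix v assume "v \<in> E q"
      then obtain u where u: "v = lift_vector (slope E) q u" using Eq by blast
      obtain e where e: "e > 0" "ball x e \<subseteq> B" using \<open>open B\<close> x(1) open_contains_ball by blast
      \<comment> \<open>The summand 1 covers \<open>u = 0\<close>.\<close>
      define \<delta> where "\<delta> = e / (norm u + 1)"
      have n1: "0 < norm u + 1" by (simp add: add_nonneg_pos)
      then have "0 < \<delta>" using e by (simp add: \<delta>_def)
      define \<gamma> where "\<gamma> t = (x + t *\<^sub>R u, G (x + t *\<^sub>R u))" for t
      have inB: "x + t *\<^sub>R u \<in> B" if "t \<in> {-\<delta><..<\<delta>}" for t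
      proof -
        have "\<bar>t\<bar> * norm u \<le> \<bar>t\<bar> * (norm u + 1)" by (intro mult_left_mono) auto
        also have "\<dots> < \<delta> * (norm u + 1)" using that n1 by (intro mult_strict_right_mono) auto
        also have "\<dots> = e" using n1 by (simp add: \<delta>_def)
        finally show ?thesis using e(2) by (auto simp: dist_norm)
      qed
      have d\<gamma>: "(\<gamma> has_vector_derivative (u, slope E (\<gamma> t) u)) (at t)" if "t \<in> {-\<delta><..<\<delta>}" for t
      proof -
        have l: "((\<lambda>t. x + t *\<^sub>R u) has_derivative (\<lambda>h. h *\<^sub>R u)) (at t)"
          by (auto intro!: derivative_eq_intros)
        have "((\<lambda>t. G (x + t *\<^sub>R u)) has_derivative (\<lambda>h. slope E (\<gamma> t) (h *\<^sub>R u))) (at t)"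
          unfolding \<gamma>_def by (rule has_derivative_compose[OF l der[OF inB[OF that]]])
        from has_derivative_Pair[OF l this] show ?thesis
          unfolding has_vector_derivative_def \<gamma>_def by (simp add: blinfun.scaleR_right)
      qed
      have c\<gamma>: "continuous_on {-\<delta><..<\<delta>} \<gamma>"
        using d\<gamma> by (meson continuous_at_imp_continuous_on has_vector_derivative_continuous)
      have "continuous_on {-\<delta><..<\<delta>} (\<lambda>t. slope E (\<gamma> t))"
        by (rule continuous_on_compose2[OF cont c\<gamma>]) (use inB inU in \<open>auto simp: \<gamma>_def\<close>)
      then have c: "continuous_on {-\<delta><..<\<delta>} (\<lambda>t. (u, slope E (\<gamma> t) u))"
        by (intro continuous_on_Pair continuous_on_const bounded_bilinear.continuous_on[OF bounded_bilinear_blinfun_apply])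
      have "C1_on {-\<delta><..<\<delta>} \<gamma>" by (rule C1_on_curve[OF _ c]) (rule d\<gamma>)
      moreover have "\<gamma> ` {-\<delta><..<\<delta>} \<subseteq> ?N" using inB by (auto simp: \<gamma>_def)
      moreover have "\<gamma> 0 = q" by (simp add: \<gamma>_def x)
      moreover have "(\<gamma> has_vector_derivative v) (at 0)"
        using d\<gamma>[of 0] \<open>0 < \<delta>\<close> by (simp add: u lift_vector_def \<gamma>_def x)
      ultimately show "v \<in> tangent_space ?N q" by (rule tangent_spaceI[OF \<open>0 < \<delta>\<close>])
    qed
  qed
  ultimately show ?thesis unfolding integral_manifold_def using inU by blast
qed

lemma obtain_box:
  fixes U :: "('a::euclidean_space \<times> 'b::euclidean_space) set"
  assumes "open U" "(x0, y0) \<in> U"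
  obtains r where "0 < r" "cball x0 r \<times> cball y0 r \<subseteq> U"
proof -
  obtain e where e: "0 < e" "ball (x0, y0) e \<subseteq> U" using assms open_contains_ball by blast
  show ?thesis
  proof (rule that[of "e / 3"])
    show "cball x0 (e / 3) \<times> cball y0 (e / 3) \<subseteq> U"
    proof (clarify)
      fix x y assume "x \<in> cball x0 (e / 3)" "y \<in> cball y0 (e / 3)"
      then have "dist (x0, y0) (x, y) \<le> e / 3 + e / 3"
        using norm_Pair_le[of "x0 - x" "y0 - y"] by (simp add: dist_norm)
      then show "(x, y) \<in> U" using e by auto
    qed
  qed (use e in simp)
qed

text \<open>One constant \<open>C\<close> serves \<open>E\<close> and all late approximations:
  uniform convergence eventually puts their slopes within 1 of that of \<open>E\<close>.\<close>

lemma approximating_box: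
  fixes E :: "('m::finite, 'n::finite) distribution"
  assumes "open U" and cs: "continuous_subbundle U E" and tr: "transverse_to_vertical U E"
    and ap: "approximating_sequence U E Ek" and p: "(x0, y0) \<in> U"
  obtains r C N where "0 < r" "cball x0 r \<times> cball y0 r \<subseteq> U" "0 \<le> C"
    "\<And>p. p \<in> cball x0 r \<times> cball y0 r \<Longrightarrow> norm (slope E p) \<le> C"
    "\<And>k p. k \<ge> N \<Longrightarrow> p \<in> cball x0 r \<times> cball y0 r \<Longrightarrow> norm (slope (Ek k) p) \<le> C"
    "\<And>e. 0 < e \<Longrightarrow> \<exists>N. \<forall>k\<ge>N. \<forall>p\<in>cball x0 r \<times> cball y0 r. norm (slope (Ek k) p - slope E p) \<le> e"
proof -
  obtain r where r: "0 < r" "cball x0 r \<times> cball y0 r \<subseteq> U" by (rule obtain_box[OF \<open>open U\<close> p])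
  let ?K = "cball x0 r \<times> cball y0 r"
  have "compact ?K" by (intro compact_Times compact_cball)
  then obtain C where C: "0 < C" "\<And>p. p \<in> ?K \<Longrightarrow> norm (slope E p) \<le> C"
    using compact_bounded_image[OF continuous_on_slope[OF cs tr] _ r(2)] by blast
  have conv: "converges_in_angle U Ek E"
    and gk: "\<And>k p. p \<in> U \<Longrightarrow> Ek k p = range (lift_vector (slope (Ek k)) p)"
    using ap C1_subbundle_graph unfolding approximating_sequence_def by blast+
  have unif: "\<exists>N. \<forall>k\<ge>N. \<forall>p\<in>?K. norm (slope (Ek k) p - slope E p) \<le> e" if "0 < e" for e
    using slope_uniform_limit[OF conv r(2) continuous_subbundle_graph[OF cs tr] gk C(2) less_imp_le[OF C(1)] that]
    by metis
  obtain N where N: "\<And>k p. k \<ge> N \<Longrightarrow> p \<in> ?K \<Longrightarrow> norm (slope (Ek k) p - slope E p) \<le> 1"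
    using unif[OF zero_less_one] by metis
  show ?thesis
  proof (rule that[of r "C + 1" N])
    show "norm (slope E p) \<le> C + 1" if "p \<in> ?K" for p using C(2)[OF that] by simp
    show "norm (slope (Ek k) p) \<le> C + 1" if "k \<ge> N" "p \<in> ?K" for k p
      using N[OF that] C(2)[OF that(2)] norm_triangle_sub[of "slope (Ek k) p" "slope E p"] by linarith
  qed (use r C unif in auto)
qed

theorem asymptotically_involutive_imp_integrable:
  fixes E :: "('m::finite, 'n::finite) distribution"
  assumes "open U" and cs: "continuous_subbundle U E" and tr: "transverse_to_vertical U E"
    and inv: "asymptotically_involutive U E"
  shows "integrable_distribution U E"
  unfolding integrable_distribution_def
proof
  fix p assume "p \<in> U"
  obtain x0 y0 where p: "p = (x0, y0)" by fastforce
  obtain Ek \<epsilon> s V A where ap: "approximating_sequence U E Ek" and "0 < \<epsilon>"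
    and cov: "\<And>k. compatible_cover U (Ek k) (s k) (V k) (A k)"
    and lim: "(\<lambda>k. MAX (i, j, l) \<in> {1..s k} \<times> {1..s k} \<times> {1..s k}.
          d_sup_norm (V k i) (Ek k) (A k i) * inv_sup_norm (V k j) (A k j) *
          exp_ennreal (ennreal \<epsilon> * M_const (V k l) (Ek k) (A k l))) \<longlonglongrightarrow> 0"
    using inv unfolding asymptotically_involutive_def by (elim exE conjE) blast
  define T where "T k = (MAX (i, j, l) \<in> {1..s k} \<times> {1..s k} \<times> {1..s k}.
          d_sup_norm (V k i) (Ek k) (A k i) * inv_sup_norm (V k j) (A k j) *
          exp_ennreal (ennreal \<epsilon> * M_const (V k l) (Ek k) (A k l)))" for k
  have "T \<longlonglongrightarrow> 0" using lim unfolding T_def .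
  obtain r C N where r: "0 < r" "cball x0 r \<times> cball y0 r \<subseteq> U" and C: "0 \<le> C"
    "\<And>p. p \<in> cball x0 r \<times> cball y0 r \<Longrightarrow> norm (slope E p) \<le> C"
    "\<And>k p. k \<ge> N \<Longrightarrow> p \<in> cball x0 r \<times> cball y0 r \<Longrightarrow> norm (slope (Ek k) p) \<le> C"
    and unif: "\<And>e. 0 < e \<Longrightarrow> \<exists>N. \<forall>k\<ge>N. \<forall>p\<in>cball x0 r \<times> cball y0 r. norm (slope (Ek k) p - slope E p) \<le> e"
    using approximating_box[OF \<open>open U\<close> cs tr ap] \<open>p \<in> U\<close> unfolding p by metis
  define K where "K = cball x0 r \<times> cball y0 r"
  have K: "compact K" "K \<subseteq> U" "K \<noteq> {}" using r unfolding K_def by (auto intro: compact_Times)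
  obtain N1 where N1: "\<And>k. k \<ge> N1 \<Longrightarrow> T k < top"
    using order_tendstoD(2)[OF \<open>T \<longlonglongrightarrow> 0\<close>, of top] unfolding eventually_sequentially by auto
  define N2 where "N2 = max N N1"
  \<comment> \<open>The bound by \<open>r / (1 + C)\<close> keeps the polygons in the box; the bound
    by \<open>\<epsilon> / (1 + C)\<close> lets \<open>exp (\<epsilon> * M)\<close> dominate the
    growth factor \<open>exp (M * ((1 + C) * \<rho>))\<close>.\<close>
  define \<rho> where "\<rho> = min r (min (r / (1 + C)) (\<epsilon> / (1 + C)))"
  have "0 < \<rho>" "\<rho> \<le> r" using r C \<open>0 < \<epsilon>\<close> by (auto simp: \<rho>_def)
  have "\<rho> \<le> r / (1 + C)" "\<rho> \<le> \<epsilon> / (1 + C)" by (auto simp: \<rho>_def)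
  then have \<rho>: "(1 + C) * \<rho> \<le> r" "(1 + C) * \<rho> \<le> \<epsilon>" using C(1) by (simp_all add: field_simps)
  then have "C * \<rho> \<le> r" using \<open>0 < \<rho>\<close> by (simp add: distrib_right)
  define l where "l = (1 + C) * \<rho> * (1 + C)"
  have "0 \<le> l" using C(1) \<open>0 < \<rho>\<close> by (simp add: l_def)
  \<comment> \<open>The index is shifted so that the slope bound and the finiteness of
    \<open>T\<close> hold from the start; \<open>1 / real (Suc k)\<close> is the freely chosen error
    \<open>e\<close> of \<open>euler_surface\<close>.\<close>
  define \<tau> where "\<tau> k = enn2real (T (k + N2)) * l + 1 / real (Suc k)" for k
  define Lk where "Lk k = slope (Ek (k + N2))" for k
  define P where "P k f d \<longleftrightarrow> 0 < d \<and> f 0 = y0 \<and> (\<forall>v. norm v \<le> \<rho> \<longrightarrow> (x0 + v, f v) \<in> K) \<and>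
    (\<forall>v v'. norm v \<le> \<rho> \<longrightarrow> norm v' \<le> \<rho> \<longrightarrow> norm (v' - v) < d \<longrightarrow>
      norm (f v' - f v - Lk k (x0 + v, f v) (v' - v)) \<le> \<tau> k * norm (v' - v))" for k f d
  have "\<exists>f d. P k f d" for k
  proof -
    let ?k = "k + N2"
    have "?k \<ge> N" "?k \<ge> N1" by (auto simp: N2_def)
    have C1: "C1_subbundle U (Ek ?k)" "transverse_to_vertical U (Ek ?k)"
      using ap unfolding approximating_sequence_def by blast+
    obtain Kc S M D where fb: "framed_bundle K (slope (Ek ?k)) {1..s ?k} Kc (V ?k) (A ?k) C S M D"
      and SMD: "S * exp (\<epsilon> * M) * D \<le> enn2real (T ?k)"
      unfolding T_def
      by (rule involutive_framed_bundle[OF cov C1 K C(3)[folded K_def, OF \<open>?k \<ge> N\<close>] C(1) \<open>0 < \<epsilon>\<close> N1[unfolded T_def, OF \<open>?k \<ge> N1\<close>]])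
    interpret framed_bundle K "slope (Ek ?k)" "{1..s ?k}" Kc "V ?k" "A ?k" C S M D by fact
    have "(0::real) < 1 / real (Suc k)" by simp
    from euler_surface[OF K_def \<open>0 < \<rho>\<close> \<open>\<rho> \<le> r\<close> \<open>C * \<rho> \<le> r\<close> this]
    obtain f d where f: "0 < d" "f 0 = y0" "\<And>v. norm v \<le> \<rho> \<Longrightarrow> (x0 + v, f v) \<in> K"
      "\<And>v v'. \<lbrakk>norm v \<le> \<rho>; norm v' \<le> \<rho>; norm (v' - v) < d\<rbrakk> \<Longrightarrow>
      norm (f v' - f v - slope (Ek ?k) (x0 + v, f v) (v' - v))
        \<le> (S * exp (M * ((1 + C) * \<rho>)) * D * ((1 + C) * \<rho> * (1 + C)) + 1 / real (Suc k)) * norm (v' - v)"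
      by blast
    have "S * exp (M * ((1 + C) * \<rho>)) * D \<le> S * exp (\<epsilon> * M) * D"
      using \<rho>(2) nonneg by (intro mult_right_mono mult_left_mono) (auto simp: mult.commute[of M] intro: mult_right_mono)
    then have "S * exp (M * ((1 + C) * \<rho>)) * D * l \<le> enn2real (T ?k) * l"
      using SMD \<open>0 \<le> l\<close> by (intro mult_right_mono) auto
    then have \<tau>: "S * exp (M * ((1 + C) * \<rho>)) * D * ((1 + C) * \<rho> * (1 + C)) + 1 / real (Suc k) \<le> \<tau> k"
      by (simp add: \<tau>_def l_def)
    have "norm (f v' - f v - Lk k (x0 + v, f v) (v' - v)) \<le> \<tau> k * norm (v' - v)"
      if "norm v \<le> \<rho>" "norm v' \<le> \<rho>" "norm (v' - v) < d" for v v'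
      using f(4)[OF that] mult_right_mono[OF \<tau> norm_ge_zero[of "v' - v"]] unfolding Lk_def by linarith
    then show ?thesis unfolding P_def using f(1-3) by (intro exI[of _ f] exI[of _ d]) simp
  qed
  then obtain f d where Pfd: "\<And>k. P k (f k) (d k)" by metis
  have f1: "(x0 + v, f k v) \<in> K" if "norm v \<le> \<rho>" for k v using Pfd[of k] that unfolding P_def by blast
  have f2: "f k 0 = y0" "0 < d k" for k using Pfd[of k] unfolding P_def by blast+
  have f3: "norm (f k v' - f k v - Lk k (x0 + v, f k v) (v' - v)) \<le> \<tau> k * norm (v' - v)"
    if "norm v \<le> \<rho>" "norm v' \<le> \<rho>" "norm (v' - v) < d k" for k v v'
    using Pfd[of k] that unfolding P_def by blast
  have "\<tau> \<longlonglongrightarrow> 0"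
  proof -
    have "(\<lambda>k. enn2real (T k)) \<longlonglongrightarrow> 0"
      using tendsto_enn2real[of T 0 sequentially] \<open>T \<longlonglongrightarrow> 0\<close> by simp
    then have l1: "(\<lambda>k. enn2real (T (k + N2))) \<longlonglongrightarrow> 0" by (rule LIMSEQ_ignore_initial_segment)
    have l2: "(\<lambda>k. 1 / real (Suc k)) \<longlonglongrightarrow> 0" using LIMSEQ_inverse_real_of_nat by (simp add: inverse_eq_divide)
    show ?thesis
      using tendsto_add[OF tendsto_mult[OF l1 tendsto_const[of l]] l2] unfolding \<tau>_def by simp
  qed
  have contE: "continuous_on U (slope E)" by (rule continuous_on_slope[OF cs tr])
  have LkE: "\<exists>N. \<forall>k\<ge>N. \<forall>p\<in>K. norm (Lk k p - slope E p) \<le> e" if e: "0 < e" for e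
  proof -
    obtain N' where "\<forall>k\<ge>N'. \<forall>p\<in>K. norm (slope (Ek k) p - slope E p) \<le> e" using unif[OF e] unfolding K_def by blast
    then show ?thesis unfolding Lk_def by (intro exI[of _ N']) auto
  qed
  have LkC: "norm (Lk k p) \<le> C" if "p \<in> K" for k p
    unfolding Lk_def using C(3)[of "k + N2" p] that by (simp add: N2_def K_def)
  obtain g where g: "g 0 = y0" "\<And>v. norm v \<le> \<rho> \<Longrightarrow> (x0 + v, g v) \<in> K"
    "\<And>v. norm v \<le> \<rho> \<Longrightarrow> (g has_derivative slope E (x0 + v, g v)) (at v within cball 0 \<rho>)"
    by (rule approximate_solutions_limit[OF K(1) \<open>0 < \<rho>\<close> f1 f2(1) continuous_on_subset[OF contE K(2)] LkE LkC \<open>\<tau> \<longlonglongrightarrow> 0\<close> f2(2) f3])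
      (assumption | (erule that, blast+))+
  \<comment> \<open>The surfaces are parametrised by the displacement \<open>v\<close> from
    \<open>x0\<close>; \<open>G\<close> returns to the coordinate \<open>x\<close>.\<close>
  define G where "G x = g (x - x0)" for x
  have "integral_manifold U E ((\<lambda>x. (x, G x)) ` ball x0 \<rho>)"
  proof (rule graph_integral_manifold[OF open_ball _ _ contE continuous_subbundle_graph[OF cs tr]])
    fix x assume x: "x \<in> ball x0 \<rho>"
    let ?v = "x - x0"
    have v: "?v \<in> ball 0 \<rho>" using x by (simp add: dist_norm norm_minus_commute)
    show "(x, G x) \<in> U" using g(2)[of ?v] v K(2) by (auto simp: G_def)
    have "(g has_derivative slope E (x, G x)) (at ?v within cball 0 \<rho>)" using g(3)[of ?v] v by (simp add: G_def)
    moreover have "?v \<in> interior (cball 0 \<rho>)" using v by simp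
    ultimately have "(g has_derivative slope E (x, G x)) (at ?v)" by (metis at_within_interior)
    moreover have "((\<lambda>x. x - x0) has_derivative (\<lambda>h. h - 0)) (at x)"
      by (intro has_derivative_diff has_derivative_ident has_derivative_const)
    then have "((\<lambda>x. x - x0) has_derivative (\<lambda>h. h)) (at x)" by simp
    ultimately show "(G has_derivative blinfun_apply (slope E (x, G x))) (at x)"
      unfolding G_def by (rule has_derivative_compose[rotated])
  qed
  moreover have "p \<in> (\<lambda>x. (x, G x)) ` ball x0 \<rho>" using \<open>0 < \<rho>\<close> g(1) by (auto simp: p G_def)
  ultimately show "\<exists>N. integral_manifold U E N \<and> p \<in> N" by blast
qed

section \<open>Uniqueness of integral manifolds\<close>

text \<open>Over the segment from \<open>x0\<close> to \<open>x\<close> both solutions are curves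
  tangent to \<open>E\<close>, hence almost tangent to the approximations, and both are tracked by
  the same polygon from \<open>(x0, y0)\<close>. The index type \<open>bool\<close> allows one
  treatment of the two.\<close>

lemma unique_solution_germ:
  fixes E :: "('m::finite, 'n::finite) distribution" and f :: "bool \<Rightarrow> real ^ 'm \<Rightarrow> real ^ 'n"
  assumes "open U" and cs: "continuous_subbundle U E" and tr: "transverse_to_vertical U E"
    and reg: "exterior_regular U E" and p: "(x0, y0) \<in> U" and "0 < \<rho>0"
    and der: "\<And>b x. x \<in> ball x0 \<rho>0 \<Longrightarrow> (f b has_derivative blinfun_apply (slope E (x, f b x))) (at x)"
    and init: "\<And>b. f b x0 = y0"
  obtains \<rho> where "0 < \<rho>" "\<rho> \<le> \<rho>0" "\<And>x. x \<in> ball x0 \<rho> \<Longrightarrow> f True x = f False x"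
proof -
  obtain Ek \<epsilon> s V B where ap: "approximating_sequence U E Ek" and "0 < \<epsilon>"
    and cov: "\<And>k. compatible_cover U (Ek k) (s k) (V k) (B k)"
    and lim: "(\<lambda>k. MAX (i, j, l) \<in> {1..s k} \<times> {1..s k} \<times> {1..s k}.
          restr_sup_norm (V k i) E (B k i) * inv_sup_norm (V k j) (B k j) *
          exp_ennreal (ennreal \<epsilon> * M_const (V k l) (Ek k) (B k l))) \<longlonglongrightarrow> 0"
    using reg unfolding exterior_regular_def by (elim exE conjE) blast
  define T where "T k = (MAX (i, j, l) \<in> {1..s k} \<times> {1..s k} \<times> {1..s k}.
          restr_sup_norm (V k i) E (B k i) * inv_sup_norm (V k j) (B k j) *
          exp_ennreal (ennreal \<epsilon> * M_const (V k l) (Ek k) (B k l)))" for k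
  have "T \<longlonglongrightarrow> 0" using lim unfolding T_def .
  obtain r C N where r: "0 < r" "cball x0 r \<times> cball y0 r \<subseteq> U" and C: "0 \<le> C"
    "\<And>p. p \<in> cball x0 r \<times> cball y0 r \<Longrightarrow> norm (slope E p) \<le> C"
    "\<And>k p. k \<ge> N \<Longrightarrow> p \<in> cball x0 r \<times> cball y0 r \<Longrightarrow> norm (slope (Ek k) p) \<le> C"
    using approximating_box[OF \<open>open U\<close> cs tr ap p] by metis
  define K where "K = cball x0 r \<times> cball y0 r"
  have K: "compact K" "K \<subseteq> U" "K \<noteq> {}" using r unfolding K_def by (auto intro: compact_Times)
  obtain N1 where N1: "\<And>k. k \<ge> N1 \<Longrightarrow> T k < top"
    using order_tendstoD(2)[OF \<open>T \<longlonglongrightarrow> 0\<close>, of top] unfolding eventually_sequentially by auto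
  have "\<exists>d>0. \<forall>x. dist x x0 < d \<longrightarrow> dist (f b x) y0 < r / 2" for b
  proof -
    have "isCont (f b) x0" using der[of x0 b] \<open>0 < \<rho>0\<close> by (auto intro: has_derivative_continuous)
    moreover have "0 < r / 2" using r(1) by simp
    ultimately show ?thesis unfolding continuous_at_eps_delta init[of b] by blast
  qed
  then obtain d where d: "\<And>b. 0 < d b" "\<And>b x. dist x x0 < d b \<Longrightarrow> dist (f b x) y0 < r / 2" by metis
  \<comment> \<open>Half of the box is reserved for the solutions, through \<open>d True\<close> and
    \<open>d False\<close>, and half for the climb of the polygons, through
    \<open>r / (2 * (1 + C))\<close>; the last entry makes \<open>exp (\<epsilon> * M)\<close>
    dominate the growth.\<close>
  define \<rho> where "\<rho> = Min {\<rho>0, d True, d False, r, r / (2 * (1 + C)), \<epsilon> / (1 + C)}"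
  have "0 < \<rho>" unfolding \<rho>_def using \<open>0 < \<rho>0\<close> d r C \<open>0 < \<epsilon>\<close> by simp
  have \<rho>_le: "\<rho> \<le> \<rho>0" "\<rho> \<le> d True" "\<rho> \<le> d False" "\<rho> \<le> r" "\<rho> \<le> r / (2 * (1 + C))" "\<rho> \<le> \<epsilon> / (1 + C)"
    by (auto simp: \<rho>_def)
  have \<rho>: "(1 + C) * \<rho> \<le> r / 2" "(1 + C) * \<rho> \<le> \<epsilon>" using \<rho>_le(5,6) C(1) by (simp_all add: field_simps)
  then have C\<rho>: "C * \<rho> \<le> r / 2" using \<open>0 < \<rho>\<close> by (simp add: distrib_right)
  have contE: "continuous_on U (slope E)" by (rule continuous_on_slope[OF cs tr])
  have "f True x = f False x" if x: "x \<in> ball x0 \<rho>" for x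
  proof -
    define v where "v = x - x0"
    have v: "norm v < \<rho>" using x by (simp add: v_def dist_norm norm_minus_commute)
    define \<gamma> where "\<gamma> b t = (x0 + t *\<^sub>R v, f b (x0 + t *\<^sub>R v))" for b and t :: real
    have tv: "norm (t *\<^sub>R v) < \<rho>" if "t \<in> {0..1}" for t
    proof -
      have "\<bar>t\<bar> * norm v \<le> 1 * norm v" using that by (intro mult_right_mono) auto
      then show ?thesis using v by simp
    qed
    have f_close: "dist y0 (f b (x0 + t *\<^sub>R v)) \<le> r / 2" if "t \<in> {0..1}" for b t
    proof -
      have "dist (x0 + t *\<^sub>R v) x0 < d b" using tv[OF that] \<rho>_le by (cases b) (auto simp: dist_norm)
      then show ?thesis using d(2)[of "x0 + t *\<^sub>R v" b] by (simp add: dist_commute)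
    qed
    have \<gamma>K: "\<gamma> b t \<in> K" if "t \<in> {0..1}" for b t
    proof -
      have "dist x0 (x0 + t *\<^sub>R v) \<le> r" using tv[OF that] \<rho>_le(4) by (simp add: dist_norm)
      moreover have "dist y0 (f b (x0 + t *\<^sub>R v)) \<le> r" using f_close[OF that, of b] r(1) by linarith
      ultimately show ?thesis by (simp add: \<gamma>_def K_def)
    qed
    have y_der: "((\<lambda>t. f b (x0 + t *\<^sub>R v)) has_vector_derivative slope E (\<gamma> b t) v) (at t within {0..1})"
      if "t \<in> {0..1}" for b t
    proof -
      have l: "((\<lambda>t. x0 + t *\<^sub>R v) has_derivative (\<lambda>h. h *\<^sub>R v)) (at t within {0..1})"
        by (auto intro!: derivative_eq_intros)
      have "x0 + t *\<^sub>R v \<in> ball x0 \<rho>0" using tv[OF that] \<rho>_le(1) by (simp add: dist_norm)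
      from has_derivative_compose[OF l der[OF this, of b]] show ?thesis
        by (simp add: has_vector_derivative_def \<gamma>_def blinfun.scaleR_right)
    qed
    have c\<gamma>: "continuous_on {0..1} (\<gamma> b)" for b
    proof -
      have "continuous_on {0..1} (\<lambda>t. f b (x0 + t *\<^sub>R v))"
        unfolding continuous_on_eq_continuous_within by (intro ballI has_vector_derivative_continuous[OF y_der])
      then show ?thesis unfolding \<gamma>_def
        by (intro continuous_on_Pair continuous_on_add continuous_on_const continuous_on_scaleR continuous_on_id)
    qed
    have y_cont: "continuous_on {0..1} (\<lambda>t. slope E (\<gamma> b t) v)" for b
    proof -
      have "continuous_on {0..1} (\<lambda>t. slope E (\<gamma> b t))"
        by (rule continuous_on_compose2[OF contE c\<gamma>]) (rule image_subsetI, rule subsetD[OF K(2) \<gamma>K])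
      then show ?thesis
        by (intro bounded_bilinear.continuous_on[OF bounded_bilinear_blinfun_apply] continuous_on_const)
    qed
    have slope_le: "norm (v, slope E (\<gamma> b t) v) \<le> (1 + C) * \<rho>" if "t \<in> {0..1}" for b t
    proof -
      have "norm (lift_vector (slope E) (\<gamma> b t) v) \<le> (1 + C) * norm v"
        by (intro norm_lift_vector_le C(2)[folded K_def] \<gamma>K[OF that])
      also have "\<dots> \<le> (1 + C) * \<rho>" using v C(1) by (intro mult_left_mono) auto
      finally show ?thesis by (simp add: lift_vector_def)
    qed
    \<comment> \<open>For fixed \<open>k\<close> the number of steps grows until the tracking error
      \<open>e\<close> is arbitrarily small; only afterwards does \<open>k\<close> tend to
      infinity.\<close>
    have le: "norm (f True x - f False x) \<le> 2 * (enn2real (T k) * ((1 + C) * \<rho>))" if k: "k \<ge> max N N1" for k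
    proof (rule field_le_epsilon)
      fix e :: real assume "0 < e"
      have C1: "C1_subbundle U (Ek k)" "transverse_to_vertical U (Ek k)"
        using ap unfolding approximating_sequence_def by blast+
      have "k \<ge> N" "k \<ge> N1" using k by auto
      obtain Kc S M D R where fb: "framed_bundle K (slope (Ek k)) {1..s k} Kc (V k) (B k) C S M D" and "0 \<le> R"
        and SMR: "S * exp (\<epsilon> * M) * R \<le> enn2real (T k)"
        and R: "\<And>i p v. i \<in> {1..s k} \<Longrightarrow> p \<in> Kc i \<Longrightarrow> v \<in> E p \<Longrightarrow> norm (frame_map (B k i) p v) \<le> R * norm v"
        unfolding T_def
        by (rule regular_framed_bundle[where E = E,
              OF cov C1 K C(3)[folded K_def, OF \<open>k \<ge> N\<close>] C(1) \<open>0 < \<epsilon>\<close> N1[unfolded T_def, OF \<open>k \<ge> N1\<close>]])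
          (assumption | (erule that[unfolded T_def], blast+))+
      interpret framed_bundle K "slope (Ek k)" "{1..s k}" Kc "V k" "B k" C S M D by fact
      let ?c = "\<lambda>n. snd ((euler_step (slope (Ek k)) (1 / real n) v ^^ n) (x0, y0))"
      have "\<exists>n0. \<forall>n\<ge>n0. norm (f b x - ?c n) \<le> S * exp (M * ((1 + C) * \<rho>)) * (R * ((1 + C) * \<rho>)) + e / 2" for b
      proof (rule euler_tracks_curve[OF K_def \<open>0 < \<rho>\<close> \<rho>_le(4) C\<rho> less_imp_le[OF v] y_der[of _ b] y_cont[of b] f_close slope_le _ \<open>0 \<le> R\<close>])
        show "norm (frame_map (B k i) (x0 + t *\<^sub>R v, f b (x0 + t *\<^sub>R v)) (v, slope E (\<gamma> b t) v)) \<le> R * norm (v, slope E (\<gamma> b t) v)"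
          if "t \<in> {0..1}" "i \<in> {1..s k}" "(x0 + t *\<^sub>R v, f b (x0 + t *\<^sub>R v)) \<in> Kc i" for t i
        proof -
          have "\<gamma> b t \<in> U" using \<gamma>K[OF that(1)] K(2) by blast
          then have "lift_vector (slope E) (\<gamma> b t) v \<in> E (\<gamma> b t)"
            using continuous_subbundle_graph[OF cs tr] by blast
          from R[OF that(2) _ this] that(3) show ?thesis by (simp add: \<gamma>_def lift_vector_def)
        qed
        show "0 < e / 2" using \<open>0 < e\<close> by simp
      next
        fix n0 :: nat
        assume "\<And>n. n0 \<le> n \<Longrightarrow> norm (f b (x0 + 1 *\<^sub>R v) - snd ((euler_step (slope (Ek k)) (1 / real n) v ^^ n) (x0, f b (x0 + 0 *\<^sub>R v))))
          \<le> S * exp (M * ((1 + C) * \<rho>)) * (R * ((1 + C) * \<rho>)) + e / 2"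
        then show ?thesis using init[of b] by (intro exI[of _ n0]) (simp add: v_def)
      qed
      then obtain n0 where n0: "\<And>b n. n \<ge> n0 b \<Longrightarrow>
        norm (f b x - ?c n) \<le> S * exp (M * ((1 + C) * \<rho>)) * (R * ((1 + C) * \<rho>)) + e / 2" by metis
      \<comment> \<open>One common number of steps, so that both solutions are compared with
        literally the same polygon.\<close>
      define n where "n = max (n0 True) (n0 False)"
      have "norm (f True x - f False x) \<le> norm (f True x - ?c n) + norm (f False x - ?c n)"
        using norm_triangle_ineq4[of "f True x - ?c n" "f False x - ?c n"] by simp
      also have "\<dots> \<le> 2 * (S * exp (M * ((1 + C) * \<rho>)) * (R * ((1 + C) * \<rho>))) + e"
        using n0[of True n] n0[of False n] by (simp add: n_def)
      also have "S * exp (M * ((1 + C) * \<rho>)) * (R * ((1 + C) * \<rho>)) \<le> enn2real (T k) * ((1 + C) * \<rho>)"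
      proof -
        have "S * exp (M * ((1 + C) * \<rho>)) * R \<le> S * exp (\<epsilon> * M) * R"
          using \<rho>(2) nonneg \<open>0 \<le> R\<close>
          by (intro mult_right_mono mult_left_mono) (auto simp: mult.commute[of M] intro: mult_right_mono)
        then have "S * exp (M * ((1 + C) * \<rho>)) * R * ((1 + C) * \<rho>) \<le> enn2real (T k) * ((1 + C) * \<rho>)"
          using SMR nonneg \<open>0 < \<rho>\<close> by (intro mult_right_mono) auto
        then show ?thesis by (simp only: mult.assoc)
      qed
      finally show "norm (f True x - f False x) \<le> 2 * (enn2real (T k) * ((1 + C) * \<rho>)) + e" by simp
    qed
    have "(\<lambda>k. enn2real (T k)) \<longlonglongrightarrow> 0"
      using tendsto_enn2real[of T 0 sequentially] \<open>T \<longlonglongrightarrow> 0\<close> by simp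
    from tendsto_mult[OF tendsto_const[of 2] tendsto_mult[OF this tendsto_const[of "(1 + C) * \<rho>"]]]
    have "(\<lambda>k. 2 * (enn2real (T k) * ((1 + C) * \<rho>))) \<longlonglongrightarrow> 0" by simp
    from LIMSEQ_le_const[OF this] le have "norm (f True x - f False x) \<le> 0" by blast
    then show ?thesis by simp
  qed
  then show ?thesis using that \<open>0 < \<rho>\<close> \<rho>_le(1) by blast
qed

text \<open>The projection of the manifold to the first factor is a local diffeomorphism: a tangent
  vector that projects to 0 is vertical and lies in the graph \<open>E\<close>, hence vanishes. The
  inverse function theorem then solves for the parameter as a function of \<open>x\<close>.\<close>

lemma integral_manifold_local_graph:
  fixes E :: "('m::finite, 'n::finite) distribution"
  assumes im: "integral_manifold U E N" and "(x0, y0) \<in> N"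
    and graph: "\<And>p. p \<in> U \<Longrightarrow> E p = range (lift_vector (slope E) p)"
  obtains \<rho> W f where "0 < \<rho>" "open W" "(x0, y0) \<in> W"
    "\<And>p. p \<in> N \<inter> W \<Longrightarrow> fst p \<in> ball x0 \<rho> \<and> snd p = f (fst p)"
    "\<And>x. x \<in> ball x0 \<rho> \<Longrightarrow> (x, f x) \<in> N \<and> (f has_derivative blinfun_apply (slope E (x, f x))) (at x)"
proof -
  have "N \<subseteq> U" "C1_submanifold N" and tan: "\<And>q. q \<in> N \<Longrightarrow> tangent_space N q = E q"
    using im unfolding integral_manifold_def by blast+
  obtain W Z :: "('m, 'n) pt set" and \<phi> \<psi> where W: "open W" "(x0, y0) \<in> W" "open Z" and hom: "homeomorphism W Z \<phi> \<psi>"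
    and C1: "C1_on W \<phi>" "C1_on Z \<psi>" and img: "\<phi> ` (N \<inter> W) = {z \<in> Z. snd z = 0}"
    using bspec[OF \<open>C1_submanifold N\<close>[unfolded C1_submanifold_def] \<open>(x0, y0) \<in> N\<close>]
    by (elim exE conjE) (rule that; assumption)
  obtain \<psi>' where \<psi>': "\<And>z. z \<in> Z \<Longrightarrow> (\<psi> has_derivative blinfun_apply (\<psi>' z)) (at z)" "continuous_on Z \<psi>'"
    using C1(2) unfolding C1_on_def by blast
  have \<psi>\<phi>: "\<psi> (\<phi> q) = q" "\<phi> q \<in> Z" if "q \<in> W" for q
    using hom that unfolding homeomorphism_def by auto
  have \<phi>\<psi>: "\<phi> (\<psi> z) = z" "\<psi> z \<in> W" if "z \<in> Z" for z
    using hom that unfolding homeomorphism_def by auto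
  have c\<phi>: "continuous_on W \<phi>" using hom unfolding homeomorphism_def by blast
  define S where "S = {s. (s, 0) \<in> Z}"
  have "S = (\<lambda>s. (s, 0)) -` Z" by (auto simp: S_def)
  moreover have "open ((\<lambda>s. (s, 0 :: real ^ 'n)) -` Z)"
    by (intro open_vimage W(3) continuous_on_Pair continuous_on_id continuous_on_const)
  ultimately have "open S" by simp
  \<comment> \<open>Parametrisation of \<open>N \<inter> W\<close> by the flat slice of the
    chart.\<close>
  define \<sigma> where "\<sigma> s = \<psi> (s, 0)" for s
  have \<sigma>N: "\<sigma> s \<in> N" "\<sigma> s \<in> W" "\<phi> (\<sigma> s) = (s, 0)" if "s \<in> S" for s
  proof -
    have z: "(s, 0) \<in> Z" using that by (simp add: S_def)
    then have "(s, 0) \<in> \<phi> ` (N \<inter> W)" using img by auto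
    then obtain q where q: "(s, 0) = \<phi> q" "q \<in> N \<inter> W" by (rule imageE)
    then have "\<sigma> s = q" unfolding \<sigma>_def using \<psi>\<phi>(1)[of q] by simp
    then show "\<sigma> s \<in> N" "\<sigma> s \<in> W" using q by auto
    show "\<phi> (\<sigma> s) = (s, 0)" unfolding \<sigma>_def using \<phi>\<psi>(1)[OF z] .
  qed
  let ?inl = "Blinfun (\<lambda>s. (s, 0)) :: (real ^ 'm) \<Rightarrow>\<^sub>L ('m, 'n) pt"
  have "bounded_linear (\<lambda>s :: real ^ 'm. (s, 0 :: real ^ 'n))"
    by (intro bounded_linear_Pair bounded_linear_zero bounded_linear_ident)
  then have inl: "blinfun_apply ?inl w = (w, 0)" for w by (simp add: bounded_linear_Blinfun_apply)
  define \<sigma>' where "\<sigma>' s = \<psi>' (s, 0) o\<^sub>L ?inl" for s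
  have d\<sigma>: "(\<sigma> has_derivative blinfun_apply (\<sigma>' s)) (at s)" if "s \<in> S" for s
  proof -
    have "((\<lambda>s. (s, 0 :: real ^ 'n)) has_derivative (\<lambda>h. (h, 0))) (at s)"
      by (intro has_derivative_Pair has_derivative_ident has_derivative_const)
    from has_derivative_compose[OF this \<psi>'(1)] that show ?thesis
      by (simp add: \<sigma>_def[abs_def] \<sigma>'_def S_def inl blinfun_compose.rep_eq o_def)
  qed
  have c\<sigma>': "continuous_on S \<sigma>'"
    unfolding \<sigma>'_def
    by (intro bounded_bilinear.continuous_on[OF bounded_bilinear_blinfun_compose] continuous_on_const
        continuous_on_compose2[OF \<psi>'(2)] continuous_on_Pair continuous_on_id) (auto simp: S_def)
  \<comment> \<open>Images of straight lines under \<sigma> are curves in \<open>N\<close>, so the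
    range of the derivative of \<sigma> lies in the tangent space, that is in
    \<open>E\<close>.\<close>
  have tangent: "snd (\<sigma>' s w) = slope E (\<sigma> s) (fst (\<sigma>' s w))" if s: "s \<in> S" for s w
  proof -
    obtain e where e: "e > 0" "ball s e \<subseteq> S" using \<open>open S\<close> s open_contains_ball by blast
    define \<delta> where "\<delta> = e / (norm w + 1)"
    have n1: "0 < norm w + 1" by (simp add: add_nonneg_pos)
    then have "0 < \<delta>" using e by (simp add: \<delta>_def)
    have inS: "s + t *\<^sub>R w \<in> S" if "t \<in> {-\<delta><..<\<delta>}" for t
    proof -
      have "\<bar>t\<bar> * norm w \<le> \<bar>t\<bar> * (norm w + 1)" by (intro mult_left_mono) auto
      also have "\<dots> < \<delta> * (norm w + 1)" using that n1 by (intro mult_strict_right_mono) auto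
      also have "\<dots> = e" using n1 by (simp add: \<delta>_def)
      finally have "s + t *\<^sub>R w \<in> ball s e" by (simp add: dist_norm)
      then show ?thesis using e(2) by blast
    qed
    let ?\<gamma> = "\<lambda>t. \<sigma> (s + t *\<^sub>R w)"
    have d\<gamma>: "(?\<gamma> has_vector_derivative \<sigma>' (s + t *\<^sub>R w) w) (at t)" if t: "t \<in> {-\<delta><..<\<delta>}" for t
    proof -
      have l: "((\<lambda>t. s + t *\<^sub>R w) has_derivative (\<lambda>h. h *\<^sub>R w)) (at t)"
        by (auto intro!: derivative_eq_intros)
      from has_derivative_compose[OF l d\<sigma>[OF inS[OF t]]] show ?thesis
        by (simp add: has_vector_derivative_def blinfun.scaleR_right)
    qed
    have "continuous_on {-\<delta><..<\<delta>} (\<lambda>t. \<sigma>' (s + t *\<^sub>R w))"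
      by (rule continuous_on_compose2[OF c\<sigma>'])
        (intro continuous_on_add continuous_on_const continuous_on_scaleR continuous_on_id, rule image_subsetI, rule inS)
    then have c: "continuous_on {-\<delta><..<\<delta>} (\<lambda>t. \<sigma>' (s + t *\<^sub>R w) w)"
      by (intro bounded_bilinear.continuous_on[OF bounded_bilinear_blinfun_apply] continuous_on_const)
    have "\<sigma>' s w \<in> tangent_space N (\<sigma> s)"
    proof (rule tangent_spaceI[OF \<open>0 < \<delta>\<close>])
      show "C1_on {-\<delta><..<\<delta>} ?\<gamma>" by (rule C1_on_curve[OF _ c]) (rule d\<gamma>)
      show "?\<gamma> ` {-\<delta><..<\<delta>} \<subseteq> N" by (rule image_subsetI) (rule \<sigma>N(1)[OF inS])
      show "(?\<gamma> has_vector_derivative \<sigma>' s w) (at 0)" using d\<gamma>[of 0] \<open>0 < \<delta>\<close> by simp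
    qed simp
    then have "\<sigma>' s w \<in> E (\<sigma> s)" using tan[OF \<sigma>N(1)[OF s]] by simp
    moreover have "E (\<sigma> s) = range (lift_vector (slope E) (\<sigma> s))"
      by (rule graph) (use \<sigma>N(1)[OF s] \<open>N \<subseteq> U\<close> in blast)
    ultimately obtain u where "\<sigma>' s w = lift_vector (slope E) (\<sigma> s) u" by blast
    then show ?thesis by (simp add: lift_vector_def)
  qed
  obtain s0 where s0: "\<phi> (x0, y0) = (s0, 0)" "s0 \<in> S" "\<sigma> s0 = (x0, y0)"
  proof -
    have "\<phi> (x0, y0) \<in> {z \<in> Z. snd z = 0}" using img \<open>(x0, y0) \<in> N\<close> W(2) by blast
    then have "\<phi> (x0, y0) = (fst (\<phi> (x0, y0)), 0)" "fst (\<phi> (x0, y0)) \<in> S"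
      by (auto simp: S_def prod_eq_iff) (metis prod.collapse)
    moreover have "\<sigma> (fst (\<phi> (x0, y0))) = (x0, y0)"
      unfolding \<sigma>_def using calculation(1) \<psi>\<phi>(1)[OF W(2)] by simp
    ultimately show ?thesis by (rule that)
  qed
  let ?fst = "Blinfun fst :: ('m, 'n) pt \<Rightarrow>\<^sub>L (real ^ 'm)"
  have f: "blinfun_apply ?fst = fst" by (simp add: bounded_linear_Blinfun_apply bounded_linear_fst)
  define h where "h s = fst (\<sigma> s)" for s
  define h' where "h' s = ?fst o\<^sub>L \<sigma>' s" for s
  have h'_apply: "h' s w = fst (\<sigma>' s w)" for s w by (simp add: h'_def f)
  have dh: "(h has_derivative blinfun_apply (h' s)) (at s)" if "s \<in> S" for s
  proof -
    have "((\<lambda>s. fst (\<sigma> s)) has_derivative (\<lambda>w. fst (\<sigma>' s w))) (at s)" by (rule has_derivative_fst[OF d\<sigma>[OF that]])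
    moreover have "blinfun_apply (h' s) = (\<lambda>w. fst (\<sigma>' s w))" by (rule ext) (rule h'_apply)
    ultimately show ?thesis unfolding h_def[abs_def] by simp
  qed
  have ch': "continuous_on S h'"
    unfolding h'_def
    by (intro bounded_bilinear.continuous_on[OF bounded_bilinear_blinfun_compose] continuous_on_const c\<sigma>')
  have "inj (blinfun_apply (h' s0))"
  proof -
    have "w = 0" if "h' s0 w = 0" for w
    proof -
      have "fst (\<sigma>' s0 w) = 0" using that by (simp add: h'_apply)
      then have z: "\<sigma>' s0 w = 0" using tangent[OF s0(2), of w] by (simp add: prod_eq_iff blinfun.zero_right)
      \<comment> \<open>The differentiable chart \<phi> recovers the parameter from \<sigma>, so the
        derivative of \<sigma> has no kernel.\<close>
      obtain \<phi>' where "\<And>q. q \<in> W \<Longrightarrow> (\<phi> has_derivative blinfun_apply (\<phi>' q)) (at q)"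
        using C1(1) unfolding C1_on_def by blast
      then have "(\<phi> has_derivative blinfun_apply (\<phi>' (\<sigma> s0))) (at (\<sigma> s0))" using \<sigma>N(2)[OF s0(2)] by blast
      from has_derivative_compose[OF d\<sigma>[OF s0(2)] this]
      have "((\<lambda>s. \<phi> (\<sigma> s)) has_derivative (\<lambda>w. \<phi>' (\<sigma> s0) (\<sigma>' s0 w))) (at s0)" .
      then have "((\<lambda>s. (s, 0 :: real ^ 'n)) has_derivative (\<lambda>w. \<phi>' (\<sigma> s0) (\<sigma>' s0 w))) (at s0)"
        by (rule has_derivative_transform_within_open[OF _ \<open>open S\<close> s0(2)]) (rule \<sigma>N(3))
      moreover have "((\<lambda>s. (s, 0 :: real ^ 'n)) has_derivative (\<lambda>w. (w, 0))) (at s0)"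
        by (intro has_derivative_Pair has_derivative_ident has_derivative_const)
      ultimately have "(\<lambda>w. \<phi>' (\<sigma> s0) (\<sigma>' s0 w)) = (\<lambda>w. (w, 0))" by (rule has_derivative_unique)
      from fun_cong[OF this, of w] have "0 = (w, 0 :: real ^ 'n)" unfolding z blinfun.zero_right .
      then show "w = 0" by (simp add: zero_prod_def)
    qed
    then show ?thesis
      using linear_injective_0[OF bounded_linear.linear[OF blinfun.bounded_linear_right]] by blast
  qed
  then obtain k where k: "linear k" "k \<circ> blinfun_apply (h' s0) = id"
    using linear_injective_left_inverse[OF bounded_linear.linear[OF blinfun.bounded_linear_right]] by blast
  have "bounded_linear k" using k(1) by (simp add: linear_conv_bounded_linear)
  have "Blinfun k o\<^sub>L h' s0 = id_blinfun"
  proof (rule blinfun_eqI)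
    fix w
    have "k (h' s0 w) = w" using fun_cong[OF k(2), of w] by simp
    then show "(Blinfun k o\<^sub>L h' s0) w = id_blinfun w" by (simp add: bounded_linear_Blinfun_apply[OF \<open>bounded_linear k\<close>])
  qed
  from inverse_function_theorem[OF \<open>open S\<close> dh ch' s0(2) this]
  obtain S' V g g' where S': "open S'" "S' \<subseteq> S" "s0 \<in> S'" and V: "open V" "h s0 \<in> V" and homh: "homeomorphism S' V h g"
    and dg: "\<And>y. y \<in> V \<Longrightarrow> (g has_derivative (g' y)) (at y)"
    and g': "\<And>y. y \<in> V \<Longrightarrow> g' y = inv (blinfun_apply (h' (g y)))"
    and bij: "\<And>y. y \<in> V \<Longrightarrow> bij (blinfun_apply (h' (g y)))"
    by metis
  have gh: "g (h s) = s" if "s \<in> S'" for s using homh that unfolding homeomorphism_def by blast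
  have hg: "h (g y) = y" "g y \<in> S'" if "y \<in> V" for y using homh that unfolding homeomorphism_def by blast+
  have "x0 \<in> V" using V(2) s0(3) by (simp add: h_def)
  then obtain \<rho> where \<rho>: "0 < \<rho>" "ball x0 \<rho> \<subseteq> V" using V(1) open_contains_ball by blast
  define F where "F x = snd (\<sigma> (g x))" for x
  have \<sigma>g: "\<sigma> (g x) = (x, F x)" if "x \<in> V" for x
    using hg(1)[OF that] by (simp add: h_def F_def prod_eq_iff)
  \<comment> \<open>The parameter is confined to \<open>S'\<close>, where \<open>g\<close> inverts
    \<open>h\<close>, and \<open>x\<close> to the ball. Every point of \<open>N\<close> in this set
    is then a point of the graph, which the openness of intersections depends on.\<close>
  define W' where "W' = (W \<inter> \<phi> -` (S' \<times> UNIV)) \<inter> (ball x0 \<rho> \<times> UNIV)"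
  show ?thesis
  proof (rule that[OF \<rho>(1)])
    have "open (W \<inter> \<phi> -` (S' \<times> UNIV))"
      using continuous_on_open_vimage[OF W(1), of \<phi>] c\<phi> S'(1) by (metis Int_commute open_Times open_UNIV)
    then show "open W'" unfolding W'_def by (rule open_Int) (intro open_Times open_ball open_UNIV)
    show "(x0, y0) \<in> W'" unfolding W'_def using W(2) s0(1) S'(3) \<rho>(1) by simp
    fix p assume p: "p \<in> N \<inter> W'"
    then have "p \<in> N \<inter> W" and x: "fst p \<in> ball x0 \<rho>" and "fst (\<phi> p) \<in> S'" by (auto simp: W'_def)
    then have "\<phi> p \<in> {z \<in> Z. snd z = 0}" using img by blast
    then have "\<phi> p = (fst (\<phi> p), 0)" by (simp add: prod_eq_iff)
    then have "\<sigma> (fst (\<phi> p)) = p" unfolding \<sigma>_def using \<psi>\<phi>(1)[of p] \<open>p \<in> N \<inter> W\<close> by simp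
    moreover from this have "g (fst p) = fst (\<phi> p)" using gh[OF \<open>fst (\<phi> p) \<in> S'\<close>] by (simp add: h_def)
    ultimately show "fst p \<in> ball x0 \<rho> \<and> snd p = F (fst p)" using x by (simp add: F_def)
  next
    fix x assume "x \<in> ball x0 \<rho>"
    then have x: "x \<in> V" using \<rho>(2) by blast
    have gS: "g x \<in> S" using hg(2)[OF x] S'(2) by blast
    have "(F has_derivative (\<lambda>u. snd (\<sigma>' (g x) (g' x u)))) (at x)"
      unfolding F_def[abs_def] by (rule has_derivative_snd[OF has_derivative_compose[OF dg[OF x] d\<sigma>[OF gS]]])
    moreover have "snd (\<sigma>' (g x) (g' x u)) = slope E (x, F x) u" for u
    proof -
      have "fst (\<sigma>' (g x) (g' x u)) = u"
        using surj_f_inv_f[OF bij_is_surj[OF bij[OF x]], of u] by (simp add: g'[OF x] h'_apply)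
      then show ?thesis using tangent[OF gS, of "g' x u"] by (simp add: \<sigma>g[OF x])
    qed
    ultimately show "(x, F x) \<in> N \<and> (F has_derivative blinfun_apply (slope E (x, F x))) (at x)"
      using \<sigma>N(1)[OF gS] by (simp add: \<sigma>g[OF x])
  qed
qed

theorem exterior_regular_imp_uniquely_integrable:
  fixes E :: "('m::finite, 'n::finite) distribution"
  assumes "open U" and cs: "continuous_subbundle U E" and tr: "transverse_to_vertical U E"
    and "integrable_distribution U E" and reg: "exterior_regular U E"
  shows "uniquely_integrable U E"
proof -
  \<comment> \<open>Stated asymmetrically; exchanging the two manifolds gives the other
    inclusion.\<close>
  have germ: "\<exists>W. open W \<and> p \<in> W \<and> N1 \<inter> W \<subseteq> N2"
    if im: "integral_manifold U E N1" "integral_manifold U E N2" and p: "p \<in> N1" "p \<in> N2" for N1 N2 p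
  proof -
    obtain x0 y0 where xy: "p = (x0, y0)" by fastforce
    note g = continuous_subbundle_graph[OF cs tr]
    have "(x0, y0) \<in> U" using im(1) p(1) unfolding integral_manifold_def xy by blast
    obtain \<rho>1 W1 f1 where 1: "0 < \<rho>1" "open W1" "(x0, y0) \<in> W1"
      "\<And>p. p \<in> N1 \<inter> W1 \<Longrightarrow> fst p \<in> ball x0 \<rho>1 \<and> snd p = f1 (fst p)"
      "\<And>x. x \<in> ball x0 \<rho>1 \<Longrightarrow> (x, f1 x) \<in> N1 \<and> (f1 has_derivative blinfun_apply (slope E (x, f1 x))) (at x)"
      using integral_manifold_local_graph[OF im(1) p(1)[unfolded xy] g] by blast
    obtain \<rho>2 W2 f2 where 2: "0 < \<rho>2" "open W2" "(x0, y0) \<in> W2"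
      "\<And>p. p \<in> N2 \<inter> W2 \<Longrightarrow> fst p \<in> ball x0 \<rho>2 \<and> snd p = f2 (fst p)"
      "\<And>x. x \<in> ball x0 \<rho>2 \<Longrightarrow> (x, f2 x) \<in> N2 \<and> (f2 has_derivative blinfun_apply (slope E (x, f2 x))) (at x)"
      using integral_manifold_local_graph[OF im(2) p(2)[unfolded xy] g] by blast
    have init: "f1 x0 = y0" "f2 x0 = y0"
      using 1(4)[of "(x0, y0)"] 2(4)[of "(x0, y0)"] 1(3) 2(3) p by (simp_all add: xy)
    define f where "f b = (if b then f1 else f2)" for b
    have der: "(f b has_derivative blinfun_apply (slope E (x, f b x))) (at x)" if "x \<in> ball x0 (min \<rho>1 \<rho>2)" for b x
      using 1(5)[of x] 2(5)[of x] that by (cases b) (simp_all add: f_def)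
    have fi: "f b x0 = y0" for b using init by (simp add: f_def)
    have "0 < min \<rho>1 \<rho>2" using 1(1) 2(1) by simp
    obtain \<rho> where \<rho>: "0 < \<rho>" "\<rho> \<le> min \<rho>1 \<rho>2" "\<And>x. x \<in> ball x0 \<rho> \<Longrightarrow> f True x = f False x"
      using unique_solution_germ[where f = f, OF \<open>open U\<close> cs tr reg \<open>(x0, y0) \<in> U\<close> \<open>0 < min \<rho>1 \<rho>2\<close> der fi] by blast
    \<comment> \<open>Only the neighbourhood of \<open>N1\<close> enters: the points of
      \<open>N1\<close> have to lie on the graph of \<open>f1\<close>, while \<open>N2\<close>
      merely has to contain the graph of \<open>f2\<close>.\<close>
    let ?W = "W1 \<inter> (ball x0 \<rho> \<times> UNIV)"
    have "q \<in> N2" if q: "q \<in> N1 \<inter> ?W" for q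
    proof -
      have x: "fst q \<in> ball x0 \<rho>" "q \<in> N1 \<inter> W1" using q by auto
      then have "snd q = f2 (fst q)" using 1(4)[OF x(2)] \<rho>(3)[OF x(1)] by (simp add: f_def)
      moreover have "(fst q, f2 (fst q)) \<in> N2" using 2(5)[of "fst q"] x(1) \<rho>(2) by simp
      ultimately show ?thesis by (cases q) simp
    qed
    moreover have "open ?W" by (intro open_Int 1(2) open_Times open_ball open_UNIV)
    moreover have "p \<in> ?W" using 1(3) \<rho>(1) by (simp add: xy)
    ultimately show ?thesis by blast
  qed
  have op: "openin (top_of_set N1) (N1 \<inter> N2)"
    if im: "integral_manifold U E N1" "integral_manifold U E N2" for N1 N2
  proof -
    \<comment> \<open>The union of all admissible neighbourhoods shows relative openness without
      choosing one for each point.\<close>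
    let ?O = "\<Union>{W. open W \<and> N1 \<inter> W \<subseteq> N2}"
    have "N1 \<inter> N2 = N1 \<inter> ?O"
    proof (intro equalityI subsetI)
      fix p assume p: "p \<in> N1 \<inter> N2"
      then obtain W where "open W" "p \<in> W" "N1 \<inter> W \<subseteq> N2" using germ[OF im] by blast
      then show "p \<in> N1 \<inter> ?O" using p by blast
    qed blast
    moreover have "open ?O" by (rule open_Union) blast
    ultimately show ?thesis using openin_open_Int[of ?O N1] by simp
  qed
  show ?thesis
    unfolding uniquely_integrable_def
  proof (intro conjI allI impI; (elim conjE)?)
    show "openin (top_of_set N1) (N1 \<inter> N2)" if "integral_manifold U E N1" "integral_manifold U E N2" for N1 N2
      by (rule op[OF that])
    show "openin (top_of_set N2) (N1 \<inter> N2)" if "integral_manifold U E N1" "integral_manifold U E N2" for N1 N2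
      using op[OF that(2,1)] by (simp add: Int_commute)
  qed fact
qed

theorem mainTheorem1:
  fixes U :: "('m::finite, 'n::finite) pt set"
    and E :: "('m, 'n) distribution"
  assumes "open U"
    and "continuous_subbundle U E"
    and "transverse_to_vertical U E"
  shows "(asymptotically_involutive U E \<longrightarrow> integrable_distribution U E) \<and>
         (integrable_distribution U E \<and> exterior_regular U E \<longrightarrow> uniquely_integrable U E)"
  using asymptotically_involutive_imp_integrable[OF assms] exterior_regular_imp_uniquely_integrable[OF assms]
  by blast

end
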